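(* Let $N\ge 3$, and let $E$ be a Steiner bundle on $\mathbb{P}^{N-1}$ (over $\mathbb{C}$) defined by the exact sequence $$0\rightarrow \mathcal{O}(-1)^s\overset{m}{\rightarrow}\mathcal{O}^t\rightarrow E\rightarrow 0,$$ where $m$ is a generic morphism in $\operatorname{Hom}(\mathcal{O}(-1)^s,\mathcal{O}^t)$. Then the following statements are equivalent: (i) $E$ is simple, i.e. $h^0(\operatorname{End} E)=1$; (ii) $s^2-Nst+t^2\le 1$, i.e. $\chi(\operatorname{End} E)\le 1$; (iii) either $s^2-Nst+t^2\le 0$, i.e. $t\le \left(\frac{N+\sqrt{N^2-4}}{2}\right)s$, or $(t,s)=(a_{k+1},a_k)$ for some integer $k\ge 0$, where $$a_k=\frac{\left(\frac{N+\sqrt{N^2-4}}{2}\right)^k-\left(\frac{N-\sqrt{N^2-4}}{2}\right)^k}{\sqrt{N^2-4}}.$$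
   Context: A Steiner bundle on $\mathbb{P}^{N-1}=\mathbb{P}(V)$, where $V$ is a complex vector space of dimension $N$, is a (nonzero) vector bundle $E$ having a linear resolution $0\to\mathcal{O}(-1)^s\to\mathcal{O}^t\to E\to 0$; in particular $t>s$. Here $\operatorname{End}E=E^\vee\otimes E$ denotes the bundle of endomorphisms, $h^i=\dim_{\mathbb{C}} H^i$, and $\chi(F)=\sum_i(-1)^ih^i(F)$. "Generic" means that, for fixed $N,s,t$, the morphism $m$ is taken in a suitable nonempty Zariski open subset of the vector space $\operatorname{Hom}(\mathcal{O}(-1)^s,\mathcal{O}^t)$; the equivalence is asserted for such $m$. *)

theory Defs
  imports Complex_Main "HOL-Library.Function_Algebras"
begin

section \<open>Polynomial functions and Zariski open sets\<close>

text \<open>Points of the affine space with coordinates indexed by \<open>I\<close>; coordinates outside \<open>I\<close> are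
  pinned to 0, so that \<open>affine_space {..<n}\<close> is a copy of \<open>n\<close>-dimensional complex space.\<close>

definition affine_space :: "'i set \<Rightarrow> ('i \<Rightarrow> complex) set" where
  "affine_space I = {x. \<forall>i. i \<notin> I \<longrightarrow> x i = 0}"

inductive_set poly_fun :: "'i set \<Rightarrow> (('i \<Rightarrow> complex) \<Rightarrow> complex) set" for I :: "'i set" where
  const: "(\<lambda>x. c) \<in> poly_fun I"
| coord: "i \<in> I \<Longrightarrow> (\<lambda>x. x i) \<in> poly_fun I"
| add: "f \<in> poly_fun I \<Longrightarrow> g \<in> poly_fun I \<Longrightarrow> (\<lambda>x. f x + g x) \<in> poly_fun I"
| mult: "f \<in> poly_fun I \<Longrightarrow> g \<in> poly_fun I \<Longrightarrow> (\<lambda>x. f x * g x) \<in> poly_fun I"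

definition zariski_open :: "'i set \<Rightarrow> ('i \<Rightarrow> complex) set \<Rightarrow> bool" where
  "zariski_open I U \<longleftrightarrow>
     (\<exists>F \<subseteq> poly_fun I. U = {x \<in> affine_space I. \<exists>f\<in>F. f x \<noteq> 0})"


section \<open>Projective space\<close>

text \<open>Subsets of the projective space of dimension \<open>N - 1\<close> are represented by the corresponding
  cones of homogeneous coordinate vectors, without the origin.\<close>

definition hcoords :: "nat \<Rightarrow> (nat \<Rightarrow> complex) set" where
  "hcoords N = affine_space {..<N} - {0}"

definition hom_poly :: "nat \<Rightarrow> nat \<Rightarrow> ((nat \<Rightarrow> complex) \<Rightarrow> complex) set" where
  "hom_poly N d = {g \<in> poly_fun {..<N}. \<forall>c x. g (\<lambda>i. c * x i) = c ^ d * g x}"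

definition proj_open :: "nat \<Rightarrow> (nat \<Rightarrow> complex) set \<Rightarrow> bool" where
  "proj_open N W \<longleftrightarrow> (\<exists>H \<subseteq> (\<Union>d. hom_poly N d). W = {x \<in> hcoords N. \<exists>h\<in>H. h x \<noteq> 0})"

text \<open>Regular functions: locally quotients of homogeneous polynomials of equal degree.\<close>

definition regular_on ::
    "nat \<Rightarrow> (nat \<Rightarrow> complex) set \<Rightarrow> ((nat \<Rightarrow> complex) \<Rightarrow> complex) \<Rightarrow> bool" where
  "regular_on N W f \<longleftrightarrow>
     (\<forall>p\<in>W. \<exists>d. \<exists>g\<in>hom_poly N d. \<exists>h\<in>hom_poly N d.
        h p \<noteq> 0 \<and> (\<forall>x\<in>W. h x \<noteq> 0 \<longrightarrow> f x = g x / h x))"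


section \<open>Steiner bundles\<close>

definition mat_apply ::
    "nat \<Rightarrow> nat \<Rightarrow> (nat \<Rightarrow> nat \<Rightarrow> complex) \<Rightarrow> (nat \<Rightarrow> complex) \<Rightarrow> (nat \<Rightarrow> complex)" where
  "mat_apply r k A w = (\<lambda>a. if a < r then \<Sum>b<k. A a b * w b else 0)"

text \<open>A morphism from \<open>\<O>(-1)\<^sup>s\<close> to \<open>\<O>\<^sup>t\<close> is a \<open>t \<times> s\<close> matrix of linear forms in \<open>N\<close> variables;
  \<open>m (i, a, b)\<close> is the coefficient of the \<open>i\<close>-th variable in the entry \<open>(a, b)\<close>.\<close>

type_synonym morph = "nat \<times> nat \<times> nat \<Rightarrow> complex"

definition morph_index :: "nat \<Rightarrow> nat \<Rightarrow> nat \<Rightarrow> (nat \<times> nat \<times> nat) set" where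
  "morph_index N s t = {..<N} \<times> {..<t} \<times> {..<s}"

definition morph_at :: "nat \<Rightarrow> morph \<Rightarrow> (nat \<Rightarrow> complex) \<Rightarrow> nat \<Rightarrow> nat \<Rightarrow> complex" where
  "morph_at N m x = (\<lambda>a b. \<Sum>i<N. x i * m (i, a, b))"

definition morph_image ::
    "nat \<Rightarrow> nat \<Rightarrow> nat \<Rightarrow> morph \<Rightarrow> (nat \<Rightarrow> complex) \<Rightarrow> (nat \<Rightarrow> complex) set" where
  "morph_image N s t m x = mat_apply t s (morph_at N m x) ` affine_space {..<s}"

text \<open>The sequence \<open>0 \<rightarrow> \<O>(-1)\<^sup>s \<rightarrow> \<O>\<^sup>t \<rightarrow> E \<rightarrow> 0\<close> is an exact sequence of vector bundles iff it is
  exact on fibres. The fibre of \<open>E\<close> at \<open>x\<close> is then the quotient of \<open>affine_space {..<t}\<close> by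
  \<open>morph_image N s t m x\<close>, and \<open>E\<close>, of rank \<open>t - s\<close>, is nonzero iff \<open>s < t\<close>.\<close>

definition steiner_bundle :: "nat \<Rightarrow> nat \<Rightarrow> nat \<Rightarrow> morph \<Rightarrow> bool" where
  "steiner_bundle N s t m \<longleftrightarrow>
     m \<in> affine_space (morph_index N s t) \<and> s < t \<and>
     (\<forall>x\<in>hcoords N. inj_on (mat_apply t s (morph_at N m x)) (affine_space {..<s}))"


section \<open>Sections of the bundle of endomorphisms\<close>

text \<open>An endomorphism of the quotient of \<open>affine_space {..<t}\<close> by a subspace \<open>K\<close> is represented
  by a \<open>t \<times> t\<close> matrix mapping \<open>K\<close> into \<open>K\<close>; two matrices represent the same endomorphism iff their
  difference maps everything into \<open>K\<close>. A section of \<open>End E\<close> over \<open>U\<close> is represented by a choice of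
  such a matrix at every point of \<open>U\<close>. The choice itself need not be regular, but the induced
  endomorphisms must be: since \<open>\<O>\<^sup>t \<rightarrow> E\<close> is surjective, this means that they are locally induced
  by matrices of regular functions. Values at points outside \<open>U\<close> and entries outside the
  \<open>t \<times> t\<close> block are irrelevant; \<open>end_null\<close> consists of the representatives of the zero section.\<close>

type_synonym msection = "(nat \<Rightarrow> complex) \<Rightarrow> nat \<Rightarrow> nat \<Rightarrow> complex"

definition end_null ::
    "nat \<Rightarrow> nat \<Rightarrow> nat \<Rightarrow> morph \<Rightarrow> (nat \<Rightarrow> complex) set \<Rightarrow> msection set" where
  "end_null N s t m U =
     {A. \<forall>x\<in>U. mat_apply t t (A x) ` affine_space {..<t} \<subseteq> morph_image N s t m x}"

definition end_sections ::
    "nat \<Rightarrow> nat \<Rightarrow> nat \<Rightarrow> morph \<Rightarrow> (nat \<Rightarrow> complex) set \<Rightarrow> msection set" where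
  "end_sections N s t m U =
     {A. (\<forall>x\<in>U. mat_apply t t (A x) ` morph_image N s t m x \<subseteq> morph_image N s t m x) \<and>
         (\<forall>p\<in>U. \<exists>W R. proj_open N W \<and> p \<in> W \<and> W \<subseteq> U \<and>
            (\<forall>a<t. \<forall>b<t. regular_on N W (\<lambda>x. R x a b)) \<and> A - R \<in> end_null N s t m W)}"


section \<open>Cohomology of the bundle of endomorphisms\<close>

text \<open>Cohomology is computed by the alternating Cech complex of the standard affine cover: a
  \<open>p\<close>-cochain assigns to each \<open>S\<close> with \<open>p + 1\<close> elements a section over the intersection of the
  charts \<open>x i \<noteq> 0\<close>, \<open>i \<in> S\<close>. As sections are given by representatives, equality of cochains is
  equality modulo \<open>null_cochains\<close>. Components at sets of other sizes are irrelevant.\<close>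

type_synonym cochain = "nat set \<Rightarrow> msection"

definition cochain_scale :: "complex \<Rightarrow> cochain \<Rightarrow> cochain" where
  "cochain_scale k c = (\<lambda>S x a b. k * c S x a b)"

interpretation cochain: vector_space cochain_scale
  by unfold_locales (auto simp: cochain_scale_def fun_eq_iff algebra_simps)

text \<open>A basis of \<open>Z\<close> modulo \<open>B\<close>. For subspaces \<open>B \<subseteq> Z\<close>, \<open>quotient_dim Z B\<close> is the dimension of
  \<open>Z / B\<close>; as for \<open>dim\<close> in the library, the value is 0 if the dimension is infinite.\<close>

definition quotient_basis :: "cochain set \<Rightarrow> cochain set \<Rightarrow> cochain set \<Rightarrow> bool" where
  "quotient_basis Z B b \<longleftrightarrow> b \<subseteq> Z \<and> Z \<subseteq> cochain.span (B \<union> b) \<and>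
     (\<forall>f u. finite f \<and> f \<subseteq> b \<and> (\<Sum>v\<in>f. cochain_scale (u v) v) \<in> B \<longrightarrow> (\<forall>v\<in>f. u v = 0))"

definition quotient_dim :: "cochain set \<Rightarrow> cochain set \<Rightarrow> nat" where
  "quotient_dim Z B = card (SOME b. quotient_basis Z B b)"

definition chart :: "nat \<Rightarrow> nat set \<Rightarrow> (nat \<Rightarrow> complex) set" where
  "chart N S = {x \<in> hcoords N. \<forall>i\<in>S. x i \<noteq> 0}"

definition cochains :: "nat \<Rightarrow> nat \<Rightarrow> nat \<Rightarrow> morph \<Rightarrow> nat \<Rightarrow> cochain set" where
  "cochains N s t m p =
     {c. \<forall>S. S \<subseteq> {..<N} \<and> card S = Suc p \<longrightarrow> c S \<in> end_sections N s t m (chart N S)}"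

definition null_cochains :: "nat \<Rightarrow> nat \<Rightarrow> nat \<Rightarrow> morph \<Rightarrow> nat \<Rightarrow> cochain set" where
  "null_cochains N s t m p =
     {c. \<forall>S. S \<subseteq> {..<N} \<and> card S = Suc p \<longrightarrow> c S \<in> end_null N s t m (chart N S)}"

definition coboundary :: "cochain \<Rightarrow> cochain" where
  "coboundary c = (\<lambda>S x a b. \<Sum>i\<in>S. (- 1) ^ card {j\<in>S. j < i} * c (S - {i}) x a b)"

definition cocycles :: "nat \<Rightarrow> nat \<Rightarrow> nat \<Rightarrow> morph \<Rightarrow> nat \<Rightarrow> cochain set" where
  "cocycles N s t m p =
     {c \<in> cochains N s t m p. coboundary c \<in> null_cochains N s t m (Suc p)}"

fun coboundaries :: "nat \<Rightarrow> nat \<Rightarrow> nat \<Rightarrow> morph \<Rightarrow> nat \<Rightarrow> cochain set" where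
  "coboundaries N s t m 0 = null_cochains N s t m 0"
| "coboundaries N s t m (Suc p) =
     {c. \<exists>e\<in>cochains N s t m p. c - coboundary e \<in> null_cochains N s t m (Suc p)}"

definition h_End :: "nat \<Rightarrow> nat \<Rightarrow> nat \<Rightarrow> morph \<Rightarrow> nat \<Rightarrow> nat" where
  "h_End N s t m p = quotient_dim (cocycles N s t m p) (coboundaries N s t m p)"

text \<open>There are no \<open>p\<close>-cochains for \<open>p \<ge> N\<close>, so the sum is over all degrees.\<close>

definition chi_End :: "nat \<Rightarrow> nat \<Rightarrow> nat \<Rightarrow> morph \<Rightarrow> int" where
  "chi_End N s t m = (\<Sum>p<N. (- 1) ^ p * int (h_End N s t m p))"

definition simple_bundle :: "nat \<Rightarrow> nat \<Rightarrow> nat \<Rightarrow> morph \<Rightarrow> bool" where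
  "simple_bundle N s t m \<longleftrightarrow> h_End N s t m 0 = 1"


section \<open>The numerical sequence\<close>

definition a_seq :: "nat \<Rightarrow> nat \<Rightarrow> real" where
  "a_seq N k =
     (((real N + sqrt (real N ^ 2 - 4)) / 2) ^ k - ((real N - sqrt (real N ^ 2 - 4)) / 2) ^ k)
       / sqrt (real N ^ 2 - 4)"

end

theory Submission
  imports
    Defs
    "Jordan_Normal_Form.Determinant"
    "HOL-Analysis.Continuum_Not_Denumerable"
    "HOL-Computational_Algebra.Fundamental_Theorem_Algebra"
begin

text \<open>Write \<open>M\<close> for the matrix of linear forms. As \<open>\<O>(d)\<close> has no higher cohomology for \<open>d \<ge> - 1\<close>, and
  no cohomology at all for \<open>d = - 1\<close>, the complex
  \<open>\<O>(-1)\<^bsup>st\<^esup> \<rightarrow> \<O>\<^bsup>tt\<^esup> \<oplus> \<O>\<^bsup>ss\<^esup> \<rightarrow> \<O>(1)\<^bsup>ts\<^esup>\<close>, \<open>C \<mapsto> (M C, C M)\<close>, \<open>(A, B) \<mapsto> A M - M B\<close>, whose only cohomology is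
  \<open>End E\<close> in the middle, shows that \<open>h\<^sup>0(End E)\<close> and \<open>h\<^sup>1(End E)\<close> are the dimensions of the kernel and
  the cokernel of \<open>(A, B) \<mapsto> (A m\<^sub>i - m\<^sub>i B)\<^sub>i\<close> on constant matrices, and that the other \<open>h\<^sup>p\<close> vanish. This holds
  for every Steiner bundle and gives \<open>\<chi> = s\<^sup>2 - N s t + t\<^sup>2\<close>, so simplicity forces \<open>\<chi> \<le> 1\<close>.

  Conversely, simplicity says that the Kronecker module \<open>m\<close> has only scalar endomorphisms, which is an
  open condition. If \<open>\<chi> \<le> 1\<close>, such a module exists: it is explicit for \<open>s < t \<le> (N - 1) s\<close>, and the
  reflection \<open>(N s - t, s) \<leadsto> (s, t)\<close>, which preserves \<open>\<chi>\<close> and the endomorphism ring, reduces the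
  other cases to this one or to \<open>(s, t) = (0, 1)\<close>. The same descent identifies the solutions of
  \<open>\<chi> = 1\<close>.\<close>

section \<open>Linear algebra\<close>

text \<open>Sections of \<open>End E\<close> are given pointwise, by representatives that need not
  be regular, while the resolution argument needs honest cochains of line bundles. The bridge is a
  left inverse L of M with entries of degree -1 on every chart: P = 1 - M L normalises
  representatives, L recovers C from M C, and g L lifts a matrix g of linear forms to a
  representative. The left inverses on different charts need not agree, and the coboundary of g L is
  exactly the connecting map into H^1. Producing L, and turning locally regular functions into
  Laurent polynomials, is what the Nullstellensatz is for. Injectivity of a matrix M is always
  tested by det(Q M) with Q a frozen conjugate transpose: this is polynomial in M and nonzero at the
  matrix from which Q was taken. It serves both the left inverse and the openness of the generic
  condition.\<close>

lemma det_gram_nonzero: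
  fixes M :: "nat \<Rightarrow> nat \<Rightarrow> complex"
  assumes inj: "\<And>w. (\<forall>a<r. (\<Sum>b<k. M a b * w b) = 0) \<Longrightarrow> \<forall>b<k. w b = 0"
  shows "det (mat k k (\<lambda>(i, j). \<Sum>a<r. cnj (M a i) * M a j)) \<noteq> 0"
proof
  let ?A = "mat k k (\<lambda>(i, j). \<Sum>a<r. cnj (M a i) * M a j)"
  assume "det ?A = 0"
  then obtain v where v: "v \<in> carrier_vec k" "v \<noteq> 0\<^sub>v k" "?A *\<^sub>v v = 0\<^sub>v k"
    using det_0_iff_vec_prod_zero[of ?A k] by auto
  define u where "u a = (\<Sum>b<k. M a b * v $ b)" for a
  have row: "(\<Sum>j<k. (\<Sum>a<r. cnj (M a i) * M a j) * v $ j) = 0" if "i < k" for i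
  proof -
    have "(?A *\<^sub>v v) $ i = 0" using v(3) that by simp
    moreover have "(?A *\<^sub>v v) $ i = (\<Sum>j<k. (\<Sum>a<r. cnj (M a i) * M a j) * v $ j)"
      using that v(1) by (simp add: scalar_prod_def lessThan_atLeast0)
    ultimately show ?thesis by simp
  qed
  \<comment> \<open>With u = M v, the Hermitian form of the Gram matrix takes the value |u|^2 at
    v.\<close>
  have "(\<Sum>a<r. cnj (u a) * u a) = (\<Sum>a<r. \<Sum>i<k. \<Sum>j<k. cnj (v $ i) * (cnj (M a i) * M a j * v $ j))"
    unfolding u_def cnj_sum sum_product by (intro sum.cong refl) (simp add: algebra_simps)
  also have "\<dots> = (\<Sum>i<k. \<Sum>j<k. \<Sum>a<r. cnj (v $ i) * (cnj (M a i) * M a j * v $ j))"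
    by (subst sum.swap, rule sum.cong[OF refl], rule sum.swap)
  also have "\<dots> = (\<Sum>i<k. cnj (v $ i) * (\<Sum>j<k. (\<Sum>a<r. cnj (M a i) * M a j) * v $ j))"
    by (simp add: sum_distrib_left sum_distrib_right)
  also have "\<dots> = 0" using row by simp
  finally have "of_real (\<Sum>a<r. (cmod (u a))\<^sup>2) = (0::complex)"
    by (simp add: complex_norm_square mult.commute del: of_real_power)
  then have "(\<Sum>a<r. (cmod (u a))\<^sup>2) = 0" using of_real_eq_0_iff by blast
  then have "\<forall>a<r. u a = 0" by (subst (asm) sum_nonneg_eq_0_iff) auto
  then have "\<forall>b<k. v $ b = 0" using inj[of "\<lambda>b. v $ b"] unfolding u_def by blast
  then show False using v by (metis carrier_vecD eq_vecI index_zero_vec(1) index_zero_vec(2))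
qed

text \<open>A vector killed by M is killed by \<Lambda> M. The left factor is arbitrary so that it
  can be frozen at the conjugate transpose of a reference matrix, which keeps the determinant
  polynomial in the entries of M.\<close>

lemma det_product_nonzero_imp_injective:
  fixes M \<Lambda> :: "nat \<Rightarrow> nat \<Rightarrow> complex"
  assumes det: "det (mat k k (\<lambda>(i, j). \<Sum>a<r. \<Lambda> i a * M a j)) \<noteq> 0"
    and w: "\<forall>a<r. (\<Sum>b<k. M a b * w b) = 0"
  shows "\<forall>b<k. w b = 0"
proof (rule ccontr)
  assume n: "\<not> (\<forall>b<k. w b = 0)"
  let ?A = "mat k k (\<lambda>(i, j). \<Sum>a<r. \<Lambda> i a * M a j)"
  have "?A *\<^sub>v vec k w = 0\<^sub>v k"
  proof (rule eq_vecI)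
    fix i assume "i < dim_vec (0\<^sub>v k :: complex vec)"
    then have i: "i < k" by simp
    then have "(?A *\<^sub>v vec k w) $ i = (\<Sum>j<k. (\<Sum>a<r. \<Lambda> i a * M a j) * w j)"
      by (simp add: scalar_prod_def lessThan_atLeast0)
    also have "\<dots> = (\<Sum>j<k. \<Sum>a<r. \<Lambda> i a * (M a j * w j))"
      by (simp add: sum_distrib_right mult.assoc)
    also have "\<dots> = (\<Sum>a<r. \<Lambda> i a * (\<Sum>j<k. M a j * w j))"
      by (subst sum.swap) (simp add: sum_distrib_left)
    finally show "(?A *\<^sub>v vec k w) $ i = 0\<^sub>v k $ i" using w i by simp
  qed simp
  moreover have "vec k w \<noteq> 0\<^sub>v k" using n by (metis index_vec index_zero_vec(1))
  ultimately have "\<exists>v. v \<in> carrier_vec k \<and> v \<noteq> 0\<^sub>v k \<and> ?A *\<^sub>v v = 0\<^sub>v k"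
    using vec_carrier by blast
  then have "det ?A = 0" using det_0_iff_vec_prod_zero[OF mat_carrier] by blast
  with det show False by simp
qed

text \<open>One vector space structure serves coordinate tuples and polynomial functions alike,
  since both are complex-valued functions on some index type.\<close>

definition fscale :: "complex \<Rightarrow> ('i \<Rightarrow> complex) \<Rightarrow> 'i \<Rightarrow> complex" where
  "fscale k f = (\<lambda>i. k * f i)"

interpretation fv: vector_space fscale
  by unfold_locales (auto simp: fscale_def fun_eq_iff algebra_simps)

lemma sum_fun_apply: "(\<Sum>x\<in>F. f x) i = (\<Sum>x\<in>F. f x i)"
  by (induction F rule: infinite_finite_induct) auto

definition unit_fun :: "'i \<Rightarrow> 'i \<Rightarrow> complex" where
  "unit_fun i = (\<lambda>j. if j = i then 1 else 0)"

lemma unit_fun_inj: "inj unit_fun"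
  by (rule injI) (metis unit_fun_def zero_neq_one)

lemma unit_fun_sum:
  assumes "finite I"
  shows "(\<Sum>i\<in>I. fscale (w i) (unit_fun i)) = (\<lambda>i. if i \<in> I then w i else 0)"
  using assms by (auto simp: fun_eq_iff sum_fun_apply fscale_def unit_fun_def if_distrib cong: if_cong)

lemma affine_space_span:
  assumes "finite I" shows "affine_space I = fv.span (unit_fun ` I)"
proof
  show "affine_space I \<subseteq> fv.span (unit_fun ` I)"
  proof
    fix x :: "'a \<Rightarrow> complex" assume "x \<in> affine_space I"
    then have "x = (\<lambda>i. if i \<in> I then x i else 0)" by (auto simp: affine_space_def)
    also have "\<dots> = (\<Sum>i\<in>I. fscale (x i) (unit_fun i))" using unit_fun_sum[OF assms] by metis
    also have "\<dots> \<in> fv.span (unit_fun ` I)"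
      by (intro fv.span_sum fv.span_scale fv.span_base) auto
    finally show "x \<in> fv.span (unit_fun ` I)" .
  qed
  have "fv.subspace (affine_space I)"
    by (auto simp: fv.subspace_def affine_space_def fscale_def)
  moreover have "unit_fun ` I \<subseteq> affine_space I" by (auto simp: affine_space_def unit_fun_def)
  ultimately show "fv.span (unit_fun ` I) \<subseteq> affine_space I" by (metis fv.span_minimal)
qed

lemma fv_independent_family:
  assumes A: "finite A" and li: "\<And>u. (\<Sum>a\<in>A. fscale (u a) (f a)) = 0 \<Longrightarrow> \<forall>a\<in>A. u a = 0"
  shows "inj_on f A \<and> fv.independent (f ` A)"
proof
  show inj: "inj_on f A"
  proof (rule inj_onI, rule ccontr)
    fix x y assume xy: "x \<in> A" "y \<in> A" "f x = f y" "x \<noteq> y"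
    \<comment> \<open>A repeated vector would give a relation with coefficients 1 and -1.\<close>
    have "(\<Sum>a\<in>A. fscale ((if a = x then 1 else 0) - (if a = y then 1 else 0)) (f a))
        = (\<Sum>a\<in>A. (if a = x then f x else 0) - (if a = y then f y else 0))"
      by (intro sum.cong) (auto simp: fscale_def fun_eq_iff)
    also have "\<dots> = 0" using xy A by (simp add: sum_subtractf)
    finally show False using li xy by fastforce
  qed
  show "fv.independent (f ` A)"
  proof (rule fv.independent_if_scalars_zero)
    fix u x assume "(\<Sum>x\<in>f ` A. fscale (u x) x) = 0" and x: "x \<in> f ` A"
    then have "(\<Sum>a\<in>A. fscale (u (f a)) (f a)) = 0" by (simp add: sum.reindex[OF inj])
    from li[OF this] show "u x = 0" using x by auto
  qed (use A in simp)
qed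

lemma unit_fun_independent:
  assumes "finite I" shows "fv.independent (unit_fun ` I)"
proof -
  have "\<forall>i\<in>I. w i = 0" if "(\<Sum>i\<in>I. fscale (w i) (unit_fun i)) = 0" for w
    using that unfolding unit_fun_sum[OF assms] by (auto simp: fun_eq_iff split: if_splits)
  from fv_independent_family[OF assms this] show ?thesis by blast
qed

lemma affine_space_subspace: "fv.subspace (affine_space I)"
  by (auto simp: fv.subspace_def affine_space_def fscale_def)

text \<open>The exchange lemma is applied in both directions between \<open>b\<close> and the unit
  vectors.\<close>

lemma affine_space_basis_card:
  assumes I: "finite I" and b: "fv.independent b" "b \<subseteq> affine_space I" "affine_space I \<subseteq> fv.span b"
  shows "finite b \<and> card b = card I"
proof -
  have cI: "card (unit_fun ` I) = card I" by (rule card_image[OF inj_on_subset[OF unit_fun_inj]]) simp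
  have 1: "finite b \<and> card b \<le> card (unit_fun ` I)"
    using fv.independent_span_bound[OF _ b(1)] b(2) I affine_space_span[OF I] by blast
  have "unit_fun ` I \<subseteq> fv.span b"
    using b(3) affine_space_span[OF I] fv.span_superset[of "unit_fun ` I"] by blast
  then have "card (unit_fun ` I) \<le> card b"
    using fv.independent_span_bound[OF _ unit_fun_independent[OF I]] 1 by blast
  then show ?thesis using 1 cI by simp
qed

text \<open>Injectivity makes the columns of \<mu> independent, so they extend to a basis of C^n;
  this basis forms the columns of \<open>F\<close>, and \<open>C\<close> is the inverse. The rows of
  \<open>C\<close> from \<open>k\<close> on then cut out the column space of \<mu>, which is how a
  cokernel is obtained later.\<close>

lemma extend_to_invertible:
  fixes \<mu> :: "nat \<Rightarrow> nat \<Rightarrow> complex"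
  assumes inj: "\<And>w. (\<forall>a<n. (\<Sum>b<k. \<mu> a b * w b) = 0) \<Longrightarrow> \<forall>b<k. w b = 0"
  shows "k \<le> n \<and> (\<exists>F C. (\<forall>a<n. \<forall>b<k. F a b = \<mu> a b) \<and>
     (\<forall>a<n. \<forall>b<n. (\<Sum>c<n. F a c * C c b) = (if a = b then 1 else 0)) \<and>
     (\<forall>a<n. \<forall>b<n. (\<Sum>c<n. C a c * F c b) = (if a = b then 1 else 0)))"
proof -
  define col where "col b = (\<lambda>a. if a < n then \<mu> a b else 0)" for b

  have comb: "(\<Sum>b<k. fscale (w b) (col b)) a = (if a < n then \<Sum>b<k. \<mu> a b * w b else 0)" for w a
    by (simp add: sum_fun_apply fscale_def col_def mult.commute)
  have li: "\<forall>b<k. w b = 0" if "(\<Sum>b<k. fscale (w b) (col b)) = 0" for w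
  proof (rule inj, intro allI impI)
    fix a assume "a < n"
    then show "(\<Sum>b<k. \<mu> a b * w b) = 0" using comb[of w a] that by simp
  qed
  have colinj: "inj_on col {..<k}" and ind: "fv.independent (col ` {..<k})"
    using fv_independent_family[of "{..<k}" col] li by auto
  have "col ` {..<k} \<subseteq> affine_space {..<n}" by (auto simp: affine_space_def col_def)
  then obtain t' where t': "col ` {..<k} \<subseteq> t'" "t' \<subseteq> affine_space {..<n}" "fv.independent t'"
    and sp: "affine_space {..<n} \<subseteq> fv.span t'"
    using fv.maximal_independent_subset_extend[OF _ ind] by metis
  have ft': "finite t'" and ct': "card t' = n"
    using affine_space_basis_card[OF _ t'(3,2) sp] by auto
  have kn: "k \<le> n"
    using card_mono[OF ft' t'(1)] ct' card_image[OF colinj] by simp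
  have "card (t' - col ` {..<k}) = card {k..<n}"
    using ct' card_Diff_subset[OF _ t'(1)] card_image[OF colinj] by simp
  then obtain g where g: "bij_betw g {k..<n} (t' - col ` {..<k})"
    using finite_same_card_bij[of "{k..<n}" "t' - col ` {..<k}"] ft' by auto
  \<comment> \<open>The basis is numbered with the given columns first.\<close>
  define h where "h b = (if b < k then col b else g b)" for b
  have him: "h ` {..<n} = t'"
  proof -
    have "h ` {..<n} = h ` {..<k} \<union> h ` {k..<n}" using kn by (metis image_Un ivl_disj_un_one(2))
    also have "h ` {..<k} = col ` {..<k}" by (auto simp: h_def)
    also have "h ` {k..<n} = t' - col ` {..<k}" using g by (auto simp: h_def bij_betw_def)
    finally show ?thesis using t'(1) by auto
  qed
  have hinj: "inj_on h {..<n}" using him ct' by (intro eq_card_imp_inj_on) auto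
  have "\<exists>w. (\<Sum>b<n. fscale (w b) (h b)) = unit_fun c" if "c < n" for c
  proof -
    have "unit_fun c \<in> fv.span t'" using sp that by (auto simp: affine_space_def unit_fun_def)
    then obtain u where "unit_fun c = (\<Sum>v\<in>t'. fscale (u v) v)"
      unfolding fv.span_finite[OF ft'] by auto
    also have "\<dots> = (\<Sum>b<n. fscale (u (h b)) (h b))"
      unfolding him[symmetric] by (subst sum.reindex[OF hinj]) simp
    finally show ?thesis by metis
  qed
  then obtain W where W: "\<And>c. c < n \<Longrightarrow> (\<Sum>b<n. fscale (W c b) (h b)) = unit_fun c" by metis
  define F where "F a b = h b a" for a b
  define C where "C b c = W c b" for b c
  have FC: "(\<Sum>c<n. F a c * C c b) = (if a = b then 1 else 0)" if "a < n" "b < n" for a b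
    using fun_cong[OF W[OF that(2)], of a]
    by (simp add: sum_fun_apply fscale_def F_def C_def unit_fun_def mult.commute)
  let ?F = "mat n n (\<lambda>(a, b). F a b)" and ?C = "mat n n (\<lambda>(a, b). C a b)"
  have "?F * ?C = 1\<^sub>m n"
    using FC by (intro eq_matI) (auto simp: scalar_prod_def lessThan_atLeast0)
  then have CF: "?C * ?F = 1\<^sub>m n" by (intro mat_mult_left_right_inverse[of ?F]) auto
  have "(\<Sum>c<n. C a c * F c b) = (if a = b then 1 else 0)" if "a < n" "b < n" for a b
  proof -
    have "(?C * ?F) $$ (a, b) = (\<Sum>c<n. C a c * F c b)"
      using that by (simp add: scalar_prod_def lessThan_atLeast0)
    then show ?thesis using CF that by simp
  qed
  moreover have "\<forall>a<n. \<forall>b<k. F a b = \<mu> a b" by (simp add: F_def h_def col_def)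
  ultimately show ?thesis using kn FC by blast
qed

section \<open>Kronecker modules with trivial endomorphisms\<close>

text \<open>Endomorphisms of the Kronecker module: A on C^t and B on C^s that commute with each of
  the N matrices m_i.\<close>

definition intertwines :: "nat \<Rightarrow> nat \<Rightarrow> nat \<Rightarrow> morph \<Rightarrow> (nat \<Rightarrow> nat \<Rightarrow> complex) \<Rightarrow> (nat \<Rightarrow> nat \<Rightarrow> complex) \<Rightarrow> bool" where
  "intertwines N s t m A B \<longleftrightarrow>
     (\<forall>i<N. \<forall>a<t. \<forall>b<s. (\<Sum>c<t. A a c * m (i, c, b)) = (\<Sum>c<s. m (i, a, c) * B c b))"

definition scalar_mat :: "nat \<Rightarrow> (nat \<Rightarrow> nat \<Rightarrow> complex) \<Rightarrow> complex \<Rightarrow> bool" where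
  "scalar_mat n A k \<longleftrightarrow> (\<forall>a<n. \<forall>b<n. A a b = (if a = b then k else 0))"

definition brick :: "nat \<Rightarrow> nat \<Rightarrow> nat \<Rightarrow> morph \<Rightarrow> bool" where
  "brick N s t m \<longleftrightarrow>
     (\<forall>A B. intertwines N s t m A B \<longrightarrow> (\<exists>k. scalar_mat t A k \<and> scalar_mat s B k))"

lemma sum_delta_mult:
  fixes f :: "nat \<Rightarrow> complex"
  shows "(\<Sum>c<n. f c * (if c = x then 1 else 0)) = (if x < n then f x else 0)"
    and "(\<Sum>c<n. (if c = x then 1 else 0) * f c) = (if x < n then f x else 0)"
    and "(\<Sum>c<n. (if x = c then 1 else 0) * f c) = (if x < n then f x else 0)"
    and "(\<Sum>c<n. f c * (if x = c then 1 else 0)) = (if x < n then f x else 0)"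
  by (simp_all add: if_distrib[of "\<lambda>z. z * _"] if_distrib[of "\<lambda>z. _ * z"] cong: if_cong)

text \<open>The first \<open>N - 1\<close> matrices are the blocks of a \<open>t\<close>-row truncation of the identity of size
  \<open>(N - 1) s\<close>, so that \<open>A\<close> consists of diagonal blocks of \<open>B\<close>; the last one makes \<open>B\<close> diagonal and
  connects its diagonal entries.\<close>

lemma brick_wide:
  assumes N: "N \<ge> 3" and st: "s \<ge> 1" "s < t" "t \<le> (N - 1) * s"
  shows "\<exists>m. brick N s t m"
proof -
  define m :: morph where "m = (\<lambda>(i, a, b). if i < N - 1 then (if a = i * s + b then 1 else 0)
     else (if a = b then of_nat b else 0) + (if s \<le> a then 1 else 0))"
  have "brick N s t m" unfolding brick_def
  proof (intro allI impI)
    fix A B assume I: "intertwines N s t m A B"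
    have E: "(\<Sum>c<t. A a c * m (i, c, b)) = (\<Sum>c<s. m (i, a, c) * B c b)"
      if "i < N" "a < t" "b < s" for i a b using I that unfolding intertwines_def by blast
    \<comment> \<open>For i < N - 1 the entry (a, b) of A m_i is A a (i s + b), while m_i B is B
      moved down to the rows of block i and cut off at row t.\<close>
    have blk: "A a (i * s + b) = (if i * s \<le> a \<and> a < i * s + s then B (a - i * s) b else 0)"
      if "i < N - 1" "a < t" "b < s" "i * s + b < t" for i a b
    proof -
      have "A a (i * s + b) = (\<Sum>c<t. A a c * m (i, c, b))"
        using that by (simp add: m_def sum_delta_mult)
      also have "\<dots> = (\<Sum>c<s. m (i, a, c) * B c b)" using E that by simp
      also have "\<dots> = (\<Sum>c<s. if i * s \<le> a \<and> c = a - i * s then B c b else 0)"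
        using that by (intro sum.cong) (auto simp: m_def)
      also have "\<dots> = (if i * s \<le> a \<and> a < i * s + s then B (a - i * s) b else 0)"
        by (cases "i * s \<le> a") auto
      finally show ?thesis .
    qed
    \<comment> \<open>Since t \<le> (N - 1) s, every index below t lies in one of the first N - 1
      blocks, and in block 0 only if it is below s.\<close>
    have split: "\<exists>i b. a' = i * s + b \<and> b < s \<and> i < N - 1 \<and> (s \<le> a' \<longrightarrow> i \<ge> 1)"
      if "a' < t" for a'
    proof (intro exI conjI)
      show "a' = a' div s * s + a' mod s" by simp
      show "a' mod s < s" using st by simp
      have "a' < (N - 1) * s" using that st by linarith
      then show "a' div s < N - 1" by (simp add: less_mult_imp_div_less)
      show "s \<le> a' \<longrightarrow> a' div s \<ge> 1" using st by (simp add: div_greater_zero_iff Suc_le_eq)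
    qed
    have A0: "A a b = (if a < s then B a b else 0)" if "a < t" "b < s" for a b
      using blk[of 0 a b] that st N by simp
    have Aup: "A a c = 0" if ac: "a < s" "s \<le> c" "c < t" for a c
    proof -
      obtain i b where ib: "c = i * s + b" "b < s" "i < N - 1" "i \<ge> 1"
        using split[OF ac(3)] ac(2) by blast
      moreover have "a < i * s" using ac(1) mult_le_mono1[OF ib(4), of s] unfolding mult_1 by linarith
      ultimately show ?thesis using blk[of i a b] ac st by simp
    qed
    have last: "(\<Sum>c<t. A a c * m (N - 1, c, b)) = A a b * of_nat b + (\<Sum>c\<in>{s..<t}. A a c)"
      if "b < s" for a b
    proof -
      have "(\<Sum>c<t. A a c * m (N - 1, c, b)) = (\<Sum>c<t. (if c = b then A a b * of_nat b else 0)
          + (if s \<le> c then A a c else 0))"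
        by (intro sum.cong) (auto simp: m_def algebra_simps)
      also have "\<dots> = A a b * of_nat b + (\<Sum>c<t. if s \<le> c then A a c else 0)"
        using that st by (simp add: sum.distrib)
      also have "(\<Sum>c<t. if s \<le> c then A a c else 0) = (\<Sum>c\<in>{s..<t}. A a c)"
        by (rule sum.mono_neutral_cong_right) auto
      finally show ?thesis .
    qed
    \<comment> \<open>In the rows above s the last relation says that B commutes with diag(0, ..., s
      - 1), whose entries are distinct.\<close>
    have off: "B a b = 0" if "a < s" "b < s" "a \<noteq> b" for a b
    proof -
      have "(\<Sum>c\<in>{s..<t}. A a c) = 0" using Aup that by simp
      then have "(\<Sum>c<t. A a c * m (N - 1, c, b)) = B a b * of_nat b"
        using last that A0 st by simp
      moreover have "(\<Sum>c<s. m (N - 1, a, c) * B c b) = (\<Sum>c<s. if c = a then of_nat a * B a b else 0)"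
        using that by (intro sum.cong) (auto simp: m_def)
      ultimately have "B a b * of_nat b = of_nat a * B a b" using E[of "N - 1" a b] that N st by simp
      then have "B a b * (of_nat b - of_nat a) = 0" by (simp add: algebra_simps)
      then show ?thesis using that by simp
    qed
    have full: "A a (i * s + b) = (if a = i * s + b then B b b else 0)"
      if "i < N - 1" "a < t" "b < s" "i * s + b < t" for i a b
      using blk[OF that] off[of "a - i * s" b] that by auto
    \<comment> \<open>Row s of the last matrix is constantly 1, so row s of the last relation
      compares B b b with A s s, which is B 0 0 by block 1. Row s exists because s < t, and block 1
      because N \<ge> 3.\<close>
    have diag: "B b b = B 0 0" if "b < s" for b
    proof -
      have "(\<Sum>c\<in>{s..<t}. A s c) = (\<Sum>c\<in>{s..<t}. if c = s then B 0 0 else 0)"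
      proof (rule sum.cong[OF refl])
        fix c assume c: "c \<in> {s..<t}"
        then obtain i e where ib: "c = i * s + e" "e < s" "i < N - 1" "i \<ge> 1"
          using split[of c] by auto
        show "A s c = (if c = s then B 0 0 else 0)"
          using full[of i s e] full[of 1 s 0] ib c st N by auto
      qed
      also have "\<dots> = B 0 0" using st by simp
      finally have l: "(\<Sum>c<t. A s c * m (N - 1, c, b)) = B 0 0"
        using last[OF that, of s] A0[of s b] that st by simp
      have "(\<Sum>c<s. m (N - 1, s, c) * B c b) = (\<Sum>c<s. if c = b then B b b else 0)"
        using that off by (intro sum.cong) (auto simp: m_def)
      also have "\<dots> = B b b" using that by simp
      finally show ?thesis using l E[of "N - 1" s b] that N st by simp
    qed
    have "scalar_mat t A (B 0 0)" unfolding scalar_mat_def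
    proof (intro allI impI)
      fix a c assume ac: "a < t" "c < t"
      obtain i b where ib: "c = i * s + b" "b < s" "i < N - 1" using split ac by blast
      show "A a c = (if a = c then B 0 0 else 0)" using full[of i a b] ib ac diag[of b] by simp
    qed
    moreover have "scalar_mat s B (B 0 0)" unfolding scalar_mat_def by (auto simp: off intro: diag)
    ultimately show "\<exists>k. scalar_mat t A k \<and> scalar_mat s B k" by blast
  qed
  then show ?thesis by blast
qed

text \<open>A common kernel vector v yields the endomorphism (0, B) with all columns of B equal to
  v; as t \<ge> 1, its scalar is 0.\<close>

lemma brick_injective:
  assumes b: "brick N s t m" and t: "t \<ge> 1"
    and v: "\<forall>i<N. \<forall>a<t. (\<Sum>c<s. m (i, a, c) * v c) = 0"
  shows "\<forall>c<s. v c = 0"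
proof (intro allI impI)
  fix c assume c: "c < s"
  have "intertwines N s t m (\<lambda>_ _. 0) (\<lambda>e _. v e)"
    unfolding intertwines_def using v by simp
  then obtain k where "scalar_mat t (\<lambda>_ _. 0) k" "scalar_mat s (\<lambda>e _. v e) k"
    using b unfolding brick_def by meson
  then show "v c = 0" using t c unfolding scalar_mat_def by force
qed

text \<open>The stacked map from C^s to C^N tensor C^t is injective, and its cokernel, of dimension
  N t - s, receives N maps from C^t. For an endomorphism (A, B) of this new module, 1 tensor B
  preserves the image of the old map and so induces an endomorphism (B, B') of m. Hence B is scalar,
  and A is scalar because the projection to the cokernel is onto.\<close>

lemma brick_reflect:
  assumes m: "brick N s t m" and t: "t \<ge> 1"
  shows "s \<le> N * t \<and> (\<exists>m'. brick N t (N * t - s) m')"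
proof -
  \<comment> \<open>Row r = i t + a of the stacked matrix is row a of m_i.\<close>
  define \<mu> where "\<mu> r c = m (r div t, r mod t, c)" for r c
  have inj: "\<forall>c<s. w c = 0" if w: "\<forall>r<N * t. (\<Sum>c<s. \<mu> r c * w c) = 0" for w
  proof (rule brick_injective[OF m t], intro allI impI)
    fix i a assume ia: "i < N" "a < t"
    have "i * t + a < Suc i * t" using ia by simp
    also have "\<dots> \<le> N * t" using ia by (intro mult_right_mono) auto
    finally show "(\<Sum>c<s. m (i, a, c) * w c) = 0"
      using w[rule_format, of "i * t + a"] ia by (simp add: \<mu>_def)
  qed
  have ext: "s \<le> N * t \<and> (\<exists>F C. (\<forall>a<N * t. \<forall>b<s. F a b = \<mu> a b) \<and>
     (\<forall>a<N * t. \<forall>b<N * t. (\<Sum>c<N * t. F a c * C c b) = (if a = b then 1 else 0)) \<and>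
     (\<forall>a<N * t. \<forall>b<N * t. (\<Sum>c<N * t. C a c * F c b) = (if a = b then 1 else 0)))"
    by (rule extend_to_invertible) (rule inj)
  then obtain F C where FC: "s \<le> N * t" "\<forall>a<N * t. \<forall>b<s. F a b = \<mu> a b"
     "\<And>a b. a < N * t \<Longrightarrow> b < N * t \<Longrightarrow> (\<Sum>c<N * t. F a c * C c b) = (if a = b then 1 else 0)"
     "\<And>a b. a < N * t \<Longrightarrow> b < N * t \<Longrightarrow> (\<Sum>c<N * t. C a c * F c b) = (if a = b then 1 else 0)"
    by blast
  define n where "n = N * t"
  \<comment> \<open>The last N t - s rows of the inverse of F form the projection to the cokernel,
    and m'_i is its restriction to the i-th copy of C^t.\<close>
  define m' :: morph where "m' = (\<lambda>(i, a, b). C (s + a) (i * t + b))"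
  have reidx: "(\<Sum>r<n. f r) = (\<Sum>i<N. \<Sum>b<t. f (i * t + b))" for f :: "nat \<Rightarrow> complex"
  proof -
    have "sum f {i * t..<i * t + t} = (\<Sum>b<t. f (i * t + b))" for i
      using sum.shift_bounds_nat_ivl[of f 0 "i * t" t] by (simp add: add.commute lessThan_atLeast0)
    then show ?thesis unfolding n_def by (simp add: sum.nat_group[symmetric])
  qed
  have rlt: "i * t + b < n" if "i < N" "b < t" for i b
  proof -
    have "i * t + b < Suc i * t" using that by simp
    also have "\<dots> \<le> n" using that unfolding n_def by (intro mult_right_mono) auto
    finally show ?thesis .
  qed
  have "brick N t (n - s) m'" unfolding brick_def
  proof (intro allI impI)
    fix A B assume I: "intertwines N t (n - s) m' A B"
    have E: "(\<Sum>c<n - s. A a c * C (s + c) (i * t + b)) = (\<Sum>c<t. C (s + a) (i * t + c) * B c b)"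
      if "i < N" "a < n - s" "b < t" for i a b
      using I that unfolding intertwines_def m'_def by simp
    \<comment> \<open>X is 1 tensor B applied to the stacked matrix, and B' holds its coordinates in
      the columns of F.\<close>
    define X where "X r d = (\<Sum>c<t. B (r mod t) c * m (r div t, c, d))" for r d
    define B' where "B' e d = (\<Sum>r<n. C e r * X r d)" for e d
    have CX: "(\<Sum>r<n. C (s + a) r * X r d) = 0" if ad: "a < n - s" "d < s" for a d
    proof -
      have "(\<Sum>r<n. C (s + a) r * X r d)
          = (\<Sum>i<N. \<Sum>b<t. \<Sum>c<t. C (s + a) (i * t + b) * B b c * m (i, c, d))"
        by (simp add: reidx X_def sum_distrib_left mult.assoc)
      also have "\<dots> = (\<Sum>i<N. \<Sum>c<t. \<Sum>b<t. C (s + a) (i * t + b) * B b c * m (i, c, d))"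
        by (intro sum.cong refl sum.swap)
      also have "\<dots> = (\<Sum>i<N. \<Sum>c<t. (\<Sum>e<n - s. A a e * C (s + e) (i * t + c)) * m (i, c, d))"
        using E ad by (intro sum.cong refl) (simp add: sum_distrib_right)
      also have "\<dots> = (\<Sum>r<n. \<Sum>e<n - s. A a e * (C (s + e) r * F r d))"
        using ad FC(2) rlt
        by (simp add: reidx sum_distrib_right mult.assoc \<mu>_def n_def[symmetric])
      also have "\<dots> = (\<Sum>e<n - s. A a e * (\<Sum>r<n. C (s + e) r * F r d))"
        by (subst sum.swap) (simp add: sum_distrib_left)
      also have "\<dots> = 0" using FC(4) ad by (simp add: n_def)
      finally show ?thesis .
    qed
    \<comment> \<open>The projection kills X, so only the first s columns of F, those of the stacked
      matrix, contribute.\<close>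
    have X: "X r d = (\<Sum>c<s. F r c * B' c d)" if rd: "r < n" "d < s" for r d
    proof -
      have "X r d = (\<Sum>r'<n. (\<Sum>c<n. F r c * C c r') * X r' d)"
        using FC(3) rd by (simp add: n_def[symmetric] sum_delta_mult)
      also have "\<dots> = (\<Sum>r'<n. \<Sum>c<n. F r c * (C c r' * X r' d))"
        by (simp add: sum_distrib_right mult.assoc)
      also have "\<dots> = (\<Sum>c<n. F r c * B' c d)"
        unfolding B'_def by (subst sum.swap) (simp add: sum_distrib_left)
      also have "\<dots> = (\<Sum>c<s. F r c * B' c d)"
      proof (rule sum.mono_neutral_right)
        show "\<forall>c\<in>{..<n} - {..<s}. F r c * B' c d = 0"
        proof
          fix c assume "c \<in> {..<n} - {..<s}"
          then have "c - s < n - s" "c = s + (c - s)" by auto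
          then show "F r c * B' c d = 0" using CX[of "c - s" d] rd unfolding B'_def by simp
        qed
      qed (use FC(1) n_def in auto)
      finally show ?thesis .
    qed
    have "intertwines N s t m B B'" unfolding intertwines_def
    proof (intro allI impI)
      fix i a b assume h: "i < N" "a < t" "b < s"
      have "(\<Sum>c<t. B a c * m (i, c, b)) = X (i * t + a) b" using h by (simp add: X_def)
      also have "\<dots> = (\<Sum>c<s. m (i, a, c) * B' c b)"
        using X[OF rlt[OF h(1,2)] h(3)] FC(2) rlt[OF h(1,2)] h by (simp add: \<mu>_def n_def[symmetric])
      finally show "(\<Sum>c<t. B a c * m (i, c, b)) = (\<Sum>c<s. m (i, a, c) * B' c b)" .
    qed
    then obtain k where k: "scalar_mat t B k" using m unfolding brick_def by blast
    \<comment> \<open>With B the scalar k, the relation E reads A Q = k Q for the projection Q. The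
      last columns of F are a right inverse of Q, and so A = k.\<close>
    have AC: "(\<Sum>c<n - s. A a c * C (s + c) r) = k * C (s + a) r" if ar: "a < n - s" "r < n" for a r
    proof -
      have r: "r div t < N" "r mod t < t" "r div t * t + r mod t = r"
        using ar t by (auto simp: n_def less_mult_imp_div_less)
      have "(\<Sum>c<t. C (s + a) (r div t * t + c) * B c (r mod t))
          = (\<Sum>c<t. if c = r mod t then C (s + a) r * k else 0)"
        using k r unfolding scalar_mat_def by (intro sum.cong) auto
      also have "\<dots> = k * C (s + a) r" using r by simp
      finally show ?thesis using E[of "r div t" a "r mod t"] r ar by simp
    qed
    have "A a b = (if a = b then k else 0)" if ab: "a < n - s" "b < n - s" for a b
    proof -
      have "A a b = (\<Sum>c<n - s. A a c * (if c = b then 1 else 0))" using ab by (simp add: sum_delta_mult)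
      also have "\<dots> = (\<Sum>c<n - s. A a c * (\<Sum>r<n. C (s + c) r * F r (s + b)))"
        using FC(4) ab by (simp add: n_def)
      also have "\<dots> = (\<Sum>r<n. (\<Sum>c<n - s. A a c * C (s + c) r) * F r (s + b))"
        by (simp add: sum_distrib_left sum_distrib_right mult.assoc) (rule sum.swap)
      also have "\<dots> = k * (\<Sum>r<n. C (s + a) r * F r (s + b))"
        using AC ab by (simp add: sum_distrib_left mult.assoc)
      also have "\<dots> = (if a = b then k else 0)" using FC(4) ab by (simp add: n_def)
      finally show ?thesis .
    qed
    then show "\<exists>k. scalar_mat (n - s) A k \<and> scalar_mat t B k"
      using k unfolding scalar_mat_def by blast
  qed
  then show ?thesis using FC(1) n_def by blast
qed

section \<open>The quadratic form s^2 - N s t + t^2 and descent on it\<close>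

lemma quadric_negative:
  fixes N s t :: int
  assumes "N \<ge> 3" "s \<ge> 1" "s \<le> t" "t \<le> (N - 1) * s"
  shows "s^2 - N * s * t + t^2 < 0"
proof -
  \<comment> \<open>The form equals -(N - 2) s^2 minus this product.\<close>
  have "(t - s) * ((N - 1) * s - t) \<ge> 0" using assms by simp
  then have "t^2 \<le> N * s * t - (N - 1) * s^2" by (simp add: algebra_simps power2_eq_square)
  moreover have "(N - 2) * s^2 > 0" using assms by simp
  ultimately show ?thesis by (simp add: algebra_simps)
qed

text \<open>For fixed s the form is invariant under t -> N s - t, and beyond t = (N - 1) s the new
  value s' = N s - t is below s. The result has the shape of a case distinction because two
  inductions follow it: one builds modules, the other identifies the solutions of value 1.\<close>

lemma quadric_descent:
  fixes N s t :: nat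
  assumes N: "N \<ge> 3" and st: "s < t" and q: "(int s)^2 - int N * int s * int t + (int t)^2 \<le> 1"
    and P0: "t = 1 \<Longrightarrow> s = 0 \<Longrightarrow> P"
    and P1: "s \<ge> 1 \<Longrightarrow> t \<le> (N - 1) * s \<Longrightarrow> P"
    and step: "\<And>s'. s' < s \<Longrightarrow> s' + t = N * s \<Longrightarrow>
        (int s')^2 - int N * int s' * int s + (int s)^2 = (int s)^2 - int N * int s * int t + (int t)^2
          \<Longrightarrow> P"
  shows P
proof (cases "s = 0")
  case True
  then have "(int t)^2 \<le> 1" using q by simp
  then have "int t \<le> 1" by (meson less_le_not_le linorder_not_less one_less_power pos2)
  then show ?thesis using P0 True st by simp
next
  case False
  show ?thesis
  proof (cases "t \<le> (N - 1) * s")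
    case True then show ?thesis using P1 False by simp
  next
    case gt: False
    \<comment> \<open>A negative s' is impossible: t (t - N s) \<ge> 1 together with s^2 \<ge> 1
      would make the form at least 2.\<close>
    have "t \<le> N * s"
    proof (rule ccontr)
      assume "\<not> t \<le> N * s"
      then have "N * s + 1 \<le> t" by simp
      then have "int (N * s + 1) \<le> int t" by (simp only: of_nat_le_iff)
      then have "int t - int N * int s \<ge> 1" by simp
      moreover have "int t \<ge> 1" using st by simp
      ultimately have "1 * 1 \<le> int t * (int t - int N * int s)" by (intro mult_mono) auto
      moreover have "(int s)^2 > 0" using False by simp
      ultimately show False using q by (simp add: algebra_simps power2_eq_square)
    qed
    then have e: "(N * s - t) + t = N * s" by simp
    have "N * s = (N - 1) * s + s" using N by (cases N) auto
    then have "N * s - t < s" using gt False by linarith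
    moreover have i: "int (N * s - t) = int N * int s - int t" using \<open>t \<le> N * s\<close> by (simp add: of_nat_diff)
    have "(int (N * s - t))^2 - int N * int (N * s - t) * int s + (int s)^2
        = (int s)^2 - int N * int s * int t + (int t)^2"
      unfolding i by (simp add: algebra_simps power2_eq_square)
    ultimately show ?thesis using step[OF _ e] by blast
  qed
qed

text \<open>The induction is on t because the reflected pair (s', s) has s < t as its second
  entry.\<close>

lemma brick_exists:
  fixes N s t :: nat
  assumes N: "N \<ge> 3" and st: "s < t" and q: "(int s)^2 - int N * int s * int t + (int t)^2 \<le> 1"
  shows "\<exists>m. brick N s t m"
  using st q
proof (induction t arbitrary: s rule: less_induct)
  case (less t)
  show ?case
  proof (rule quadric_descent[OF N less.prems])
    assume "t = 1" "s = 0"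
    then have "brick N s t (\<lambda>_. 0)" unfolding brick_def scalar_mat_def by simp
    then show "\<exists>m. brick N s t m" by blast
  next
    assume "s \<ge> 1" "t \<le> (N - 1) * s"
    then show "\<exists>m. brick N s t m" using brick_wide[OF N] less.prems by blast
  next
    fix s' assume s': "s' < s" "s' + t = N * s"
      "(int s')^2 - int N * int s' * int s + (int s)^2 = (int s)^2 - int N * int s * int t + (int t)^2"
    have "\<exists>m. brick N s' s m"
      using less.IH[OF less.prems(1) s'(1)] s'(3) less.prems(2) by simp
    then obtain m where "brick N s' s m" by blast
    moreover have "s \<ge> 1" using s'(1) by simp
    ultimately have "\<exists>m. brick N s (N * s - s') m" using brick_reflect by blast
    moreover have "N * s - s' = t" using s'(2) by simp
    ultimately show "\<exists>m. brick N s t m" by simp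
  qed
qed

section \<open>The numerical sequence\<close>

lemma a_seq_0 [simp]: "a_seq N 0 = 0"
  by (simp add: a_seq_def)

lemma root_N:
  assumes N: "N \<ge> 3"
  shows "sqrt (real N ^ 2 - 4) > 0" "sqrt (real N ^ 2 - 4) ^ 2 = real N ^ 2 - 4"
    "sqrt (real N ^ 2 - 4) < real N" "real N - sqrt (real N ^ 2 - 4) < 2"
proof -
  have "(real N)^2 \<ge> 3^2" using N by (intro power_mono) auto
  then have g: "real N ^ 2 - 4 \<ge> 5" by simp
  then show "sqrt (real N ^ 2 - 4) > 0" "sqrt (real N ^ 2 - 4) ^ 2 = real N ^ 2 - 4" by auto
  show "sqrt (real N ^ 2 - 4) < real N" using N by (intro real_less_lsqrt) auto
  have "(real N - 2)^2 < real N ^ 2 - 4" using N by (simp add: power2_diff)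
  then have "real N - 2 < sqrt (real N ^ 2 - 4)" by (rule real_less_rsqrt)
  then show "real N - sqrt (real N ^ 2 - 4) < 2" by simp
qed

lemma a_seq_1: "N \<ge> 3 \<Longrightarrow> a_seq N (Suc 0) = 1"
  using root_N(1)[of N] by (simp add: a_seq_def diff_divide_distrib[symmetric])

lemma a_seq_rec:
  assumes N: "N \<ge> 3"
  shows "a_seq N (Suc (Suc k)) = real N * a_seq N (Suc k) - a_seq N k"
proof -
  define r where "r = sqrt (real N ^ 2 - 4)"
  define x y where "x = (real N + r) / 2" and "y = (real N - r) / 2"
  have r: "r^2 = real N ^ 2 - 4" using root_N[OF N] by (simp add: r_def)
  \<comment> \<open>x and y are the roots of X^2 - N X + 1, the characteristic polynomial of the
    recursion.\<close>
  have x: "x^2 = real N * x - 1" and y: "y^2 = real N * y - 1"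
    using r unfolding x_def y_def by (simp_all add: power2_eq_square field_simps)
  have "x ^ Suc (Suc k) = x^2 * x^k" "y ^ Suc (Suc k) = y^2 * y^k" by (simp_all add: power2_eq_square)
  then have "x ^ Suc (Suc k) = real N * x ^ Suc k - x ^ k" "y ^ Suc (Suc k) = real N * y ^ Suc k - y ^ k"
    unfolding x y by (simp_all add: algebra_simps)
  then have "(x ^ Suc (Suc k) - y ^ Suc (Suc k)) / r
      = real N * ((x ^ Suc k - y ^ Suc k) / r) - (x ^ k - y ^ k) / r"
    by (simp add: right_diff_distrib diff_divide_distrib)
  then show ?thesis unfolding a_seq_def x_def y_def r_def .
qed

text \<open>A step of the recursion is the inverse of the reflection and fixes the form, whose value
  at (0, 1) is 1.\<close>

lemma a_seq_quadric:
  assumes "N \<ge> 3"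
  shows "(a_seq N k)^2 - real N * a_seq N k * a_seq N (Suc k) + (a_seq N (Suc k))^2 = 1"
proof (induction k)
  case 0 then show ?case using a_seq_1[OF assms] by simp
next
  case (Suc k) then show ?case unfolding a_seq_rec[OF assms, of k]
    by (simp add: algebra_simps power2_eq_square)
qed

text \<open>For 1 \<le> s < t \<le> (N - 1) s the form is negative, so a descent at value 1 can only
  stop at (0, 1) = (a_0, a_1); every step back is the recursion.\<close>

lemma quadric_eq_1_imp_a_seq:
  fixes N s t :: nat
  assumes N: "N \<ge> 3" and st: "s < t" and q: "(int s)^2 - int N * int s * int t + (int t)^2 = 1"
  shows "\<exists>k. real t = a_seq N (Suc k) \<and> real s = a_seq N k"
  using st q
proof (induction t arbitrary: s rule: less_induct)
  case (less t)
  have q1: "(int s)^2 - int N * int s * int t + (int t)^2 \<le> 1" using less.prems by simp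
  show ?case
  proof (rule quadric_descent[OF N less.prems(1) q1])
    assume "t = 1" "s = 0"
    then show "\<exists>k. real t = a_seq N (Suc k) \<and> real s = a_seq N k"
      using a_seq_1[OF N] by (intro exI[of _ 0]) simp
  next
    assume "s \<ge> 1" and ts: "t \<le> (N - 1) * s"
    have "int t \<le> int ((N - 1) * s)" using ts by (simp only: of_nat_le_iff)
    then have "int t \<le> (int N - 1) * int s" using N by (simp add: of_nat_diff)
    then have "(int s)^2 - int N * int s * int t + (int t)^2 < 0"
      using quadric_negative[of "int N" "int s" "int t"] N less.prems(1) \<open>s \<ge> 1\<close> by simp
    then show "\<exists>k. real t = a_seq N (Suc k) \<and> real s = a_seq N k" using less.prems by simp
  next
    fix s' assume s': "s' < s" "s' + t = N * s"
      "(int s')^2 - int N * int s' * int s + (int s)^2 = (int s)^2 - int N * int s * int t + (int t)^2"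
    then obtain k where k: "real s = a_seq N (Suc k)" "real s' = a_seq N k"
      using less.IH[OF less.prems(1) s'(1)] less.prems(2) by auto
    have "real s' + real t = real N * real s" using s'(2) by (metis of_nat_add of_nat_mult)
    then have "real t = a_seq N (Suc (Suc k))" using k a_seq_rec[OF N, of k] by simp
    then show "\<exists>k. real t = a_seq N (Suc k) \<and> real s = a_seq N k" using k by blast
  qed
qed

lemma quadric_real:
  fixes N s t :: nat
  shows "real_of_int ((int s)^2 - int N * int s * int t + (int t)^2)
    = (real s)^2 - real N * real s * real t + (real t)^2"
  by simp

lemma quadric_le_1_iff:
  fixes N s t :: nat
  assumes N: "N \<ge> 3" and st: "s < t" and q: "q = (int s)^2 - int N * int s * int t + (int t)^2"
  shows "q \<le> 1 \<longleftrightarrow> q \<le> 0 \<or> (\<exists>k::nat. real t = a_seq N (k + 1) \<and> real s = a_seq N k)"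
proof
  assume "q \<le> 1"
  then have "q \<le> 0 \<or> q = 1" by linarith
  then show "q \<le> 0 \<or> (\<exists>k::nat. real t = a_seq N (k + 1) \<and> real s = a_seq N k)"
    using quadric_eq_1_imp_a_seq[OF N st] q by auto
next
  assume "q \<le> 0 \<or> (\<exists>k::nat. real t = a_seq N (k + 1) \<and> real s = a_seq N k)"
  then show "q \<le> 1"
  proof
    assume "\<exists>k::nat. real t = a_seq N (k + 1) \<and> real s = a_seq N k"
    then have "real_of_int q = 1" unfolding q quadric_real using a_seq_quadric[OF N] by auto
    then show ?thesis by linarith
  qed simp
qed

text \<open>The form is (t - x s)(t - y s) with y < 1. As s < t, the second factor is positive, and
  the sign is that of the first.\<close>

lemma quadric_le_0_iff:
  fixes N s t :: nat
  assumes N: "N \<ge> 3" and st: "s < t" and q: "q = (int s)^2 - int N * int s * int t + (int t)^2"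
  shows "q \<le> 0 \<longleftrightarrow> real t \<le> (real N + sqrt (real N ^ 2 - 4)) / 2 * real s"
proof -
  define r where "r = sqrt (real N ^ 2 - 4)"
  define x y where "x = (real N + r) / 2" and "y = (real N - r) / 2"
  have r: "r^2 = real N ^ 2 - 4" "real N - r < 2" using root_N[OF N] by (simp_all add: r_def)
  have xy: "x + y = real N" "x * y = 1" using r unfolding x_def y_def
    by (simp_all add: power2_eq_square field_simps)
  have "real_of_int q = (real t - x * real s) * (real t - y * real s)"
  proof -
    have "(real t - x * real s) * (real t - y * real s)
        = (real t)^2 - (x + y) * real s * real t + (x * y) * (real s)^2"
      by (simp add: algebra_simps power2_eq_square)
    then show ?thesis unfolding q quadric_real xy by simp
  qed
  moreover have "y * real s \<le> 1 * real s" using r by (intro mult_right_mono) (auto simp: y_def)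
  then have "real t - y * real s > 0" using st by simp
  ultimately have "real_of_int q \<le> 0 \<longleftrightarrow> real t - x * real s \<le> 0"
    by (simp add: mult_le_0_iff)
  then show ?thesis unfolding x_def r_def by simp
qed

section \<open>Polynomial functions and the Nullstellensatz\<close>

lemma poly_fun_sum:
  "(\<And>a. a \<in> A \<Longrightarrow> f a \<in> poly_fun I) \<Longrightarrow> (\<lambda>x. \<Sum>a\<in>A. f a x) \<in> poly_fun I"
  by (induction A rule: infinite_finite_induct) (auto intro: poly_fun.intros)

lemma poly_fun_prod:
  "(\<And>a. a \<in> A \<Longrightarrow> f a \<in> poly_fun I) \<Longrightarrow> (\<lambda>x. \<Prod>a\<in>A. f a x) \<in> poly_fun I"
  by (induction A rule: infinite_finite_induct) (auto intro: poly_fun.intros)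

lemma poly_fun_diff:
  assumes "f \<in> poly_fun I" "g \<in> poly_fun I" shows "(\<lambda>x. f x - g x) \<in> poly_fun I"
proof -
  have "(\<lambda>x. f x + (- 1) * g x) \<in> poly_fun I" by (intro poly_fun.intros assms)
  then show ?thesis by simp
qed

lemma poly_fun_mono: "f \<in> poly_fun I \<Longrightarrow> I \<subseteq> J \<Longrightarrow> f \<in> poly_fun J"
  by (induction rule: poly_fun.induct) (auto intro: poly_fun.intros)

lemma poly_fun_cong: "f \<in> poly_fun I \<Longrightarrow> (\<And>i. i \<in> I \<Longrightarrow> x i = y i) \<Longrightarrow> f x = f y"
  by (induction rule: poly_fun.induct) auto

lemma poly_fun_det:
  assumes "\<And>i j. i < n \<Longrightarrow> j < n \<Longrightarrow> (\<lambda>x. f x i j) \<in> poly_fun I"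
  shows "(\<lambda>x. det (mat n n (\<lambda>(i, j). f x i j))) \<in> poly_fun I"
proof -
  have lt: "p i < n" if "p permutes {0..<n}" "i < n" for p i
    using permutes_in_image[OF that(1), of i] that(2) by simp
  have "(\<lambda>x. \<Sum>p\<in>{p. p permutes {0..<n}}. signof p * (\<Prod>i = 0..<n. f x i (p i))) \<in> poly_fun I"
    using assms by (intro poly_fun_sum poly_fun.mult poly_fun.const poly_fun_prod)
      (auto simp: lt)
  moreover have "det (mat n n (\<lambda>(i, j). f x i j))
      = (\<Sum>p\<in>{p. p permutes {0..<n}}. signof p * (\<Prod>i = 0..<n. f x i (p i)))" for x
    by (subst det_def') (auto intro!: sum.cong prod.cong simp: lt)
  ultimately show ?thesis by simp
qed

definition poly_ideal :: "'i set \<Rightarrow> (('i \<Rightarrow> complex) \<Rightarrow> complex) set \<Rightarrow> bool" where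
  "poly_ideal I J \<longleftrightarrow> J \<subseteq> poly_fun I \<and> (\<lambda>_. 0) \<in> J \<and>
     (\<forall>f\<in>J. \<forall>g\<in>J. (\<lambda>x. f x + g x) \<in> J) \<and> (\<forall>f\<in>poly_fun I. \<forall>g\<in>J. (\<lambda>x. f x * g x) \<in> J)"

definition ideal_gen ::
    "'i set \<Rightarrow> (('i \<Rightarrow> complex) \<Rightarrow> complex) set \<Rightarrow> (('i \<Rightarrow> complex) \<Rightarrow> complex) set" where
  "ideal_gen I G = {h. \<exists>F c. finite F \<and> F \<subseteq> G \<and> (\<forall>g\<in>F. c g \<in> poly_fun I) \<and>
     h = (\<lambda>x. \<Sum>g\<in>F. c g x * g x)}"

lemma poly_ideal_gen:
  assumes G: "G \<subseteq> poly_fun I" shows "poly_ideal I (ideal_gen I G)"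
  unfolding poly_ideal_def
proof (intro conjI ballI)
  show "ideal_gen I G \<subseteq> poly_fun I"
    using G by (auto simp: ideal_gen_def intro!: poly_fun_sum poly_fun.mult)
  show "(\<lambda>_. 0) \<in> ideal_gen I G" unfolding ideal_gen_def by (auto intro!: exI[of _ "{}"])
next
  fix f g assume "f \<in> ideal_gen I G" "g \<in> ideal_gen I G"
  then obtain F c F' c' where F: "finite F" "F \<subseteq> G" "\<forall>g\<in>F. c g \<in> poly_fun I" "f = (\<lambda>x. \<Sum>g\<in>F. c g x * g x)"
    and F': "finite F'" "F' \<subseteq> G" "\<forall>g\<in>F'. c' g \<in> poly_fun I" "g = (\<lambda>x. \<Sum>g\<in>F'. c' g x * g x)"
    unfolding ideal_gen_def by blast
  \<comment> \<open>The coefficients of a common generator are added.\<close>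
  define d where "d h x = (if h \<in> F then c h x else 0) + (if h \<in> F' then c' h x else 0)" for h x
  have "d h \<in> poly_fun I" for h
    unfolding d_def using F(3) F'(3)
    by (cases "h \<in> F"; cases "h \<in> F'") (auto intro!: poly_fun.intros)
  moreover have "f x + g x = (\<Sum>h\<in>F \<union> F'. d h x * h x)" for x
  proof -
    have "(\<Sum>h\<in>F \<union> F'. d h x * h x) = (\<Sum>h\<in>F \<union> F'. (if h \<in> F then c h x * h x else 0))
        + (\<Sum>h\<in>F \<union> F'. (if h \<in> F' then c' h x * h x else 0))"
      unfolding sum.distrib[symmetric] by (intro sum.cong) (auto simp: d_def algebra_simps)
    also have "(\<Sum>h\<in>F \<union> F'. (if h \<in> F then c h x * h x else 0)) = f x"
      unfolding F(4) using F F' by (intro sum.mono_neutral_cong_right) auto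
    also have "(\<Sum>h\<in>F \<union> F'. (if h \<in> F' then c' h x * h x else 0)) = g x"
      unfolding F'(4) using F F' by (intro sum.mono_neutral_cong_right) auto
    finally show ?thesis by simp
  qed
  ultimately show "(\<lambda>x. f x + g x) \<in> ideal_gen I G"
    unfolding ideal_gen_def using F F'
    by (intro CollectI exI[of _ "F \<union> F'"] exI[of _ d]) (auto intro!: ext)
next
  fix f g assume f: "f \<in> poly_fun I" and "g \<in> ideal_gen I G"
  then obtain F c where F: "finite F" "F \<subseteq> G" "\<forall>g\<in>F. c g \<in> poly_fun I" "g = (\<lambda>x. \<Sum>g\<in>F. c g x * g x)"
    unfolding ideal_gen_def by blast
  have "(\<lambda>x. f x * g x) = (\<lambda>x. \<Sum>g\<in>F. (f x * c g x) * g x)"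
    unfolding F(4) by (simp add: sum_distrib_left mult.assoc)
  then show "(\<lambda>x. f x * g x) \<in> ideal_gen I G"
    unfolding ideal_gen_def using F f
    by (intro CollectI exI[of _ F] exI[of _ "\<lambda>g x. f x * c g x"]) (auto intro: poly_fun.mult)
qed

lemma ideal_gen_superset: "G \<subseteq> ideal_gen I G"
proof
  fix g assume "g \<in> G"
  then show "g \<in> ideal_gen I G" unfolding ideal_gen_def
    by (intro CollectI exI[of _ "{g}"] exI[of _ "\<lambda>_ _. 1"]) (auto intro: poly_fun.const)
qed

text \<open>Monomials are indexed by words instead of exponents: repetitions do no harm to a
  spanning set, concatenation is multiplication, and there are countably many words over a countable
  set.\<close>

definition monomial_fun :: "'i list \<Rightarrow> ('i \<Rightarrow> complex) \<Rightarrow> complex" where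
  "monomial_fun l = (\<lambda>x. \<Prod>i\<leftarrow>l. x i)"

lemma poly_fun_in_span:
  assumes "f \<in> poly_fun I" shows "f \<in> fv.span (monomial_fun ` lists I)"
  using assms
proof (induction rule: poly_fun.induct)
  case (const c)
  have "fscale c (monomial_fun []) \<in> fv.span (monomial_fun ` lists I)"
    by (intro fv.span_scale fv.span_base) auto
  also have "fscale c (monomial_fun []) = (\<lambda>x. c)" by (simp add: fscale_def monomial_fun_def)
  finally show ?case .
next
  case (coord i)
  have "monomial_fun [i] \<in> fv.span (monomial_fun ` lists I)"
    using coord by (intro fv.span_base) auto
  then show ?case by (simp add: monomial_fun_def)
next
  case (add f g)
  then show ?case using fv.span_add[of f _ g] by (simp add: plus_fun_def)
next
  case (mult f g)
  let ?S = "fv.span (monomial_fun ` lists I)"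
  have 1: "(\<lambda>x. monomial_fun l x * h x) \<in> ?S" if "l \<in> lists I" "h \<in> ?S" for l h
    using that(2)
  proof (induction rule: fv.span_induct_alt)
    case base
    then show ?case using fv.span_zero[of "monomial_fun ` lists I"] by (simp add: zero_fun_def)
  next
    case (step c u v)
    then obtain l' where l': "u = monomial_fun l'" "l' \<in> lists I" by auto
    have "fscale c (monomial_fun (l @ l')) + (\<lambda>x. monomial_fun l x * v x) \<in> ?S"
      using that l' by (intro fv.span_add fv.span_scale step.IH fv.span_base) auto
    also have "fscale c (monomial_fun (l @ l')) + (\<lambda>x. monomial_fun l x * v x)
        = (\<lambda>x. monomial_fun l x * (fscale c u + v) x)"
      by (auto simp: fscale_def l' monomial_fun_def algebra_simps fun_eq_iff)
    finally show ?case .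
  qed
  show ?case using mult.IH(1)
  proof (induction rule: fv.span_induct_alt)
    case base
    then show ?case using fv.span_zero[of "monomial_fun ` lists I"] by (simp add: zero_fun_def)
  next
    case (step c u v)
    then obtain l where l: "u = monomial_fun l" "l \<in> lists I" by auto
    have "fscale c (\<lambda>x. monomial_fun l x * g x) + (\<lambda>x. v x * g x) \<in> ?S"
      using l by (intro fv.span_add fv.span_scale step.IH 1 mult.IH(2))
    also have "fscale c (\<lambda>x. monomial_fun l x * g x) + (\<lambda>x. v x * g x)
        = (\<lambda>x. (fscale c u + v) x * g x)"
      by (auto simp: fscale_def l algebra_simps fun_eq_iff)
    finally show ?case .
  qed
qed

text \<open>As \<open>poly_fun I\<close> is a union of countably many finite-dimensional spaces, one of these contains
  infinitely many members of any family indexed by the complex numbers.\<close>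

lemma uncountable_family_dependent:
  fixes r :: "complex \<Rightarrow> ('i \<Rightarrow> complex) \<Rightarrow> complex"
  assumes I: "countable I" and r: "\<And>z. r z \<in> poly_fun I" and inj: "inj r"
  shows "\<exists>L a. finite L \<and> (\<exists>z\<in>L. a z \<noteq> 0) \<and> (\<forall>x. (\<Sum>z\<in>L. a z * r z x) = 0)"
proof -
  let ?M = "monomial_fun ` lists I :: (('i \<Rightarrow> complex) \<Rightarrow> complex) set"
  have cM: "countable ?M" using I by simp
  have nM: "?M \<noteq> {}" by auto
  define e where "e = from_nat_into ?M"
  have ran: "range e = ?M" unfolding e_def by (rule range_from_nat_into[OF nM cM])
  define V where "V n = fv.span (e ` {..<n})" for n :: nat
  have Vmono: "V n \<subseteq> V k" if "n \<le> k" for n k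
    unfolding V_def using that by (intro fv.span_mono) auto
  have ex: "\<exists>n. f \<in> V n" if "f \<in> fv.span ?M" for f
    using that
  proof (induction rule: fv.span_induct_alt)
    case base then show ?case unfolding V_def by (meson fv.span_zero)
  next
    case (step c u v)
    then obtain n k where "v \<in> V n" "u = e k" using ran by blast
    then have "v \<in> V (max n (Suc k))" using Vmono[of n "max n (Suc k)"] by auto
    moreover have "u \<in> V (max n (Suc k))"
      unfolding V_def \<open>u = e k\<close> by (intro fv.span_base) auto
    ultimately
    show ?case unfolding V_def by (meson fv.span_add fv.span_scale)
  qed
  \<comment> \<open>Otherwise the complex numbers would be a countable union of finite sets.\<close>
  have "\<exists>n. infinite {z. r z \<in> V n}"
  proof (rule ccontr)
    assume "\<not> ?thesis"
    then have "countable (\<Union>n. {z. r z \<in> V n})" by (intro countable_UN) (auto intro: countable_finite)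
    moreover have "(\<Union>n. {z. r z \<in> V n}) = UNIV" using ex poly_fun_in_span[OF r] by blast
    ultimately show False using uncountable_UNIV_complex by simp
  qed
  then obtain n where "infinite {z. r z \<in> V n}" by blast
  then obtain L where L: "finite L" "card L = Suc n" "L \<subseteq> {z. r z \<in> V n}"
    using infinite_arbitrarily_large by blast
  have cL: "card (r ` L) = Suc n" using L inj by (metis card_image inj_on_subset subset_UNIV)
  \<comment> \<open>These are n + 1 distinct vectors in the span of n vectors.\<close>
  have "fv.dependent (r ` L)"
  proof (rule ccontr)
    assume ind: "fv.independent (r ` L)"
    have "card (r ` L) \<le> card (e ` {..<n})"
      using fv.independent_span_bound[OF _ ind, of "e ` {..<n}"] L(3) V_def by auto
    also have "\<dots> \<le> n" using card_image_le[of "{..<n}" e] by simp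
    finally show False using cL by simp
  qed
  then obtain u where u: "\<exists>v\<in>r ` L. u v \<noteq> 0" "(\<Sum>v\<in>r ` L. fscale (u v) v) = 0"
    using fv.dependent_finite[of "r ` L"] L(1) by auto
  have "(\<Sum>z\<in>L. fscale (u (r z)) (r z)) = 0"
    using u(2) by (subst (asm) sum.reindex) (auto intro: inj_on_subset[OF inj])
  then have "(\<Sum>z\<in>L. fscale (u (r z)) (r z)) x = 0" for x by simp
  then have "(\<Sum>z\<in>L. u (r z) * r z x) = 0" for x by (simp add: sum_fun_apply fscale_def)
  then show ?thesis using L(1) u(1) by (intro exI[of _ L] exI[of _ "\<lambda>z. u (r z)"]) auto
qed

text \<open>If 1 is not in the ideal of \<open>G\<close>, take a maximal ideal M above it. The
  residue field has countable dimension over C, so it contains no transcendental x_i: the inverses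
  of x_i - z, for all complex z, would be an uncountable family, and a linear relation among them is
  an algebraic equation for x_i. Hence each x_i is a constant modulo M, and these constants form a
  common zero of \<open>G\<close>.\<close>

theorem weak_nullstellensatz:
  fixes G :: "(('i \<Rightarrow> complex) \<Rightarrow> complex) set"
  assumes I: "countable I" and G: "G \<subseteq> poly_fun I" and zero: "\<And>x. \<exists>g\<in>G. g x \<noteq> 0"
  shows "\<exists>F c. finite F \<and> F \<subseteq> G \<and> (\<forall>g\<in>F. c g \<in> poly_fun I) \<and> (\<forall>x. (\<Sum>g\<in>F. c g x * g x) = 1)"
proof (rule ccontr)
  assume contra: "\<not> ?thesis"
  let ?R = "poly_fun I"
  define \<A> where "\<A> = {J. poly_ideal I J \<and> G \<subseteq> J \<and> (\<lambda>_. 1) \<notin> J}"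
  have "(\<lambda>_. 1) \<notin> ideal_gen I G"
  proof
    assume "(\<lambda>_. 1) \<in> ideal_gen I G"
    then obtain F c where F: "finite F" "F \<subseteq> G" "\<forall>g\<in>F. c g \<in> poly_fun I"
      "(\<lambda>_. 1) = (\<lambda>x. \<Sum>g\<in>F. c g x * g x)" unfolding ideal_gen_def by blast
    have "\<forall>x. (\<Sum>g\<in>F. c g x * g x) = 1" using fun_cong[OF F(4)] by auto
    with F contra show False by blast
  qed
  then have "ideal_gen I G \<in> \<A>" unfolding \<A>_def using poly_ideal_gen[OF G] ideal_gen_superset by blast
  then have ne: "\<A> \<noteq> {}" by blast
  have "\<Union>C \<in> \<A>" if C: "C \<noteq> {}" "subset.chain \<A> C" for C
  proof -
    have CA: "J \<in> \<A>" if "J \<in> C" for J using C that by (auto simp: subset.chain_def)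
    have tot: "J \<subseteq> K \<or> K \<subseteq> J" if "J \<in> C" "K \<in> C" for J K
      using C that by (auto simp: subset.chain_def)
    have "poly_ideal I (\<Union>C)" unfolding poly_ideal_def
    proof (intro conjI ballI)
      show "\<Union>C \<subseteq> ?R" using CA unfolding \<A>_def poly_ideal_def by blast
      show "(\<lambda>_. 0) \<in> \<Union>C" using C(1) CA unfolding \<A>_def poly_ideal_def by blast
    next
      fix f g assume "f \<in> \<Union>C" "g \<in> \<Union>C"
      then obtain J K where "f \<in> J" "J \<in> C" "g \<in> K" "K \<in> C" by blast
      then obtain J where "f \<in> J" "g \<in> J" "J \<in> C" using tot by blast
      then show "(\<lambda>x. f x + g x) \<in> \<Union>C" using CA unfolding \<A>_def poly_ideal_def by blast
    next
      fix f g assume "f \<in> ?R" "g \<in> \<Union>C"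
      then show "(\<lambda>x. f x * g x) \<in> \<Union>C" using CA unfolding \<A>_def poly_ideal_def by blast
    qed
    then show ?thesis using C(1) CA unfolding \<A>_def by blast
  qed
  then obtain M where M: "M \<in> \<A>" and max: "\<And>J. J \<in> \<A> \<Longrightarrow> M \<subseteq> J \<Longrightarrow> J = M"
    using subset_Zorn_nonempty[OF ne] by blast
  have MR: "M \<subseteq> ?R" and M0: "(\<lambda>_. 0) \<in> M" and GM: "G \<subseteq> M" and M1: "(\<lambda>_. 1) \<notin> M"
    and Madd: "\<And>f g. f \<in> M \<Longrightarrow> g \<in> M \<Longrightarrow> (\<lambda>x. f x + g x) \<in> M"
    and Mmul: "\<And>f g. f \<in> ?R \<Longrightarrow> g \<in> M \<Longrightarrow> (\<lambda>x. f x * g x) \<in> M"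
    using M unfolding \<A>_def poly_ideal_def by blast+
  have Mcm: "(\<lambda>x. c * f x) \<in> M" if "f \<in> M" for c f
    using Mmul[OF poly_fun.const that] by simp
  have Mdiff: "(\<lambda>x. f x - g x) \<in> M" if "f \<in> M" "g \<in> M" for f g
    using Madd[OF that(1) Mcm[OF that(2), of "- 1"]] by simp
  have Msum: "(\<lambda>x. \<Sum>a\<in>A. h a x) \<in> M" if "\<And>a. a \<in> A \<Longrightarrow> h a \<in> M" for h and A :: "complex set"
    using that by (induction A rule: infinite_finite_induct) (auto intro: M0 Madd)
  have Mconst: "c = 0" if "(\<lambda>_. c) \<in> M" for c
    using Mcm[OF that, of "inverse c"] M1 by (cases "c = 0") auto
  have inv: "\<exists>r\<in>?R. (\<lambda>x. r x * f x - 1) \<in> M" if f: "f \<in> ?R" "f \<notin> M" for f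
  proof -
    \<comment> \<open>The ideal generated by M and f; maximality puts 1 into it.\<close>
    define J where "J = {\<lambda>x. r x * f x + h x | r h. r \<in> ?R \<and> h \<in> M}"
    have JI: "(\<lambda>x. r x * f x + h x) \<in> J" if "r \<in> ?R" "h \<in> M" for r h
      using that unfolding J_def by blast
    have "poly_ideal I J" unfolding poly_ideal_def
    proof (intro conjI ballI)
      show "J \<subseteq> ?R" using f MR by (auto simp: J_def intro!: poly_fun.intros)
      show "(\<lambda>_. 0) \<in> J" using JI[OF poly_fun.const[of 0] M0] by simp
    next
      fix g k assume "g \<in> J" "k \<in> J"
      then obtain r h r' h' where "r \<in> ?R" "h \<in> M" "r' \<in> ?R" "h' \<in> M"
        "g = (\<lambda>x. r x * f x + h x)" "k = (\<lambda>x. r' x * f x + h' x)" unfolding J_def by blast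
      then show "(\<lambda>x. g x + k x) \<in> J"
        using JI[OF poly_fun.add[of r I r'] Madd[of h h']] by (simp add: algebra_simps)
    next
      fix g k assume "g \<in> ?R" "k \<in> J"
      then obtain r h where "g \<in> ?R" "r \<in> ?R" "h \<in> M" "k = (\<lambda>x. r x * f x + h x)" unfolding J_def by blast
      then show "(\<lambda>x. g x * k x) \<in> J"
        using JI[OF poly_fun.mult[of g I r] Mmul[of g h]] by (simp add: algebra_simps)
    qed
    moreover have MJ: "M \<subseteq> J"
    proof
      fix h assume "h \<in> M" then show "h \<in> J" using JI[OF poly_fun.const[of 0]] by simp
    qed
    moreover have "f \<in> J" using JI[OF poly_fun.const[of 1] M0] by simp
    ultimately have "(\<lambda>_. 1) \<in> J" using max[of J] f(2) GM unfolding \<A>_def by blast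
    then obtain r h where rh: "r \<in> ?R" "h \<in> M" "(\<lambda>_. 1) = (\<lambda>x. r x * f x + h x)" unfolding J_def by blast
    have "(\<lambda>x. r x * f x - 1) = (\<lambda>x. (- 1) * h x)"
      using fun_cong[OF rh(3)] by (auto simp: algebra_simps fun_eq_iff)
    then show ?thesis using rh(1) Mcm[OF rh(2), of "- 1"] by metis
  qed
  have prime: "g \<in> M" if fg: "(\<lambda>x. f x * g x) \<in> M" "f \<in> ?R" "f \<notin> M" "g \<in> ?R" for f g
  proof -
    obtain r where r: "r \<in> ?R" "(\<lambda>x. r x * f x - 1) \<in> M" using inv fg by blast
    have "(\<lambda>x. r x * (f x * g x) - g x * (r x * f x - 1)) \<in> M"
      using Mdiff[OF Mmul[OF r(1) fg(1)] Mmul[OF fg(4) r(2)]] .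
    then show ?thesis by (simp add: algebra_simps)
  qed
  \<comment> \<open>If this fails, every x_i - z has an inverse r z modulo M.\<close>
  have pt: "\<exists>z. (\<lambda>x. x i - z) \<in> M" if i: "i \<in> I" for i
  proof (rule ccontr)
    assume n: "\<not> ?thesis"
    have lin: "(\<lambda>x. x i - z) \<in> ?R" for z by (intro poly_fun_diff poly_fun.intros i)
    have "\<forall>z. \<exists>r. r \<in> ?R \<and> (\<lambda>x. r x * (x i - z) - 1) \<in> M" using inv[OF lin] n by blast
    from choice[OF this] obtain r
      where r: "\<And>z. r z \<in> ?R" "\<And>z. (\<lambda>x. r z x * (x i - z) - 1) \<in> M" by blast
    \<comment> \<open>If one function inverts both x_i - z and x_i - w, the difference of the two
      congruences puts it into M, and then 1 lies in M.\<close>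
    have "inj r"
    proof (rule injI, rule ccontr)
      fix z w assume zw: "r z = r w" "z \<noteq> w"
      have "(\<lambda>x. (r w x * (x i - w) - 1) - (r w x * (x i - z) - 1)) \<in> M"
        using Mdiff[OF r(2)[of w] r(2)[of z]] zw by simp
      then have "(\<lambda>x. (z - w) * r w x) \<in> M" by (simp add: algebra_simps)
      from Mcm[OF this, of "inverse (z - w)"] have "(\<lambda>x. inverse (z - w) * ((z - w) * r w x)) \<in> M" .
      moreover have "(\<lambda>x. inverse (z - w) * ((z - w) * r w x)) = r w" using zw(2) by (intro ext) simp
      ultimately have "r w \<in> M" by simp
      from Mdiff[OF Mmul[OF lin[of w] this] r(2)[of w]] show False using M1 by (simp add: algebra_simps)
    qed
    from uncountable_family_dependent[where r = r, OF I r(1) this]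
    obtain L a where La: "finite L" "\<exists>z\<in>L. a z \<noteq> 0" and La1: "\<forall>x. (\<Sum>z\<in>L. a z * r z x) = 0"
      by (elim exE conjE) rule
    have La0: "(\<Sum>z\<in>L. a z * r z x) = 0" for x using La1 by simp
    \<comment> \<open>The numerator of the sum of a_z / (X - z) over the common denominator, the
      product of all X - w.\<close>
    define p where "p = (\<Sum>z\<in>L. smult (a z) (\<Prod>w\<in>L - {z}. [:- w, 1:]))"
    have pp: "poly p y = (\<Sum>z\<in>L. a z * (\<Prod>w\<in>L - {z}. y - w))" for y
      unfolding p_def by (simp add: poly_sum poly_prod)
    \<comment> \<open>Multiplying the relation among the r z by the common denominator gives p(x_i)
      = 0 modulo M.\<close>
    have "(\<lambda>x. \<Sum>z\<in>L. (a z * (\<Prod>w\<in>L - {z}. x i - w)) * (r z x * (x i - z) - 1)) \<in> M"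
      by (intro Msum Mmul r poly_fun.mult poly_fun.const poly_fun_prod lin)
    moreover have "(\<Sum>z\<in>L. (a z * (\<Prod>w\<in>L - {z}. x i - w)) * (r z x * (x i - z) - 1)) = - poly p (x i)" for x
    proof -
      have "(\<Sum>z\<in>L. (a z * (\<Prod>w\<in>L - {z}. x i - w)) * (r z x * (x i - z) - 1))
          = (\<Sum>z\<in>L. (\<Prod>w\<in>L. x i - w) * (a z * r z x) - a z * (\<Prod>w\<in>L - {z}. x i - w))"
      proof (rule sum.cong[OF refl])
        fix z assume "z \<in> L"
        then have "(\<Prod>w\<in>L. x i - w) = (x i - z) * (\<Prod>w\<in>L - {z}. x i - w)" by (rule prod.remove[OF La(1)])
        then show "(a z * (\<Prod>w\<in>L - {z}. x i - w)) * (r z x * (x i - z) - 1)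
          = (\<Prod>w\<in>L. x i - w) * (a z * r z x) - a z * (\<Prod>w\<in>L - {z}. x i - w)"
          by (simp only:) (simp add: algebra_simps del: prod_diff1)
      qed
      also have "\<dots> = - poly p (x i)" unfolding pp
        by (simp add: sum_subtractf sum_distrib_left[symmetric] La0)
      finally show ?thesis .
    qed
    ultimately have "(\<lambda>x. - poly p (x i)) \<in> M" by simp
    from Mcm[OF this, of "- 1"] have pM: "(\<lambda>x. poly p (x i)) \<in> M" by simp
    obtain z where z: "z \<in> L" "a z \<noteq> 0" using La by blast
    \<comment> \<open>At a node z with a_z nonzero only its own summand survives, so p is not the
      zero polynomial.\<close>
    have "poly p z = (\<Sum>w\<in>L. if w = z then a z * (\<Prod>w\<in>L - {z}. z - w) else 0)"
      unfolding pp using z La(1) by (intro sum.cong) (auto simp: prod_zero_iff)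
    also have "\<dots> = a z * (\<Prod>w\<in>L - {z}. z - w)" using z La(1) by simp
    also have "\<dots> \<noteq> 0" using z La(1) by simp
    finally have "p \<noteq> 0" by auto
    \<comment> \<open>A nonzero polynomial in x_i splits into linear factors; none of these lies in
      M by assumption, and M is prime.\<close>
    have "(\<lambda>x. poly q (x i)) \<notin> M" if "q \<noteq> 0" for q
      using that
    proof (induction "degree q" arbitrary: q)
      case 0
      then obtain c where "q = [:c:]" "c \<noteq> 0" by (metis degree_eq_zeroE pCons_0_0)
      then show ?case using Mconst by auto
    next
      case (Suc d)
      then have "\<not> constant (poly q)" by (simp add: constant_degree)
      then obtain w where "poly q w = 0" using fundamental_theorem_of_algebra by blast
      then obtain q' where q': "q = [:- w, 1:] * q'" using poly_eq_0_iff_dvd by blast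
      then have "q' \<noteq> 0" using Suc.prems by auto
      then have "degree q = Suc (degree q')" unfolding q' by (subst degree_mult_eq) auto
      then have "d = degree q'" using Suc.hyps(2) by simp
      then have nq: "(\<lambda>x. poly q' (x i)) \<notin> M" using Suc.hyps(1) \<open>q' \<noteq> 0\<close> by blast
      have "(\<lambda>x. poly q' (x i)) \<in> ?R"
      proof (induction q')
        case (pCons a q')
        then show ?case by (auto intro!: poly_fun.intros i)
      qed (simp add: poly_fun.const)
      then show ?case
        using prime[of "\<lambda>x. x i - w" "\<lambda>x. poly q' (x i)"] nq lin[of w] n unfolding q' by (auto simp: algebra_simps)
    qed
    then show False using pM \<open>p \<noteq> 0\<close> by blast
  qed
  then obtain p0 where p0: "\<And>i. i \<in> I \<Longrightarrow> (\<lambda>x. x i - p0 i) \<in> M" by metis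
  \<comment> \<open>Modulo M every polynomial equals its value at p0, so the members of G vanish
    there.\<close>
  have ev: "(\<lambda>x. f x - f p0) \<in> M" if "f \<in> ?R" for f
    using that
  proof (induction rule: poly_fun.induct)
    case (add f g)
    from Madd[OF add.IH] show ?case by (simp add: algebra_simps)
  next
    case (mult f g)
    have "(\<lambda>x. f x * (g x - g p0) + g p0 * (f x - f p0)) \<in> M"
      by (intro Madd Mmul Mcm mult)
    then show ?case by (simp add: algebra_simps)
  qed (auto intro: M0 p0)
  have "g p0 = 0" if "g \<in> G" for g
  proof -
    have "(\<lambda>x. g x - (g x - g p0)) \<in> M" using that GM G by (intro Mdiff ev) auto
    then show ?thesis using Mconst by simp
  qed
  then show False using zero by blast
qed

section \<open>Laurent polynomials on the charts\<close>

definition laurent_monomial :: "nat \<Rightarrow> (nat \<Rightarrow> int) \<Rightarrow> (nat \<Rightarrow> complex) \<Rightarrow> complex" where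
  "laurent_monomial N \<alpha> x = (\<Prod>i<N. x i powi \<alpha> i)"

definition exponents :: "nat \<Rightarrow> nat set \<Rightarrow> int \<Rightarrow> (nat \<Rightarrow> int) set" where
  "exponents N S d = {\<alpha>. (\<forall>i\<ge>N. \<alpha> i = 0) \<and> (\<forall>i<N. i \<notin> S \<longrightarrow> 0 \<le> \<alpha> i) \<and> (\<Sum>i<N. \<alpha> i) = d}"

definition laurent_eval :: "nat \<Rightarrow> ((nat \<Rightarrow> int) \<Rightarrow> complex) \<Rightarrow> (nat \<Rightarrow> complex) \<Rightarrow> complex" where
  "laurent_eval N c x = (\<Sum>\<alpha> | c \<alpha> \<noteq> 0. c \<alpha> * laurent_monomial N \<alpha> x)"

text \<open>The sections of O(d) over the chart of S, as functions on its cone: poles are allowed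
  only along x_i = 0 with i in S. Only values on the chart count. For empty S these are the
  homogeneous polynomials of degree d.\<close>

definition laurent :: "nat \<Rightarrow> nat set \<Rightarrow> int \<Rightarrow> ((nat \<Rightarrow> complex) \<Rightarrow> complex) set" where
  "laurent N S d = {f. \<exists>c. finite {\<alpha>. c \<alpha> \<noteq> 0} \<and> {\<alpha>. c \<alpha> \<noteq> 0} \<subseteq> exponents N S d \<and>
     (\<forall>x\<in>chart N S. f x = laurent_eval N c x)}"

lemma laurent_eval_eq:
  "finite F \<Longrightarrow> {\<alpha>. c \<alpha> \<noteq> 0} \<subseteq> F \<Longrightarrow> laurent_eval N c x = (\<Sum>\<alpha>\<in>F. c \<alpha> * laurent_monomial N \<alpha> x)"
  unfolding laurent_eval_def by (rule sum.mono_neutral_left) auto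

lemma laurentI:
  "finite {\<alpha>. c \<alpha> \<noteq> 0} \<Longrightarrow> {\<alpha>. c \<alpha> \<noteq> 0} \<subseteq> exponents N S d \<Longrightarrow>
    (\<And>x. x \<in> chart N S \<Longrightarrow> f x = laurent_eval N c x) \<Longrightarrow> f \<in> laurent N S d"
  unfolding laurent_def by (intro CollectI exI[of _ c]) simp

lemma laurent_cong:
  "f \<in> laurent N S d \<Longrightarrow> (\<And>x. x \<in> chart N S \<Longrightarrow> f x = g x) \<Longrightarrow> g \<in> laurent N S d"
  unfolding laurent_def by force

lemma laurent_zero [simp]: "(\<lambda>x. 0) \<in> laurent N S d"
  unfolding laurent_def by (auto intro!: exI[of _ "\<lambda>_. 0"] simp: laurent_eval_def)

lemma laurent_term:
  assumes "\<alpha> \<in> exponents N S d" shows "(\<lambda>x. k * laurent_monomial N \<alpha> x) \<in> laurent N S d"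
proof -
  define c where "c \<beta> = (if \<beta> = \<alpha> then k else 0)" for \<beta>
  have sub: "{\<beta>. c \<beta> \<noteq> 0} \<subseteq> {\<alpha>}" by (auto simp: c_def split: if_splits)
  moreover have "laurent_eval N c x = k * laurent_monomial N \<alpha> x" for x
    by (subst laurent_eval_eq[OF _ sub]) (simp_all add: c_def)
  ultimately show ?thesis using assms finite_subset[OF sub] by (intro laurentI[where c = c]) auto
qed

lemma laurent_add:
  assumes "f \<in> laurent N S d" "g \<in> laurent N S d" shows "(\<lambda>x. f x + g x) \<in> laurent N S d"
proof -
  obtain c e where c: "finite {\<alpha>. c \<alpha> \<noteq> 0}" "{\<alpha>. c \<alpha> \<noteq> 0} \<subseteq> exponents N S d"
      "\<forall>x\<in>chart N S. f x = laurent_eval N c x"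
    and e: "finite {\<alpha>. e \<alpha> \<noteq> 0}" "{\<alpha>. e \<alpha> \<noteq> 0} \<subseteq> exponents N S d"
      "\<forall>x\<in>chart N S. g x = laurent_eval N e x"
    using assms unfolding laurent_def by blast
  define F where "F = {\<alpha>. c \<alpha> \<noteq> 0} \<union> {\<alpha>. e \<alpha> \<noteq> 0}"
  have F: "finite F" "{\<alpha>. c \<alpha> \<noteq> 0} \<subseteq> F" "{\<alpha>. e \<alpha> \<noteq> 0} \<subseteq> F" "{\<alpha>. c \<alpha> + e \<alpha> \<noteq> 0} \<subseteq> F"
    using c e by (auto simp: F_def)
  have "f x + g x = laurent_eval N (\<lambda>\<alpha>. c \<alpha> + e \<alpha>) x" if "x \<in> chart N S" for x
    using that c(3) e(3) F by (simp add: laurent_eval_eq[of F] sum.distrib distrib_right)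
  moreover have "{\<alpha>. c \<alpha> + e \<alpha> \<noteq> 0} \<subseteq> exponents N S d" using F(4) c e by (auto simp: F_def)
  ultimately show ?thesis using finite_subset[OF F(4,1)] by (intro laurentI[where c = "\<lambda>\<alpha>. c \<alpha> + e \<alpha>"]) auto
qed

lemma laurent_sum:
  "(\<And>a. a \<in> A \<Longrightarrow> f a \<in> laurent N S d) \<Longrightarrow> (\<lambda>x. \<Sum>a\<in>A. f a x) \<in> laurent N S d"
  by (induction A rule: infinite_finite_induct) (auto intro: laurent_add)

lemma laurent_expand:
  assumes "f \<in> laurent N S d"
  shows "\<exists>F c. finite F \<and> F \<subseteq> exponents N S d \<and>
    (\<forall>x\<in>chart N S. f x = (\<Sum>\<alpha>\<in>F. c \<alpha> * laurent_monomial N \<alpha> x))"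
  using assms unfolding laurent_def laurent_eval_def by blast

lemma laurent_monomial_mult:
  assumes "\<alpha> \<in> exponents N S d" "\<beta> \<in> exponents N S e" "x \<in> chart N S"
  shows "laurent_monomial N (\<lambda>i. \<alpha> i + \<beta> i) x = laurent_monomial N \<alpha> x * laurent_monomial N \<beta> x"
  unfolding laurent_monomial_def prod.distrib[symmetric]
proof (rule prod.cong[OF refl])
  fix i assume "i \<in> {..<N}"
  \<comment> \<open>Where x i = 0, both exponents are nonnegative and the law of exponents holds;
    the case that both are 0 is treated separately.\<close>
  then have "x i \<noteq> 0 \<or> (\<alpha> i \<ge> 0 \<and> \<beta> i \<ge> 0)" using assms by (auto simp: exponents_def chart_def)
  then show "x i powi (\<alpha> i + \<beta> i) = x i powi \<alpha> i * x i powi \<beta> i"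
    by (cases "\<alpha> i = 0 \<and> \<beta> i = 0") (auto intro!: power_int_add)
qed

lemma laurent_mult:
  assumes f: "f \<in> laurent N S d" and g: "g \<in> laurent N S e"
  shows "(\<lambda>x. f x * g x) \<in> laurent N S (d + e)"
proof -
  obtain F c where F: "finite F" "F \<subseteq> exponents N S d"
    "\<forall>x\<in>chart N S. f x = (\<Sum>\<alpha>\<in>F. c \<alpha> * laurent_monomial N \<alpha> x)"
    using laurent_expand[OF f] by (elim exE conjE) rule
  obtain G k where G: "finite G" "G \<subseteq> exponents N S e"
    "\<forall>x\<in>chart N S. g x = (\<Sum>\<alpha>\<in>G. k \<alpha> * laurent_monomial N \<alpha> x)"
    using laurent_expand[OF g] by (elim exE conjE) rule
  have "(\<lambda>x. \<Sum>\<alpha>\<in>F. \<Sum>\<beta>\<in>G. (c \<alpha> * k \<beta>) * laurent_monomial N (\<lambda>i. \<alpha> i + \<beta> i) x) \<in> laurent N S (d + e)"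
    using F(2) G(2)
    by (intro laurent_sum laurent_term) (force simp: exponents_def sum.distrib subset_iff)
  then show ?thesis
  proof (rule laurent_cong)
    fix x assume x: "x \<in> chart N S"
    show "(\<Sum>\<alpha>\<in>F. \<Sum>\<beta>\<in>G. (c \<alpha> * k \<beta>) * laurent_monomial N (\<lambda>i. \<alpha> i + \<beta> i) x) = f x * g x"
      unfolding F(3)[rule_format, OF x] G(3)[rule_format, OF x] sum_product
    proof (intro sum.cong refl)
      fix \<alpha> \<beta> assume "\<alpha> \<in> F" "\<beta> \<in> G"
      then have "\<alpha> \<in> exponents N S d" "\<beta> \<in> exponents N S e" using F(2) G(2) by auto
      from laurent_monomial_mult[OF this x]
      show "(c \<alpha> * k \<beta>) * laurent_monomial N (\<lambda>i. \<alpha> i + \<beta> i) x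
          = c \<alpha> * laurent_monomial N \<alpha> x * (k \<beta> * laurent_monomial N \<beta> x)" by simp
    qed
  qed
qed

lemma laurent_const: "(\<lambda>x. k) \<in> laurent N S 0"
  using laurent_term[of "\<lambda>_. 0" N S 0 k] by (simp add: exponents_def laurent_monomial_def)

lemma laurent_scale: "f \<in> laurent N S d \<Longrightarrow> (\<lambda>x. k * f x) \<in> laurent N S d"
  using laurent_mult[OF laurent_const] by fastforce

lemma laurent_diff:
  "f \<in> laurent N S d \<Longrightarrow> g \<in> laurent N S d \<Longrightarrow> (\<lambda>x. f x - g x) \<in> laurent N S d"
  using laurent_add[OF _ laurent_scale[of g N S d "- 1"]] by fastforce

lemma laurent_powi:
  assumes "i < N" "k = 1 \<or> i \<in> S" shows "(\<lambda>x. x i powi k) \<in> laurent N S k"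
proof -
  have "laurent_monomial N (\<lambda>j. if j = i then k else 0) x = x i powi k" for x
  proof -
    have "laurent_monomial N (\<lambda>j. if j = i then k else 0) x = (\<Prod>j<N. if j = i then x i powi k else 1)"
      unfolding laurent_monomial_def by (intro prod.cong) auto
    then show ?thesis using assms by simp
  qed
  moreover have "(\<lambda>j. if j = i then k else 0) \<in> exponents N S k"
    using assms by (auto simp: exponents_def)
  ultimately show ?thesis using laurent_term[of "\<lambda>j. if j = i then k else 0" N S k 1] by simp
qed

lemma laurent_coord: "i < N \<Longrightarrow> (\<lambda>x. x i) \<in> laurent N S 1"
  using laurent_powi[of i N 1 S] by simp

lemma laurent_inverse: "i < N \<Longrightarrow> i \<in> S \<Longrightarrow> (\<lambda>x. inverse (x i)) \<in> laurent N S (- 1)"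
  using laurent_powi[of i N "- 1" S] by (simp add: power_int_minus)

lemma laurent_restrict:
  assumes "f \<in> laurent N S d" "S \<subseteq> S'" shows "f \<in> laurent N S' d"
proof -
  have "exponents N S d \<subseteq> exponents N S' d" "chart N S' \<subseteq> chart N S"
    using assms(2) by (auto simp: exponents_def chart_def)
  then show ?thesis using assms(1) unfolding laurent_def by blast
qed

section \<open>Global sections of O(d) for d < 0, d = 0 and d = 1\<close>

lemma chart_empty: "chart N {} = hcoords N"
  by (simp add: chart_def)

lemma laurent_global_neg:
  assumes f: "f \<in> laurent N {} d" and d: "d < 0" and x: "x \<in> hcoords N"
  shows "f x = 0"
proof -
  have "exponents N {} d = {}"
  proof (rule ccontr)
    assume "exponents N {} d \<noteq> {}"
    then obtain \<alpha> where "\<forall>i<N. 0 \<le> \<alpha> i" "(\<Sum>i<N. \<alpha> i) = d" by (auto simp: exponents_def)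
    then show False using d sum_nonneg[of "{..<N}" \<alpha>] by auto
  qed
  with laurent_expand[OF f] show ?thesis using x by (auto simp: chart_empty)
qed

lemma laurent_global_const:
  assumes f: "f \<in> laurent N {} 0"
  shows "\<exists>k. \<forall>x\<in>hcoords N. f x = k"
proof -
  have "exponents N {} 0 \<subseteq> {\<lambda>_. 0}"
  proof
    fix \<alpha> assume \<alpha>: "\<alpha> \<in> exponents N {} 0"
    then have "\<forall>i\<in>{..<N}. \<alpha> i = 0"
      by (subst sum_nonneg_eq_0_iff[symmetric]) (auto simp: exponents_def)
    then have "\<alpha> i = 0" for i using \<alpha> by (cases "i < N") (auto simp: exponents_def)
    then show "\<alpha> \<in> {\<lambda>_. 0}" by auto
  qed
  moreover obtain F c where F: "finite F" "F \<subseteq> exponents N {} 0"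
    "\<forall>x\<in>chart N {}. f x = (\<Sum>\<alpha>\<in>F. c \<alpha> * laurent_monomial N \<alpha> x)"
    using laurent_expand[OF f] by (elim exE conjE) rule
  ultimately have "F = {} \<or> F = {\<lambda>_. 0}" by blast
  then show ?thesis using F(3) by (auto simp: chart_empty laurent_monomial_def)
qed

lemma laurent_global_linear:
  assumes f: "f \<in> laurent N {} 1"
  shows "\<exists>g. \<forall>x\<in>hcoords N. f x = (\<Sum>i<N. x i * g i)"
proof -
  define u where "u i = (\<lambda>j::nat. if j = i then 1 else 0 :: int)" for i :: nat
  have sub: "exponents N {} 1 \<subseteq> u ` {..<N}"
  proof
    fix \<alpha> assume \<alpha>: "\<alpha> \<in> exponents N {} 1"
    then have nn: "\<And>i. i < N \<Longrightarrow> 0 \<le> \<alpha> i" and s: "(\<Sum>i<N. \<alpha> i) = 1" and o: "\<And>i. i \<ge> N \<Longrightarrow> \<alpha> i = 0"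
      by (auto simp: exponents_def)
    have "\<exists>i<N. \<alpha> i \<noteq> 0"
    proof (rule ccontr)
      assume "\<not> ?thesis" then have "(\<Sum>i<N. \<alpha> i) = 0" by simp
      then show False using s by simp
    qed
    then obtain i where i: "i < N" "\<alpha> i \<noteq> 0" by blast
    have r: "(\<Sum>i<N. \<alpha> i) = \<alpha> i + (\<Sum>j\<in>{..<N} - {i}. \<alpha> j)" using i by (intro sum.remove) auto
    have "(\<Sum>j\<in>{..<N} - {i}. \<alpha> j) \<ge> 0" using nn by (intro sum_nonneg) auto
    then have i1: "\<alpha> i = 1" "(\<Sum>j\<in>{..<N} - {i}. \<alpha> j) = 0" using r s nn[OF i(1)] i(2) by auto
    then have "\<forall>j\<in>{..<N} - {i}. \<alpha> j = 0"
      using nn by (subst sum_nonneg_eq_0_iff[symmetric]) auto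
    then have "\<alpha> = u i" using i1 o i(1) by (auto simp: u_def fun_eq_iff) (metis DiffI lessThan_iff not_le singletonD)
    then show "\<alpha> \<in> u ` {..<N}" using i by blast
  qed
  obtain c where c: "finite {\<alpha>. c \<alpha> \<noteq> 0}" "{\<alpha>. c \<alpha> \<noteq> 0} \<subseteq> exponents N {} 1"
      "\<forall>x\<in>chart N {}. f x = laurent_eval N c x"
    using f unfolding laurent_def by blast
  have inj: "inj_on u {..<N}" by (intro inj_onI) (metis u_def zero_neq_one)
  have "f x = (\<Sum>i<N. x i * c (u i))" if "x \<in> hcoords N" for x
  proof -
    have "f x = (\<Sum>\<alpha>\<in>u ` {..<N}. c \<alpha> * laurent_monomial N \<alpha> x)"
      using c sub that by (subst laurent_eval_eq[symmetric]) (auto simp: chart_empty)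
    also have "\<dots> = (\<Sum>i<N. c (u i) * laurent_monomial N (u i) x)"
      by (subst sum.reindex[OF inj]) simp
    also have "\<dots> = (\<Sum>i<N. x i * c (u i))"
    proof (rule sum.cong[OF refl])
      fix i assume "i \<in> {..<N}"
      moreover have "laurent_monomial N (u i) x = (\<Prod>j<N. if j = i then x i else 1)"
        unfolding laurent_monomial_def u_def by (intro prod.cong) auto
      ultimately show "c (u i) * laurent_monomial N (u i) x = x i * c (u i)" by simp
    qed
    finally show ?thesis .
  qed
  then show ?thesis by (intro exI[of _ "\<lambda>i. c (u i)"]) simp
qed

text \<open>Linear independence of characters: comparing the relation at \<open>x\<close> and at \<open>x y\<close>, where \<open>y\<close>
  separates two of the exponents, gives a shorter relation.\<close>

lemma laurent_monomials_independent:
  assumes "finite F" "\<And>\<alpha> i. \<alpha> \<in> F \<Longrightarrow> i \<ge> N \<Longrightarrow> \<alpha> i = 0"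
    "\<And>x. x \<in> affine_space {..<N} \<Longrightarrow> (\<forall>i<N. x i \<noteq> 0) \<Longrightarrow> (\<Sum>\<alpha>\<in>F. c \<alpha> * laurent_monomial N \<alpha> x) = 0"
    "\<alpha> \<in> F"
  shows "c \<alpha> = 0"
  using assms
proof (induction "card F" arbitrary: F c \<alpha>)
  case 0 then show ?case by simp
next
  case (Suc n)
  show ?case
  proof (cases "F = {\<alpha>}")
    case True
    have "c \<alpha> * laurent_monomial N \<alpha> (\<lambda>i. if i < N then 1 else 0) = 0"
      using Suc.prems(3)[of "\<lambda>i. if i < N then 1 else 0"] True by (simp add: affine_space_def)
    then show ?thesis by (simp add: laurent_monomial_def)
  next
    case False
    then obtain \<beta> where \<beta>: "\<beta> \<in> F" "\<beta> \<noteq> \<alpha>" using Suc.prems(4) by blast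
    then obtain i where i: "\<beta> i \<noteq> \<alpha> i" by (meson ext)
    then have iN: "i < N" using Suc.prems(2)[OF \<beta>(1)] Suc.prems(2)[OF Suc.prems(4)] by (metis not_le)
    \<comment> \<open>Multiplying x by y multiplies the monomial of \<gamma> by 2 to the power
      \<gamma> i, which separates \<alpha> from \<beta>.\<close>
    define y where "y = (\<lambda>j. if j < N then (if j = i then 2 else 1) else 0 :: complex)"
    have my: "laurent_monomial N \<gamma> y = 2 powi \<gamma> i" for \<gamma>
    proof -
      have "laurent_monomial N \<gamma> y = (\<Prod>j<N. if j = i then 2 powi \<gamma> i else 1)"
        unfolding laurent_monomial_def y_def by (intro prod.cong) auto
      then show ?thesis using iN by simp
    qed
    \<comment> \<open>The relation at x y minus 2 to the power \<beta> i times the relation at x has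
      no term at \<beta>.\<close>
    define c' where "c' \<gamma> = c \<gamma> * (2 powi \<gamma> i - 2 powi \<beta> i)" for \<gamma>
    have "c' \<alpha> = 0"
    proof (rule Suc.hyps(1)[of "F - {\<beta>}"])
      show "n = card (F - {\<beta>})" using Suc.hyps(2) \<beta>(1) Suc.prems(1) by simp
      show "finite (F - {\<beta>})" "\<alpha> \<in> F - {\<beta>}" using Suc.prems \<beta> by auto
      show "\<And>\<alpha> i. \<alpha> \<in> F - {\<beta>} \<Longrightarrow> i \<ge> N \<Longrightarrow> \<alpha> i = 0" using Suc.prems(2) by blast
    next
      fix x :: "nat \<Rightarrow> complex" assume x: "x \<in> affine_space {..<N}" "\<forall>i<N. x i \<noteq> 0"
      have xy: "laurent_monomial N \<gamma> (\<lambda>j. x j * y j) = laurent_monomial N \<gamma> x * 2 powi \<gamma> i" for \<gamma>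
        unfolding my[symmetric] laurent_monomial_def by (simp add: power_int_mult_distrib prod.distrib)
      have "(\<Sum>\<gamma>\<in>F. c \<gamma> * laurent_monomial N \<gamma> (\<lambda>j. x j * y j)) = 0"
        using x by (intro Suc.prems(3)) (auto simp: affine_space_def y_def)
      moreover have "(\<Sum>\<gamma>\<in>F. c \<gamma> * laurent_monomial N \<gamma> x) = 0" using x by (intro Suc.prems(3)) auto
      ultimately have "0 = (\<Sum>\<gamma>\<in>F. c \<gamma> * laurent_monomial N \<gamma> (\<lambda>j. x j * y j))
          - 2 powi \<beta> i * (\<Sum>\<gamma>\<in>F. c \<gamma> * laurent_monomial N \<gamma> x)" by simp
      also have "\<dots> = (\<Sum>\<gamma>\<in>F. c' \<gamma> * laurent_monomial N \<gamma> x)"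
        unfolding sum_distrib_left sum_subtractf[symmetric] xy c'_def
        by (intro sum.cong) (auto simp: algebra_simps)
      also have "\<dots> = (\<Sum>\<gamma>\<in>F - {\<beta>}. c' \<gamma> * laurent_monomial N \<gamma> x)"
        using Suc.prems(1) \<beta>(1) by (subst sum.remove[of _ \<beta>]) (auto simp: c'_def)
      finally show "(\<Sum>\<gamma>\<in>F - {\<beta>}. c' \<gamma> * laurent_monomial N \<gamma> x) = 0" by simp
    qed
    moreover have "(2::complex) powi \<alpha> i \<noteq> 2 powi \<beta> i"
    proof
      assume "(2::complex) powi \<alpha> i = 2 powi \<beta> i"
      then have "norm ((2::complex) powi \<alpha> i) = norm ((2::complex) powi \<beta> i)" by simp
      then have "(2::real) powi \<alpha> i = 2 powi \<beta> i" by (simp add: norm_power_int)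
      then show False
        using i power_int_strict_increasing[of "\<alpha> i" "\<beta> i" "2::real"]
          power_int_strict_increasing[of "\<beta> i" "\<alpha> i" "2::real"] by (cases "\<alpha> i < \<beta> i") auto
    qed
    ultimately show ?thesis by (simp add: c'_def)
  qed
qed

section \<open>The Cech complex of a line bundle\<close>

text \<open>The Cech coboundary of one matrix entry at one point, so that only the index set
  varies.\<close>

definition cob :: "(nat set \<Rightarrow> complex) \<Rightarrow> nat set \<Rightarrow> complex" where
  "cob c S = (\<Sum>i\<in>S. (- 1) ^ card {j\<in>S. j < i} * c (S - {i}))"

text \<open>Contraction towards the vertex j; the sign is given by the position of j in
  \<open>insert j S\<close>.\<close>

definition cone :: "nat \<Rightarrow> (nat set \<Rightarrow> complex) \<Rightarrow> nat set \<Rightarrow> complex" where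
  "cone j c S = (if j \<in> S then 0 else (- 1) ^ card {k\<in>S. k < j} * c (insert j S))"

lemma cob_cong: "(\<And>i. i \<in> S \<Longrightarrow> c (S - {i}) = c' (S - {i})) \<Longrightarrow> cob c S = cob c' S"
  unfolding cob_def by (intro sum.cong) auto

lemma cob_add: "cob (\<lambda>S. c S + c' S) S = cob c S + cob c' S"
  by (simp add: cob_def sum.distrib distrib_left)

lemma cob_diff: "cob (\<lambda>S. c S - c' S) S = cob c S - cob c' S"
  by (simp add: cob_def sum_subtractf right_diff_distrib)

lemma cob_mult_left: "cob (\<lambda>S. k * c S) S = k * cob c S"
  by (simp add: cob_def sum_distrib_left mult.left_commute)

lemma cob_mult_right: "cob (\<lambda>S. c S * k) S = cob c S * k"
  using cob_mult_left[of k c S] by (simp add: mult.commute)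

lemma cob_sum: "cob (\<lambda>S. \<Sum>a\<in>A. c a S) S = (\<Sum>a\<in>A. cob (c a) S)"
  unfolding cob_def sum_distrib_left by (rule sum.swap)

text \<open>If j is in S, only the term that removes j survives. Otherwise removing j from
  \<open>insert j S\<close> gives c S, and the other terms cancel because exchanging the removal of
  i with the insertion of j changes the sign.\<close>

lemma cone_homotopy:
  assumes S: "finite S" shows "cob (cone j c) S + cone j (cob c) S = c S"
proof (cases "j \<in> S")
  case True
  have "cob (cone j c) S = (\<Sum>i\<in>S. if i = j then c S else 0)" unfolding cob_def
  proof (rule sum.cong[OF refl])
    fix i assume "i \<in> S"
    have e: "{k \<in> S - {j}. k < j} = {k \<in> S. k < j}" by auto
    show "(- 1) ^ card {j \<in> S. j < i} * cone j c (S - {i}) = (if i = j then c S else 0)"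
    proof (cases "i = j")
      case True
      have "cone j c (S - {j}) = (- 1) ^ card {k \<in> S. k < j} * c S"
        unfolding cone_def e using \<open>j \<in> S\<close> by (simp add: insert_absorb)
      then show ?thesis using True
        by (simp add: mult.assoc[symmetric] power_add[symmetric] mult_2[symmetric])
    next
      case False
      then show ?thesis using \<open>j \<in> S\<close> by (simp add: cone_def)
    qed
  qed
  also have "\<dots> = c S" using True S by simp
  finally show ?thesis using True by (simp add: cone_def)
next
  case False
  have e: "{k \<in> insert j S. k < j} = {k \<in> S. k < j}" by auto
  let ?s = "(- 1) ^ card {k \<in> S. k < j} :: complex"
  have "cone j (cob c) S = ?s * ((- 1) ^ card {k \<in> insert j S. k < j} * c (insert j S - {j}) +
      (\<Sum>i\<in>S. (- 1) ^ card {k \<in> insert j S. k < i} * c (insert j S - {i})))"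
    using False S by (simp add: cone_def cob_def)
  also have "\<dots> = c S + (\<Sum>i\<in>S. ?s * (- 1) ^ card {k \<in> insert j S. k < i} * c (insert j S - {i}))"
    using False unfolding e
    by (simp add: distrib_left sum_distrib_left mult.assoc[symmetric] power_add[symmetric] mult_2[symmetric])
  also have "(\<Sum>i\<in>S. ?s * (- 1) ^ card {k \<in> insert j S. k < i} * c (insert j S - {i})) = - cob (cone j c) S"
    unfolding cob_def sum_negf[symmetric]
  proof (rule sum.cong[OF refl])
    fix i assume i: "i \<in> S"
    then have ij: "i \<noteq> j" using False by auto
    have ins: "insert j S - {i} = insert j (S - {i})" using ij by auto
    \<comment> \<open>Inserting j shifts the position of i if j < i, and removing i shifts the
      position of j if i < j; exactly one of the two happens, whence the sign.\<close>
    have 1: "card {k \<in> insert j S. k < i} = card {k \<in> S. k < i} + (if j < i then 1 else 0)"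
    proof (cases "j < i")
      case True
      then have "{k \<in> insert j S. k < i} = insert j {k \<in> S. k < i}" by auto
      then show ?thesis using True S False by simp
    next
      case nlt: False
      then have "{k \<in> insert j S. k < i} = {k \<in> S. k < i}" by auto
      then show ?thesis using nlt by simp
    qed
    have 2: "card {k \<in> S. k < j} = card {k \<in> S - {i}. k < j} + (if i < j then 1 else 0)"
    proof (cases "i < j")
      case True
      then have "{k \<in> S. k < j} = insert i {k \<in> S - {i}. k < j}" using i by auto
      then show ?thesis using True S by simp
    next
      case nlt: False
      then have "{k \<in> S. k < j} = {k \<in> S - {i}. k < j}" by auto
      then show ?thesis using nlt by simp
    qed
    have "j \<notin> S - {i}" using False by simp
    then show "?s * (- 1) ^ card {k \<in> insert j S. k < i} * c (insert j S - {i})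
        = - ((- 1) ^ card {j \<in> S. j < i} * cone j c (S - {i}))"
      unfolding 1 2 ins cone_def using ij by (cases "i < j") auto
  qed
  finally show ?thesis by simp
qed

text \<open>The homotopy replaces the computation with signs: used twice, it turns the induction
  hypothesis for the cone of c over the new vertex j into \<open>cone j (cob (cob c)) S = 0\<close>,
  and this is the value at \<open>insert j S\<close> up to sign.\<close>

lemma cob_cob:
  assumes "finite S" shows "cob (cob c) S = 0"
  using assms
proof (induction S arbitrary: c rule: finite_induct)
  case empty then show ?case by (simp add: cob_def)
next
  case (insert j S)
  have h: "cob (cone j c) T = c T - cone j (cob c) T" if "finite T" for c T
    using cone_homotopy[OF that, of j c] by (simp add: algebra_simps)
  have "0 = cob (cob (cone j c)) S" using insert.IH by simp
  also have "\<dots> = cob (\<lambda>T. c T - cone j (cob c) T) S"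
    using insert.hyps by (intro cob_cong h) auto
  also have "\<dots> = cone j (cob (cob c)) S" unfolding cob_diff using h[OF insert.hyps(1)] by simp
  finally show ?case using insert.hyps by (simp add: cone_def)
qed

text \<open>The complex splits by exponents. The summand of an exponent with a nonnegative entry at \<open>j\<close> is
  contracted by the cone over the vertex \<open>j\<close>; the degree bound provides such a vertex. The empty
  set, of degree \<open>-1\<close>, carries the global sections.\<close>

theorem laurent_cech_exact:
  assumes N: "N \<ge> 2" and d: "d \<ge> - 1"
    and f: "\<And>S. S \<subseteq> {..<N} \<Longrightarrow> card S = Suc p \<Longrightarrow> f S \<in> laurent N S d"
    and z: "\<And>S x. S \<subseteq> {..<N} \<Longrightarrow> card S = Suc (Suc p) \<Longrightarrow> x \<in> chart N S \<Longrightarrow> cob (\<lambda>S. f S x) S = 0"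
  shows "\<exists>e. (\<forall>S. S \<subseteq> {..<N} \<longrightarrow> card S = p \<longrightarrow> e S \<in> laurent N S d) \<and>
    (\<forall>S x. S \<subseteq> {..<N} \<longrightarrow> card S = Suc p \<longrightarrow> x \<in> chart N S \<longrightarrow> f S x = cob (\<lambda>S. e S x) S)"
proof -
  define good where "good S \<longleftrightarrow> S \<subseteq> {..<N} \<and> card S = Suc p" for S
  \<comment> \<open>The coefficients are made zero away from the relevant index sets, so that one
    finite set F holds all exponents that occur.\<close>
  have "\<forall>S. \<exists>c. finite {\<alpha>. c \<alpha> \<noteq> 0} \<and> {\<alpha>. c \<alpha> \<noteq> 0} \<subseteq> exponents N S d \<and>
     (good S \<longrightarrow> (\<forall>x\<in>chart N S. f S x = laurent_eval N c x)) \<and> (\<not> good S \<longrightarrow> c = (\<lambda>_. 0))"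
  proof
    fix S show "\<exists>c. finite {\<alpha>. c \<alpha> \<noteq> 0} \<and> {\<alpha>. c \<alpha> \<noteq> 0} \<subseteq> exponents N S d \<and>
     (good S \<longrightarrow> (\<forall>x\<in>chart N S. f S x = laurent_eval N c x)) \<and> (\<not> good S \<longrightarrow> c = (\<lambda>_. 0))"
      using f[of S] unfolding laurent_def by (cases "good S") (auto simp: good_def)
  qed
  from choice[OF this] obtain C where C: "\<And>S. finite {\<alpha>. C S \<alpha> \<noteq> 0}"
      "\<And>S. {\<alpha>. C S \<alpha> \<noteq> 0} \<subseteq> exponents N S d"
      "\<And>S x. good S \<Longrightarrow> x \<in> chart N S \<Longrightarrow> f S x = laurent_eval N (C S) x"
      "\<And>S. \<not> good S \<Longrightarrow> C S = (\<lambda>_. 0)" by blast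
  define F where "F = (\<Union>S\<in>Pow {..<N}. {\<alpha>. C S \<alpha> \<noteq> 0})"
  have finF: "finite F" unfolding F_def using C(1) by auto
  have CF: "{\<alpha>. C S \<alpha> \<noteq> 0} \<subseteq> F" for S
    using C(4)[of S] unfolding F_def good_def by (cases "good S") (auto simp: good_def)
  \<comment> \<open>If all N \<ge> 2 entries were negative, the degree would be at most -2.\<close>
  have ex_j: "\<exists>j<N. 0 \<le> \<alpha> j" if "\<alpha> \<in> F" for \<alpha>
  proof (rule ccontr)
    assume n: "\<not> ?thesis"
    have "(\<Sum>i<N. \<alpha> i) = d" using that C(2) unfolding F_def exponents_def by blast
    moreover have "(\<Sum>i<N. \<alpha> i) \<le> (\<Sum>i<N. - 1)" using n by (intro sum_mono) force
    ultimately show False using d N by simp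
  qed
  define j where "j \<alpha> = (SOME j. j < N \<and> 0 \<le> \<alpha> j)" for \<alpha> :: "nat \<Rightarrow> int"
  have j: "j \<alpha> < N" "0 \<le> \<alpha> (j \<alpha>)" if "\<alpha> \<in> F" for \<alpha>
    using someI_ex[OF ex_j[OF that]] unfolding j_def by auto
  \<comment> \<open>Coefficients are compared at points with no zero coordinate, which lie in every
    chart.\<close>
  have cobC: "cob (\<lambda>S. C S \<alpha>) S = 0" if S: "S \<subseteq> {..<N}" "card S = Suc (Suc p)" and \<alpha>: "\<alpha> \<in> F" for S \<alpha>
  proof (rule laurent_monomials_independent[OF finF _ _ \<alpha>])
    show "\<alpha> i = 0" if "\<alpha> \<in> F" "i \<ge> N" for \<alpha> i using that C(2) unfolding F_def exponents_def by blast
  next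
    fix x :: "nat \<Rightarrow> complex" assume x: "x \<in> affine_space {..<N}" "\<forall>i<N. x i \<noteq> 0"
    then have "x 0 \<noteq> 0" using N by simp
    then have "x \<noteq> 0" by auto
    then have xc: "x \<in> chart N T" if "T \<subseteq> {..<N}" for T
      using x that by (auto simp: chart_def hcoords_def)
    have "(\<Sum>\<alpha>\<in>F. cob (\<lambda>S. C S \<alpha>) S * laurent_monomial N \<alpha> x)
        = cob (\<lambda>S. \<Sum>\<alpha>\<in>F. C S \<alpha> * laurent_monomial N \<alpha> x) S"
      by (simp add: cob_sum cob_mult_right)
    also have "\<dots> = cob (\<lambda>S. f S x) S"
    proof (rule cob_cong)
      fix i assume "i \<in> S"
      then have "good (S - {i})" "S - {i} \<subseteq> {..<N}" using S by (auto simp: good_def)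
      then show "(\<Sum>\<alpha>\<in>F. C (S - {i}) \<alpha> * laurent_monomial N \<alpha> x) = f (S - {i}) x"
        using C(3) xc laurent_eval_eq[OF finF CF] by simp
    qed
    also have "\<dots> = 0" using z S xc by blast
    finally show "(\<Sum>\<alpha>\<in>F. cob (\<lambda>S. C S \<alpha>) S * laurent_monomial N \<alpha> x) = 0" .
  qed
  define D where "D S \<alpha> = cone (j \<alpha>) (\<lambda>S. C S \<alpha>) S" for S \<alpha>
  have D0: "D S \<alpha> \<noteq> 0 \<Longrightarrow> j \<alpha> \<notin> S \<and> C (insert (j \<alpha>) S) \<alpha> \<noteq> 0" for S \<alpha>
    by (auto simp: D_def cone_def split: if_splits)
  have DF: "{\<alpha>. D S \<alpha> \<noteq> 0} \<subseteq> F" for S using D0 CF by blast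
  \<comment> \<open>A term at S is inherited from \<open>insert (j \<alpha>) S\<close>; its exponent
    has no pole at j \<alpha>, so it is already admissible at S.\<close>
  have De: "{\<alpha>. D S \<alpha> \<noteq> 0} \<subseteq> exponents N S d" for S
  proof
    fix \<alpha> assume "\<alpha> \<in> {\<alpha>. D S \<alpha> \<noteq> 0}"
    then have "\<alpha> \<in> exponents N (insert (j \<alpha>) S) d" "0 \<le> \<alpha> (j \<alpha>)" using D0 C(2) DF j by blast+
    then show "\<alpha> \<in> exponents N S d" unfolding exponents_def by auto
  qed
  define e where "e S = laurent_eval N (D S)" for S
  have "e S \<in> laurent N S d" for S
    unfolding laurent_def e_def using De finite_subset[OF DF finF] by blast
  moreover have "f S x = cob (\<lambda>S. e S x) S" if S: "S \<subseteq> {..<N}" "card S = Suc p" and x: "x \<in> chart N S" for S x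
  proof -
    have fS: "finite S" using S finite_subset by blast
    have "C S \<alpha> = cob (\<lambda>S. D S \<alpha>) S" if "\<alpha> \<in> F" for \<alpha>
    proof -
      have "cone (j \<alpha>) (cob (\<lambda>S. C S \<alpha>)) S = 0"
        using cobC[of "insert (j \<alpha>) S" \<alpha>] S j[OF that] that fS by (auto simp: cone_def)
      then show ?thesis using cone_homotopy[OF fS, of "j \<alpha>" "\<lambda>S. C S \<alpha>"] by (simp add: D_def)
    qed
    then have "f S x = (\<Sum>\<alpha>\<in>F. cob (\<lambda>S. D S \<alpha>) S * laurent_monomial N \<alpha> x)"
      using C(3)[of S x] S x laurent_eval_eq[OF finF CF] by (simp add: good_def)
    also have "\<dots> = cob (\<lambda>S. e S x) S"
      unfolding e_def laurent_eval_eq[OF finF DF] by (simp add: cob_sum cob_mult_right)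
    finally show ?thesis .
  qed
  ultimately show ?thesis by blast
qed

section \<open>Regular functions on the charts\<close>

lemma hom_poly_mult:
  "g \<in> hom_poly N d \<Longrightarrow> h \<in> hom_poly N e \<Longrightarrow> (\<lambda>x. g x * h x) \<in> hom_poly N (d + e)"
  by (auto simp: hom_poly_def power_add intro: poly_fun.mult)

lemma hom_poly_add:
  "g \<in> hom_poly N d \<Longrightarrow> h \<in> hom_poly N d \<Longrightarrow> (\<lambda>x. g x + h x) \<in> hom_poly N d"
  by (auto simp: hom_poly_def distrib_left intro: poly_fun.add)

lemma hom_poly_const: "(\<lambda>x. k) \<in> hom_poly N 0"
  by (auto simp: hom_poly_def intro: poly_fun.const)

lemma hom_poly_power_prod:
  assumes "finite A" "A \<subseteq> {..<N}"
  shows "(\<lambda>x. \<Prod>i\<in>A. x i ^ n i) \<in> hom_poly N (\<Sum>i\<in>A. n i)"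
proof -
  have "(\<lambda>x. x i ^ k) \<in> poly_fun {..<N}" if "i \<in> A" for i k
  proof (induction k)
    case (Suc k)
    have "i \<in> {..<N}" using that assms by blast
    from poly_fun.mult[OF poly_fun.coord[OF this] Suc] show ?case by simp
  qed (simp add: poly_fun.const)
  then show ?thesis using assms
    by (auto simp: hom_poly_def power_mult_distrib prod.distrib power_sum intro!: poly_fun_prod)
qed

lemma regular_const: "regular_on N W (\<lambda>x. k)"
  unfolding regular_on_def
  by (intro ballI exI[of _ 0] bexI[OF _ hom_poly_const[of k]] bexI[OF _ hom_poly_const[of 1]]) auto

lemma regular_add:
  assumes "regular_on N W f" "regular_on N W f'" shows "regular_on N W (\<lambda>x. f x + f' x)"
  unfolding regular_on_def
proof
  fix p assume p: "p \<in> W"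
  obtain d g h where g: "g \<in> hom_poly N d" "h \<in> hom_poly N d" "h p \<noteq> 0"
    "\<forall>x\<in>W. h x \<noteq> 0 \<longrightarrow> f x = g x / h x" using assms(1) p unfolding regular_on_def by blast
  obtain d' g' h' where g': "g' \<in> hom_poly N d'" "h' \<in> hom_poly N d'" "h' p \<noteq> 0"
    "\<forall>x\<in>W. h' x \<noteq> 0 \<longrightarrow> f' x = g' x / h' x" using assms(2) p unfolding regular_on_def by blast
  have 1: "(\<lambda>x. g x * h' x + h x * g' x) \<in> hom_poly N (d + d')" by (intro hom_poly_add hom_poly_mult g g')
  have 2: "(\<lambda>x. h x * h' x) \<in> hom_poly N (d + d')" by (intro hom_poly_mult g g')
  show "\<exists>d. \<exists>g\<in>hom_poly N d. \<exists>h\<in>hom_poly N d. h p \<noteq> 0 \<and> (\<forall>x\<in>W. h x \<noteq> 0 \<longrightarrow> f x + f' x = g x / h x)"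
    using g g' by (intro exI[of _ "d + d'"] bexI[OF _ 1] bexI[OF _ 2]) (auto simp: add_frac_eq mult.commute)
qed

lemma regular_mult:
  assumes "regular_on N W f" "regular_on N W f'" shows "regular_on N W (\<lambda>x. f x * f' x)"
  unfolding regular_on_def
proof
  fix p assume p: "p \<in> W"
  obtain d g h where g: "g \<in> hom_poly N d" "h \<in> hom_poly N d" "h p \<noteq> 0"
    "\<forall>x\<in>W. h x \<noteq> 0 \<longrightarrow> f x = g x / h x" using assms(1) p unfolding regular_on_def by blast
  obtain d' g' h' where g': "g' \<in> hom_poly N d'" "h' \<in> hom_poly N d'" "h' p \<noteq> 0"
    "\<forall>x\<in>W. h' x \<noteq> 0 \<longrightarrow> f' x = g' x / h' x" using assms(2) p unfolding regular_on_def by blast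
  have 1: "(\<lambda>x. g x * g' x) \<in> hom_poly N (d + d')" by (intro hom_poly_mult g g')
  have 2: "(\<lambda>x. h x * h' x) \<in> hom_poly N (d + d')" by (intro hom_poly_mult g g')
  show "\<exists>d. \<exists>g\<in>hom_poly N d. \<exists>h\<in>hom_poly N d. h p \<noteq> 0 \<and> (\<forall>x\<in>W. h x \<noteq> 0 \<longrightarrow> f x * f' x = g x / h x)"
    using g g' by (intro exI[of _ "d + d'"] bexI[OF _ 1] bexI[OF _ 2]) auto
qed

lemma regular_sum:
  "(\<And>a. a \<in> A \<Longrightarrow> regular_on N W (f a)) \<Longrightarrow> regular_on N W (\<lambda>x. \<Sum>a\<in>A. f a x)"
  by (induction A rule: infinite_finite_induct) (simp_all add: regular_const regular_add)

lemma regular_cong: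
  assumes f: "regular_on N W f" and sub: "W' \<subseteq> W" and eq: "\<And>x. x \<in> W' \<Longrightarrow> f x = f' x"
  shows "regular_on N W' f'"
  unfolding regular_on_def
proof
  fix p assume p: "p \<in> W'"
  then obtain d g h where g: "g \<in> hom_poly N d" "h \<in> hom_poly N d" "h p \<noteq> 0"
    "\<forall>x\<in>W. h x \<noteq> 0 \<longrightarrow> f x = g x / h x" using f sub unfolding regular_on_def by blast
  then show "\<exists>d. \<exists>g\<in>hom_poly N d. \<exists>h\<in>hom_poly N d. h p \<noteq> 0 \<and> (\<forall>x\<in>W'. h x \<noteq> 0 \<longrightarrow> f' x = g x / h x)"
    using sub eq by (intro exI[of _ d] bexI[OF _ g(1)] bexI[OF _ g(2)]) auto
qed

text \<open>A form k among those defining W, with k p nonzero, is multiplied into numerator and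
  denominator. Where the new denominator is nonzero the point lies in W, so the fraction represents
  f on all of U.\<close>

lemma regular_local:
  assumes U: "U \<subseteq> hcoords N"
    and loc: "\<And>p. p \<in> U \<Longrightarrow> \<exists>W. proj_open N W \<and> p \<in> W \<and> W \<subseteq> U \<and> regular_on N W f"
  shows "regular_on N U f"
  unfolding regular_on_def
proof
  fix p assume p: "p \<in> U"
  obtain W where W: "proj_open N W" "p \<in> W" "regular_on N W f" using loc[OF p] by blast
  obtain H where H: "H \<subseteq> (\<Union>d. hom_poly N d)" "W = {x \<in> hcoords N. \<exists>h\<in>H. h x \<noteq> 0}"
    using W(1) unfolding proj_open_def by blast
  obtain k e where k: "k \<in> H" "k p \<noteq> 0" "k \<in> hom_poly N e" using W(2) H by blast
  obtain d g h where g: "g \<in> hom_poly N d" "h \<in> hom_poly N d" "h p \<noteq> 0"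
    "\<forall>x\<in>W. h x \<noteq> 0 \<longrightarrow> f x = g x / h x" using W(2,3) unfolding regular_on_def by blast
  have 1: "(\<lambda>x. g x * k x) \<in> hom_poly N (d + e)" by (intro hom_poly_mult g k)
  have 2: "(\<lambda>x. h x * k x) \<in> hom_poly N (d + e)" by (intro hom_poly_mult g k)
  show "\<exists>d. \<exists>g\<in>hom_poly N d. \<exists>h\<in>hom_poly N d. h p \<noteq> 0 \<and> (\<forall>x\<in>U. h x \<noteq> 0 \<longrightarrow> f x = g x / h x)"
    using g k U H(2) by (intro exI[of _ "d + e"] bexI[OF _ 1] bexI[OF _ 2]) auto
qed

lemma proj_open_chart:
  assumes S: "S \<subseteq> {..<N}" shows "proj_open N (chart N S)"
proof -
  have f: "finite S" using S finite_subset by blast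
  have "(\<lambda>x. \<Prod>i\<in>S. x i ^ 1) \<in> hom_poly N (\<Sum>i\<in>S. 1)" by (rule hom_poly_power_prod[OF f S])
  moreover have "chart N S = {x \<in> hcoords N. \<exists>h\<in>{\<lambda>x. \<Prod>i\<in>S. x i ^ 1}. h x \<noteq> 0}"
    using f by (auto simp: chart_def)
  ultimately show ?thesis unfolding proj_open_def by blast
qed

section \<open>Regular functions on a chart are the Laurent polynomials of degree 0\<close>

lemma regular_of_laurent:
  assumes f: "f \<in> laurent N S 0" shows "regular_on N (chart N S) f"
proof -
  obtain F c where F: "finite F" "F \<subseteq> exponents N S 0"
    "\<forall>x\<in>chart N S. f x = (\<Sum>\<alpha>\<in>F. c \<alpha> * laurent_monomial N \<alpha> x)"
    using laurent_expand[OF f] by (elim exE conjE) rule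
  have mono: "regular_on N (chart N S) (laurent_monomial N \<alpha>)" if \<alpha>: "\<alpha> \<in> exponents N S 0" for \<alpha>
    unfolding regular_on_def
  proof
    fix p assume p: "p \<in> chart N S"
    let ?g = "\<lambda>x :: nat \<Rightarrow> complex. \<Prod>i<N. x i ^ nat (\<alpha> i)" and ?h = "\<lambda>x :: nat \<Rightarrow> complex. \<Prod>i<N. x i ^ nat (- \<alpha> i)"
    \<comment> \<open>Numerator and denominator have equal degree because the exponents sum to
      0.\<close>
    have "int (\<Sum>i<N. nat (\<alpha> i)) - int (\<Sum>i<N. nat (- \<alpha> i)) = (\<Sum>i<N. int (nat (\<alpha> i)) - int (nat (- \<alpha> i)))"
      by (simp only: of_nat_sum sum_subtractf)
    also have "\<dots> = (\<Sum>i<N. \<alpha> i)" by (intro sum.cong) auto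
    also have "\<dots> = 0" using \<alpha> by (simp add: exponents_def)
    finally have deg: "(\<Sum>i<N. nat (\<alpha> i)) = (\<Sum>i<N. nat (- \<alpha> i))" by linarith
    have 1: "?g \<in> hom_poly N (\<Sum>i<N. nat (\<alpha> i))" by (intro hom_poly_power_prod) auto
    have 2: "?h \<in> hom_poly N (\<Sum>i<N. nat (\<alpha> i))" unfolding deg by (intro hom_poly_power_prod) auto
    have nz: "x i \<noteq> 0 \<or> \<alpha> i \<ge> 0" if "x \<in> chart N S" "i < N" for x i
      using \<alpha> that by (auto simp: exponents_def chart_def)
    have "laurent_monomial N \<alpha> x = ?g x / ?h x" if "x \<in> chart N S" for x
      unfolding laurent_monomial_def prod_dividef[symmetric]
      by (intro prod.cong) (auto simp: power_int_def field_simps)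
    moreover have "?h p \<noteq> 0" using nz[OF p] by (fastforce simp: prod_zero_iff)
    ultimately show "\<exists>d. \<exists>g\<in>hom_poly N d. \<exists>h\<in>hom_poly N d. h p \<noteq> 0 \<and>
        (\<forall>x\<in>chart N S. h x \<noteq> 0 \<longrightarrow> laurent_monomial N \<alpha> x = g x / h x)"
      by (intro exI[of _ "\<Sum>i<N. nat (\<alpha> i)"] bexI[OF _ 1] bexI[OF _ 2]) blast
  qed
  have "regular_on N (chart N S) (\<lambda>x. \<Sum>\<alpha>\<in>F. c \<alpha> * laurent_monomial N \<alpha> x)"
  proof (rule regular_sum)
    fix \<alpha> assume "\<alpha> \<in> F"
    then have "\<alpha> \<in> exponents N S 0" using F(2) by blast
    from regular_mult[OF regular_const mono[OF this]]
    show "regular_on N (chart N S) (\<lambda>x. c \<alpha> * laurent_monomial N \<alpha> x)" .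
  qed
  then show ?thesis by (rule regular_cong[OF _ order_refl]) (simp add: F(3))
qed

text \<open>Substituting functions of degree 0 such as x_j / x_i carries polynomials on the slice
  x_i = 1 over to the chart.\<close>

lemma laurent_poly_fun:
  assumes "g \<in> poly_fun I" "\<And>i. i \<in> I \<Longrightarrow> (\<lambda>x. z x i) \<in> laurent N S 0"
  shows "(\<lambda>x. g (z x)) \<in> laurent N S 0"
  using assms(1)
proof (induction rule: poly_fun.induct)
  case (mult f g) then show ?case using laurent_mult[of _ N S 0 _ 0] by simp
qed (auto intro: laurent_const laurent_add assms(2))

lemma laurent_prod:
  "(\<And>a. a \<in> A \<Longrightarrow> f a \<in> laurent N S 0) \<Longrightarrow> (\<lambda>x. \<Prod>a\<in>A. f a x) \<in> laurent N S 0"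
proof (induction A rule: infinite_finite_induct)
  case (insert a A)
  then show ?case using laurent_mult[of "f a" N S 0 "\<lambda>x. \<Prod>a\<in>A. f a x" 0] by simp
qed (auto intro: laurent_const)

lemma truncate_hcoords:
  assumes "i < N" "w i \<noteq> (0::complex)" shows "(\<lambda>j. if j < N then w j else 0) \<in> hcoords N"
  using assms by (auto simp: hcoords_def affine_space_def fun_eq_iff)

text \<open>The trick of Rabinowitsch, on the slice \<open>x\<^sub>i = 1\<close> of the cone, with the variable of index \<open>N\<close>
  inverting the product of the coordinates in \<open>S\<close>. The denominators are squared because the local
  equality \<open>f h = g\<close> is only given where \<open>h\<close> does not vanish.\<close>

theorem laurent_of_regular:
  assumes S: "S \<subseteq> {..<N}" "S \<noteq> {}" and f: "regular_on N (chart N S) f"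
  shows "f \<in> laurent N S 0"
proof -
  obtain i where i: "i \<in> S" using S by blast
  then have iN: "i < N" using S by auto
  have fS: "finite S" using S finite_subset by blast
  have "\<forall>p. \<exists>d g h. p \<in> chart N S \<longrightarrow> g \<in> hom_poly N d \<and> h \<in> hom_poly N d \<and> h p \<noteq> 0 \<and>
      (\<forall>x\<in>chart N S. h x \<noteq> 0 \<longrightarrow> f x = g x / h x)"
    using f unfolding regular_on_def by blast
  then obtain d g h where gh: "\<And>p. p \<in> chart N S \<Longrightarrow> g p \<in> hom_poly N (d p) \<and> h p \<in> hom_poly N (d p) \<and>
      h p p \<noteq> 0 \<and> (\<forall>x\<in>chart N S. h p x \<noteq> 0 \<longrightarrow> f x = g p x / h p x)"
    by metis
  define e1 e2 where "e1 = (\<lambda>z :: nat \<Rightarrow> complex. z i - 1)"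
    and "e2 = (\<lambda>z :: nat \<Rightarrow> complex. z N * (\<Prod>j\<in>S. z j) - 1)"
  define sq where "sq p = (\<lambda>z. h p z * h p z)" for p
  define G where "G = sq ` chart N S \<union> {e1, e2}"
  have hp: "h p \<in> poly_fun {..<N}" "g p \<in> poly_fun {..<N}" if "p \<in> chart N S" for p
    using gh[OF that] by (auto simp: hom_poly_def)
  have SN: "{..<N} \<subseteq> {..<Suc N}" by auto
  have "G \<subseteq> poly_fun {..<Suc N}"
    unfolding G_def sq_def e1_def e2_def using iN S(1)
    by (auto intro!: poly_fun_diff poly_fun.intros poly_fun_prod poly_fun_mono[OF hp(1) SN])
  moreover have "\<exists>g\<in>G. g w \<noteq> 0" for w
  proof (cases "e1 w = 0 \<and> e2 w = 0")
    case True
    then have w: "w i = 1" "w N * (\<Prod>j\<in>S. w j) = 1" by (auto simp: e1_def e2_def)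
    then have "\<forall>j\<in>S. w j \<noteq> 0" using fS by (metis mult_zero_right prod_zero zero_neq_one)
    define p where "p = (\<lambda>j. if j < N then w j else 0)"
    have p: "p \<in> chart N S"
      using truncate_hcoords[OF iN, of w] w(1) \<open>\<forall>j\<in>S. w j \<noteq> 0\<close> S unfolding chart_def p_def by auto
    have "h p w = h p p" by (rule poly_fun_cong[OF hp(1)[OF p]]) (simp add: p_def)
    then have "sq p w \<noteq> 0" using gh[OF p] by (simp add: sq_def)
    then show ?thesis using p unfolding G_def by blast
  qed (auto simp: G_def)
  ultimately obtain F c where F: "finite F" "F \<subseteq> G" "\<forall>q\<in>F. c q \<in> poly_fun {..<Suc N}"
    and F1: "\<forall>x. (\<Sum>q\<in>F. c q x * q x) = 1"
    using weak_nullstellensatz[of "{..<Suc N}" G] by auto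
  \<comment> \<open>The point of the slice on the line through x, with the inverse of the product of
    its coordinates in S as coordinate N.\<close>
  define z where "z x j = (if j < N then x j * inverse (x i)
     else if j = N then \<Prod>k\<in>S. x i * inverse (x k) else 0)" for x :: "nat \<Rightarrow> complex" and j
  have quot: "(\<lambda>x. x j * inverse (x k)) \<in> laurent N S 0" if "j < N" "k \<in> S" for j k
    using laurent_mult[OF laurent_coord[OF that(1)] laurent_inverse[OF _ that(2)]] that(2) S by auto
  have zl: "(\<lambda>x. z x j) \<in> laurent N S 0" for j
    unfolding z_def by (cases "j < N"; cases "j = N") (auto intro!: quot laurent_prod i iN)
  \<comment> \<open>Each generator times f is a Laurent polynomial: e1 and e2 vanish at z x, and
    h_p^2 f = h_p g_p holds also where h_p is zero. Writing 1 as a combination of the generators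
    then does the same for f.\<close>
  have mult_gen: "(\<lambda>x. q (z x) * f x) \<in> laurent N S 0" if "q \<in> G" for q
  proof -
    have "q = e1 \<or> q = e2 \<or> (\<exists>p\<in>chart N S. q = sq p)" using that unfolding G_def by blast
    then show ?thesis
    proof (elim disjE bexE)
      assume "q = e1"
      then have "q (z x) * f x = 0" if "x \<in> chart N S" for x
        using that i iN by (simp add: e1_def z_def chart_def)
      then show ?thesis by (intro laurent_cong[OF laurent_zero]) simp
    next
      assume q: "q = e2"
      have "q (z x) * f x = 0" if x: "x \<in> chart N S" for x
      proof -
        have nz: "x j \<noteq> 0" if "j \<in> S" for j using x that by (simp add: chart_def)
        have "z x N * (\<Prod>j\<in>S. z x j) = (\<Prod>k\<in>S. x i * inverse (x k)) * (\<Prod>k\<in>S. x k * inverse (x i))"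
          using S by (auto simp: z_def intro!: prod.cong)
        also have "\<dots> = (\<Prod>k\<in>S. 1)" unfolding prod.distrib[symmetric]
          using nz i by (intro prod.cong) (auto simp: field_simps)
        finally show ?thesis by (simp add: q e2_def)
      qed
      then show ?thesis by (intro laurent_cong[OF laurent_zero]) simp
    next
      fix p assume p: "p \<in> chart N S" and q: "q = sq p"
      \<comment> \<open>Passing to the slice multiplies numerator and denominator by the same power
        of 1 / x_i.\<close>
      have hom: "u (z x) = inverse (x i) ^ d p * u x" if "u \<in> hom_poly N (d p)" for u x
      proof -
        have "u (z x) = u (\<lambda>j. inverse (x i) * x j)"
          using that by (intro poly_fun_cong[of u "{..<N}"]) (auto simp: hom_poly_def z_def mult.commute)
        then show ?thesis using that by (simp add: hom_poly_def)
      qed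
      have "(\<lambda>x. h p (z x) * g p (z x)) \<in> laurent N S (0 + 0)"
        by (intro laurent_mult laurent_poly_fun[OF hp(1)[OF p]] laurent_poly_fun[OF hp(2)[OF p]] zl)
      then show ?thesis unfolding add_0
      proof (rule laurent_cong)
        fix x assume x: "x \<in> chart N S"
        show "h p (z x) * g p (z x) = q (z x) * f x"
          using gh[OF p] x unfolding q sq_def by (cases "h p x = 0") (auto simp: hom)
      qed
    qed
  qed
  have "(\<lambda>x. \<Sum>q\<in>F. c q (z x) * (q (z x) * f x)) \<in> laurent N S 0"
  proof (rule laurent_sum)
    fix q assume q: "q \<in> F"
    then have "(\<lambda>x. c q (z x)) \<in> laurent N S 0"
      using F(3) by (intro laurent_poly_fun[of "c q" "{..<Suc N}"] zl) auto
    from laurent_mult[OF this mult_gen[of q]] show "(\<lambda>x. c q (z x) * (q (z x) * f x)) \<in> laurent N S 0"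
      using F(2) q by auto
  qed
  moreover have "(\<Sum>q\<in>F. c q (z x) * (q (z x) * f x)) = f x" for x
  proof -
    have "(\<Sum>q\<in>F. c q (z x) * (q (z x) * f x)) = (\<Sum>q\<in>F. c q (z x) * q (z x)) * f x"
      by (simp add: sum_distrib_right mult.assoc)
    then show ?thesis using F1 by simp
  qed
  ultimately show ?thesis by simp
qed

lemma poly_fun_adj_mat:
  assumes f: "\<And>i j. i < n \<Longrightarrow> j < n \<Longrightarrow> (\<lambda>x. f x i j) \<in> poly_fun I" and ij: "i < n" "j < n"
  shows "(\<lambda>x. adj_mat (mat n n (\<lambda>(i, j). f x i j)) $$ (i, j)) \<in> poly_fun I"
proof -
  let ?s = "\<lambda>k l :: nat. if k < l then k else Suc k"
  have "adj_mat (mat n n (\<lambda>(i, j). f x i j)) $$ (i, j)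
      = (- 1) ^ (j + i) * det (mat (n - 1) (n - 1) (\<lambda>(a, b). f x (?s a j) (?s b i)))" for x
    unfolding adj_mat_def cofactor_def mat_delete_def using ij
    by (simp, intro arg_cong[of _ _ det] eq_matI) auto
  moreover have "(\<lambda>x. (- 1) ^ (j + i) * det (mat (n - 1) (n - 1) (\<lambda>(a, b). f x (?s a j) (?s b i)))) \<in> poly_fun I"
    using ij by (intro poly_fun.mult poly_fun.const poly_fun_det f) auto
  ultimately show ?thesis by simp
qed

section \<open>A left inverse of M on each chart\<close>

lemma poly_fun_morph_at: "(\<lambda>x. morph_at N m x a b) \<in> poly_fun {..<N}"
  unfolding morph_at_def by (auto intro!: poly_fun_sum poly_fun.intros)

lemma laurent_morph_at: "(\<lambda>x. morph_at N m x a b) \<in> laurent N S 1"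
  unfolding morph_at_def
  using laurent_mult[OF laurent_coord laurent_const] by (fastforce intro!: laurent_sum)

lemma steiner_injective:
  assumes m: "steiner_bundle N s t m" and x: "x \<in> hcoords N"
    and w: "\<forall>a<t. (\<Sum>b<s. morph_at N m x a b * w b) = 0"
  shows "\<forall>b<s. w b = 0"
proof -
  have inj: "inj_on (mat_apply t s (morph_at N m x)) (affine_space {..<s})"
    using m x unfolding steiner_bundle_def by blast
  let ?w = "\<lambda>b. if b < s then w b else 0"
  have "mat_apply t s (morph_at N m x) ?w = mat_apply t s (morph_at N m x) (\<lambda>_. 0)"
    using w by (auto simp: mat_apply_def fun_eq_iff)
  then have "?w = (\<lambda>_. 0)" using inj by (auto simp: affine_space_def dest!: inj_onD)
  then show ?thesis by (metis (full_types))
qed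

text \<open>With Q_p the conjugate transpose of M(p), the determinants of Q_p M(x) have no common
  zero on the slice x_i = 1, so 1 is a combination of them there. The adjugate gives a left inverse
  of M up to each determinant, and the same combination of these is a true left inverse L0. On the
  chart it becomes L0(x / x_i) / x_i, of degree -1 because M has degree 1.\<close>

theorem steiner_left_inverse:
  assumes m: "steiner_bundle N s t m" and S: "S \<subseteq> {..<N}" "S \<noteq> {}"
  shows "\<exists>L. (\<forall>b a. (\<lambda>x. L x b a) \<in> laurent N S (- 1)) \<and>
     (\<forall>x\<in>chart N S. \<forall>b<s. \<forall>c<s. (\<Sum>a<t. L x b a * morph_at N m x a c) = (if b = c then 1 else 0))"
proof -
  obtain i where i: "i \<in> S" using S by blast
  then have iN: "i < N" using S by auto
  let ?M = "morph_at N m"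
  define D where "D p x j k = (\<Sum>a<t. cnj (?M p a j) * ?M x a k)" for p x j k
  define \<delta> where "\<delta> p x = det (mat s s (\<lambda>(j, k). D p x j k))" for p x
  have Dp: "(\<lambda>x. D p x j k) \<in> poly_fun {..<N}" for p j k
    unfolding D_def by (intro poly_fun_sum poly_fun.mult poly_fun.const poly_fun_morph_at)
  have \<delta>p: "\<delta> p \<in> poly_fun {..<N}" for p
    unfolding \<delta>_def by (intro poly_fun_det Dp)
  define e where "e = (\<lambda>z :: nat \<Rightarrow> complex. z i - 1)"
  define G where "G = \<delta> ` hcoords N \<union> {e}"
  have "G \<subseteq> poly_fun {..<N}" unfolding G_def e_def using iN \<delta>p
    by (auto intro!: poly_fun_diff poly_fun.intros)
  moreover have "\<exists>g\<in>G. g w \<noteq> 0" for w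
  proof (cases "e w = 0")
    case True
    define p where "p = (\<lambda>j. if j < N then w j else 0)"
    have p: "p \<in> hcoords N" using truncate_hcoords[OF iN, of w] True unfolding p_def e_def by simp
    have "\<delta> p w = \<delta> p p" by (rule poly_fun_cong[OF \<delta>p]) (simp add: p_def)
    moreover have "\<delta> p p \<noteq> 0"
      unfolding \<delta>_def D_def by (rule det_gram_nonzero) (rule steiner_injective[OF m p])
    ultimately have "\<delta> p w \<noteq> 0" by simp
    then show ?thesis using p unfolding G_def by blast
  qed (auto simp: G_def)
  ultimately obtain F c where F: "finite F" "F \<subseteq> G" "\<forall>q\<in>F. c q \<in> poly_fun {..<N}"
    and F1: "\<forall>x. (\<Sum>q\<in>F. c q x * q x) = 1"
    using weak_nullstellensatz[of "{..<N}" G] by auto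
  have "\<exists>K. (\<forall>b a. (\<lambda>x. K x b a) \<in> poly_fun {..<N}) \<and>
      (\<forall>x. x i = 1 \<longrightarrow> (\<forall>b<s. \<forall>k<s. (\<Sum>a<t. K x b a * ?M x a k) = (if b = k then q x else 0)))"
    if "q \<in> G" for q
  proof (cases "q = e")
    case True
    \<comment> \<open>The generator e is 0 on the slice, so the zero matrix serves.\<close>
    then show ?thesis by (intro exI[of _ "\<lambda>_ _ _. 0"]) (auto simp: e_def poly_fun.const)
  next
    case False
    then obtain p where q: "q = \<delta> p" using \<open>q \<in> G\<close> unfolding G_def by blast
    define A where "A x = mat s s (\<lambda>(j, k). D p x j k)" for x
    \<comment> \<open>The adjugate of Q_p M(x) times Q_p, where Q_p is the conjugate transpose of
      M(p).\<close>
    define K where "K x b a = (if b < s then \<Sum>j<s. adj_mat (A x) $$ (b, j) * cnj (?M p a j) else 0)" for x b a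
    have "(\<lambda>x. K x b a) \<in> poly_fun {..<N}" for b a
      unfolding K_def A_def
      by (cases "b < s") (auto intro!: poly_fun_sum poly_fun.mult poly_fun.const poly_fun_adj_mat Dp)
    moreover have "(\<Sum>a<t. K x b a * ?M x a k) = (if b = k then q x else 0)" if bk: "b < s" "k < s" for x b k
    proof -
      have A: "A x \<in> carrier_mat s s" by (simp add: A_def)
      have "(\<Sum>a<t. K x b a * ?M x a k) = (\<Sum>a<t. \<Sum>j<s. adj_mat (A x) $$ (b, j) * (cnj (?M p a j) * ?M x a k))"
        using bk by (simp add: K_def sum_distrib_right mult.assoc)
      also have "\<dots> = (\<Sum>j<s. adj_mat (A x) $$ (b, j) * D p x j k)"
        unfolding D_def by (subst sum.swap) (simp add: sum_distrib_left)
      also have "\<dots> = (adj_mat (A x) * A x) $$ (b, k)"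
        using bk adj_mat(1)[OF A] by (simp add: scalar_prod_def lessThan_atLeast0 A_def)
      also have "\<dots> = (if b = k then q x else 0)"
        unfolding adj_mat(3)[OF A] using bk by (simp add: q \<delta>_def A_def)
      finally show ?thesis .
    qed
    ultimately show ?thesis by blast
  qed
  then have "\<forall>q. \<exists>K. q \<in> G \<longrightarrow> (\<forall>b a. (\<lambda>x. K x b a) \<in> poly_fun {..<N}) \<and>
      (\<forall>x. x i = 1 \<longrightarrow> (\<forall>b<s. \<forall>k<s. (\<Sum>a<t. K x b a * ?M x a k) = (if b = k then q x else 0)))" by blast
  from choice[OF this] obtain K where K: "\<And>q b a. q \<in> G \<Longrightarrow> (\<lambda>x. K q x b a) \<in> poly_fun {..<N}"
      "\<And>q x b k. q \<in> G \<Longrightarrow> x i = 1 \<Longrightarrow> b < s \<Longrightarrow> k < s \<Longrightarrow>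
        (\<Sum>a<t. K q x b a * ?M x a k) = (if b = k then q x else 0)" by blast
  define L0 where "L0 x b a = (\<Sum>q\<in>F. c q x * K q x b a)" for x b a
  have L0p: "(\<lambda>x. L0 x b a) \<in> poly_fun {..<N}" for b a
    unfolding L0_def using F K(1) by (intro poly_fun_sum poly_fun.mult) auto
  have L0: "(\<Sum>a<t. L0 x b a * ?M x a k) = (if b = k then 1 else 0)" if "x i = 1" "b < s" "k < s" for x b k
  proof -
    have "(\<Sum>a<t. L0 x b a * ?M x a k) = (\<Sum>a<t. \<Sum>q\<in>F. c q x * (K q x b a * ?M x a k))"
      by (simp add: L0_def sum_distrib_right mult.assoc)
    also have "\<dots> = (\<Sum>q\<in>F. c q x * (\<Sum>a<t. K q x b a * ?M x a k))"
      by (subst sum.swap) (simp add: sum_distrib_left)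
    also have "\<dots> = (\<Sum>q\<in>F. c q x * (if b = k then q x else 0))"
      using K(2) that F(2) by (intro sum.cong) auto
    also have "\<dots> = (if b = k then 1 else 0)" using F1 by simp
    finally show ?thesis .
  qed
  define z where "z x = (\<lambda>j. x j * inverse (x i))" for x :: "nat \<Rightarrow> complex"
  define L where "L x b a = inverse (x i) * L0 (z x) b a" for x b a
  have zl: "(\<lambda>x. z x j) \<in> laurent N S 0" if "j < N" for j
    unfolding z_def using laurent_mult[OF laurent_coord[OF that] laurent_inverse[OF iN i]] by simp
  have "(\<lambda>x. L x b a) \<in> laurent N S (- 1)" for b a
    unfolding L_def
    using laurent_mult[OF laurent_inverse[OF iN i] laurent_poly_fun[OF L0p zl]] by simp
  moreover have "(\<Sum>a<t. L x b a * ?M x a k) = (if b = k then 1 else 0)"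
    if x: "x \<in> chart N S" and bk: "b < s" "k < s" for x b k
  proof -
    have xi: "x i \<noteq> 0" using x i by (simp add: chart_def)
    have Mz: "?M (z x) a k = inverse (x i) * ?M x a k" for a
      by (simp add: morph_at_def z_def sum_distrib_left mult_ac)
    have "(\<Sum>a<t. L x b a * ?M x a k) = (\<Sum>a<t. L0 (z x) b a * ?M (z x) a k)"
      unfolding Mz L_def by (simp add: mult_ac)
    then show ?thesis using L0[of "z x" b k] bk xi by (simp add: z_def)
  qed
  ultimately show ?thesis by blast
qed

section \<open>Cohomology of the endomorphism bundle\<close>

lemma coboundary_cob: "coboundary c S x a b = cob (\<lambda>S. c S x a b) S"
  by (simp add: coboundary_def cob_def)

text \<open>The index \<open>k\<close> is the size of the index sets, which is the Cech degree plus one.\<close>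

definition lc :: "nat \<Rightarrow> nat \<Rightarrow> int \<Rightarrow> cochain \<Rightarrow> bool" where
  "lc N k d A \<longleftrightarrow> (\<forall>S. S \<subseteq> {..<N} \<longrightarrow> card S = k \<longrightarrow> (\<forall>a b. (\<lambda>x. A S x a b) \<in> laurent N S d))"

lemma lcD: "lc N k d A \<Longrightarrow> S \<subseteq> {..<N} \<Longrightarrow> card S = k \<Longrightarrow> (\<lambda>x. A S x a b) \<in> laurent N S d"
  unfolding lc_def by blast

lemma lcI:
  "(\<And>S a b. S \<subseteq> {..<N} \<Longrightarrow> card S = k \<Longrightarrow> (\<lambda>x. A S x a b) \<in> laurent N S d) \<Longrightarrow> lc N k d A"
  unfolding lc_def by blast

lemma lc_coboundary:
  assumes A: "lc N k d A" shows "lc N (Suc k) d (coboundary A)"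
proof (rule lcI)
  fix S a b assume S: "S \<subseteq> {..<N}" "card S = Suc k"
  show "(\<lambda>x. coboundary A S x a b) \<in> laurent N S d"
    unfolding coboundary_def
  proof (rule laurent_sum)
    fix i assume "i \<in> S"
    then have "(\<lambda>x. A (S - {i}) x a b) \<in> laurent N (S - {i}) d" using S by (intro lcD[OF A]) auto
    then have "(\<lambda>x. A (S - {i}) x a b) \<in> laurent N S d" by (rule laurent_restrict) auto
    then show "(\<lambda>x. (- 1) ^ card {j \<in> S. j < i} * A (S - {i}) x a b) \<in> laurent N S d"
      by (rule laurent_scale)
  qed
qed

lemma laurent_cech_exact_matrix:
  assumes N: "N \<ge> 2" and d: "d \<ge> - 1" and A: "lc N (Suc p) d A"
    and z: "\<And>S x a b. S \<subseteq> {..<N} \<Longrightarrow> card S = Suc (Suc p) \<Longrightarrow> x \<in> chart N S \<Longrightarrow> a < r \<Longrightarrow> b < k \<Longrightarrow>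
      coboundary A S x a b = 0"
  shows "\<exists>E. lc N p d E \<and> (\<forall>S x a b. S \<subseteq> {..<N} \<longrightarrow> card S = Suc p \<longrightarrow> x \<in> chart N S \<longrightarrow>
      a < r \<longrightarrow> b < k \<longrightarrow> A S x a b = coboundary E S x a b)"
proof -
  define P where "P a b e \<longleftrightarrow> (\<forall>S. S \<subseteq> {..<N} \<longrightarrow> card S = p \<longrightarrow> e S \<in> laurent N S d) \<and>
    (\<forall>S x. S \<subseteq> {..<N} \<longrightarrow> card S = Suc p \<longrightarrow> x \<in> chart N S \<longrightarrow> A S x a b = cob (\<lambda>S. e S x) S)" for a b e
  have "\<exists>e. P a b e" if "a < r" "b < k" for a b
    unfolding P_def
  proof (rule laurent_cech_exact[OF N d])
    show "(\<lambda>x. A S x a b) \<in> laurent N S d" if "S \<subseteq> {..<N}" "card S = Suc p" for S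
      using that by (rule lcD[OF A])
    show "cob (\<lambda>S. A S x a b) S = 0" if "S \<subseteq> {..<N}" "card S = Suc (Suc p)" "x \<in> chart N S" for S x
      using z[OF that \<open>a < r\<close> \<open>b < k\<close>] by (simp add: coboundary_cob)
  qed
  then have "\<forall>ab. \<exists>e. fst ab < r \<longrightarrow> snd ab < k \<longrightarrow> P (fst ab) (snd ab) e" by blast
  from choice[OF this] obtain e0
    where e0: "\<forall>ab. fst ab < r \<longrightarrow> snd ab < k \<longrightarrow> P (fst ab) (snd ab) (e0 ab)" by blast
  define e where "e a b = e0 (a, b)" for a b
  have e: "P a b (e a b)" if "a < r" "b < k" for a b
    using e0[rule_format, of "(a, b)"] that by (simp add: e_def)
  \<comment> \<open>Entries outside the block are set to 0, since \<open>lc\<close> constrains all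
    entries.\<close>
  define E :: cochain where "E S x a b = (if a < r \<and> b < k then e a b S x else 0)" for S x a b
  have "lc N p d E"
  proof (rule lcI)
    fix S a b assume "S \<subseteq> {..<N}" "card S = p"
    then show "(\<lambda>x. E S x a b) \<in> laurent N S d"
      using e[of a b] unfolding E_def P_def by (cases "a < r \<and> b < k") auto
  qed
  moreover have "A S x a b = coboundary E S x a b"
    if "S \<subseteq> {..<N}" "card S = Suc p" "x \<in> chart N S" "a < r" "b < k" for S x a b
    using e[OF that(4,5)] that unfolding P_def coboundary_cob E_def by simp
  ultimately show ?thesis by blast
qed

section \<open>Matrix products and their coboundaries\<close>

definition mmul :: "nat \<Rightarrow> (nat \<Rightarrow> nat \<Rightarrow> complex) \<Rightarrow> (nat \<Rightarrow> nat \<Rightarrow> complex) \<Rightarrow> nat \<Rightarrow> nat \<Rightarrow> complex" where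
  "mmul k A B = (\<lambda>a b. \<Sum>c<k. A a c * B c b)"

lemma mmul_assoc: "mmul k (mmul l A B) C = mmul l A (mmul k B C)"
  unfolding mmul_def
  by (intro ext, simp add: sum_distrib_left sum_distrib_right mult.assoc) (rule sum.swap)

lemma mmul_cong:
  "(\<And>c. c < k \<Longrightarrow> A a c = A' a c) \<Longrightarrow> (\<And>c. c < k \<Longrightarrow> B c b = B' c b) \<Longrightarrow> mmul k A B a b = mmul k A' B' a b"
  unfolding mmul_def by (intro sum.cong) auto

lemma mmul_diff_left: "mmul k (\<lambda>a b. A a b - A' a b) B a b = mmul k A B a b - mmul k A' B a b"
  by (simp add: mmul_def left_diff_distrib sum_subtractf)

lemma mmul_diff_right: "mmul k A (\<lambda>a b. B a b - B' a b) a b = mmul k A B a b - mmul k A B' a b"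
  by (simp add: mmul_def right_diff_distrib sum_subtractf)

lemma mmul_add_left: "mmul k (\<lambda>a b. A a b + A' a b) B a b = mmul k A B a b + mmul k A' B a b"
  by (simp add: mmul_def distrib_right sum.distrib)

lemma mmul_add_right: "mmul k A (\<lambda>a b. B a b + B' a b) a b = mmul k A B a b + mmul k A B' a b"
  by (simp add: mmul_def distrib_left sum.distrib)

lemma coboundary_mmul_right:
  "coboundary (\<lambda>S x. mmul k (A S x) (B x)) S x a b = mmul k (coboundary A S x) (B x) a b"
  by (simp add: coboundary_cob mmul_def cob_sum cob_mult_right)

lemma coboundary_mmul_left:
  "coboundary (\<lambda>S x. mmul k (B x) (A S x)) S x a b = mmul k (B x) (coboundary A S x) a b"
  by (simp add: coboundary_cob mmul_def cob_sum cob_mult_left)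

lemma coboundary_diff: "coboundary (\<lambda>S x a b. A S x a b - A' S x a b) S x a b
    = coboundary A S x a b - coboundary A' S x a b"
  by (simp add: coboundary_cob cob_diff)

lemma coboundary_cong:
  "(\<And>i. i \<in> S \<Longrightarrow> A (S - {i}) x a b = A' (S - {i}) x a b) \<Longrightarrow> coboundary A S x a b = coboundary A' S x a b"
  unfolding coboundary_cob by (rule cob_cong)

lemma coboundary_coboundary: "finite S \<Longrightarrow> coboundary (coboundary A) S x a b = 0"
  unfolding coboundary_cob by (simp add: cob_cob)

lemma coboundary_singleton: "coboundary A {i} x a b = A {} x a b"
proof -
  have e: "{j \<in> {i}. j < i} = {}" by auto
  have "coboundary A {i} x a b = (- 1) ^ card {j \<in> {i}. j < i} * A ({i} - {i}) x a b"
    unfolding coboundary_def by (rule sum.insert[of "{}" i, unfolded sum.empty add_0_right]) auto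
  then show ?thesis unfolding e by simp
qed

text \<open>On singletons a constant cochain agrees with the coboundary of its value at the empty
  set, so its own coboundary is a double one.\<close>

lemma coboundary_constant:
  assumes "card S = 2" shows "coboundary (\<lambda>_. F) S x a b = 0"
proof -
  have fin: "finite S" using assms card.infinite by fastforce
  have "coboundary (\<lambda>_. F) S x a b = coboundary (coboundary (\<lambda>_. F)) S x a b"
  proof (rule coboundary_cong)
    fix i assume "i \<in> S"
    then have "card (S - {i}) = 1" using assms by simp
    then obtain j where "S - {i} = {j}" by (rule card_1_singletonE)
    then show "F x a b = coboundary (\<lambda>_. F) (S - {i}) x a b" by (simp add: coboundary_singleton)
  qed
  then show ?thesis using coboundary_coboundary[OF fin] by simp
qed

lemma lc_mmul_right:
  assumes "lc N k d A" "\<And>a b. (\<lambda>x. B x a b) \<in> laurent N {} e"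
  shows "lc N k (d + e) (\<lambda>S x. mmul n (A S x) (B x))"
  unfolding mmul_def
  by (intro lcI laurent_sum laurent_mult lcD[OF assms(1)] laurent_restrict[OF assms(2)]) auto

lemma lc_mmul_left:
  assumes "lc N k d A" "\<And>a b. (\<lambda>x. B x a b) \<in> laurent N {} e"
  shows "lc N k (e + d) (\<lambda>S x. mmul n (B x) (A S x))"
  unfolding mmul_def
  by (intro lcI laurent_sum laurent_mult lcD[OF assms(1)] laurent_restrict[OF assms(2)]) auto

lemma lc_diff: "lc N k d A \<Longrightarrow> lc N k d B \<Longrightarrow> lc N k d (\<lambda>S x a b. A S x a b - B S x a b)"
  unfolding lc_def by (auto intro: laurent_diff)

lemma lc_zero: "lc N k d (\<lambda>S x a b. 0)"
  unfolding lc_def by simp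

locale steiner =
  fixes N s t :: nat and m :: morph
  assumes N: "N \<ge> 3" and steiner: "steiner_bundle N s t m"
begin

abbreviation "M \<equiv> morph_at N m"

lemma chart_hcoords: "x \<in> chart N S \<Longrightarrow> x \<in> hcoords N"
  by (simp add: chart_def)

lemma M_laurent: "(\<lambda>x. M x a b) \<in> laurent N S 1"
  by (rule laurent_morph_at)

lemma M_cancel:
  assumes "x \<in> hcoords N" "\<And>a. a < t \<Longrightarrow> mmul s (M x) X a b = mmul s (M x) Y a b" "c < s"
  shows "X c b = Y c b"
proof -
  have "\<forall>c<s. X c b - Y c b = 0"
    using assms(2) by (intro steiner_injective[OF steiner assms(1)])
      (auto simp: mmul_def right_diff_distrib sum_subtractf)
  then show ?thesis using assms(3) by simp
qed

text \<open>The columns of X lie in the image of M(x): X represents zero on the fibre. This is a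
  condition at a single point, without any regularity of C in x.\<close>

definition factors :: "(nat \<Rightarrow> complex) \<Rightarrow> nat \<Rightarrow> (nat \<Rightarrow> nat \<Rightarrow> complex) \<Rightarrow> bool" where
  "factors x k X \<longleftrightarrow> (\<exists>C. \<forall>a<t. \<forall>b<k. X a b = mmul s (M x) C a b)"

lemma factorsI: "(\<And>a b. a < t \<Longrightarrow> b < k \<Longrightarrow> X a b = mmul s (M x) C a b) \<Longrightarrow> factors x k X"
  unfolding factors_def by blast

lemma factors_cong:
  assumes "factors x k X" "\<And>a b. a < t \<Longrightarrow> b < k \<Longrightarrow> X a b = Y a b" shows "factors x k Y"
proof -
  obtain C where "\<forall>a<t. \<forall>b<k. X a b = mmul s (M x) C a b" using assms(1) unfolding factors_def by blast
  then show ?thesis using assms(2) by (intro factorsI[where C = C]) simp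
qed

lemma factors_add:
  assumes "factors x k X" "factors x k Y" shows "factors x k (\<lambda>a b. X a b + Y a b)"
proof -
  obtain C D where "\<forall>a<t. \<forall>b<k. X a b = mmul s (M x) C a b" "\<forall>a<t. \<forall>b<k. Y a b = mmul s (M x) D a b"
    using assms unfolding factors_def by blast
  then show ?thesis by (intro factorsI[where C = "\<lambda>a b. C a b + D a b"]) (simp add: mmul_add_right)
qed

lemma factors_scale:
  assumes "factors x k X" shows "factors x k (\<lambda>a b. z * X a b)"
proof -
  obtain C where "\<forall>a<t. \<forall>b<k. X a b = mmul s (M x) C a b" using assms unfolding factors_def by blast
  then show ?thesis
    by (intro factorsI[where C = "\<lambda>a b. z * C a b"]) (simp add: mmul_def sum_distrib_left mult.left_commute)
qed

lemma factors_diff: "factors x k X \<Longrightarrow> factors x k Y \<Longrightarrow> factors x k (\<lambda>a b. X a b - Y a b)"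
  using factors_add[OF _ factors_scale[of x k Y "- 1"]] by fastforce

lemma factors_sum: "(\<And>i. i \<in> A \<Longrightarrow> factors x k (X i)) \<Longrightarrow> factors x k (\<lambda>a b. \<Sum>i\<in>A. X i a b)"
proof (induction A rule: infinite_finite_induct)
  case (insert i A)
  then show ?case using factors_add[of x k "X i" "\<lambda>a b. \<Sum>i\<in>A. X i a b"] by simp
qed (auto intro!: factorsI[where C = "\<lambda>_ _. 0"] simp: mmul_def)

lemma factors_mmul:
  assumes "factors x k X" shows "factors x l (mmul k X Y)"
proof -
  obtain C where C: "\<forall>a<t. \<forall>b<k. X a b = mmul s (M x) C a b" using assms unfolding factors_def by blast
  show ?thesis
  proof (rule factorsI[where C = "mmul k C Y"])
    fix a b assume "a < t" "b < l"
    then have "mmul k X Y a b = mmul k (mmul s (M x) C) Y a b" using C by (intro mmul_cong) auto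
    then show "mmul k X Y a b = mmul s (M x) (mmul k C Y) a b" by (simp add: mmul_assoc)
  qed
qed

lemma image_iff_factors:
  "(\<forall>v\<in>affine_space {..<k}. mat_apply t k X v \<in> morph_image N s t m x) \<longleftrightarrow> factors x k X"
proof
  assume im: "\<forall>v\<in>affine_space {..<k}. mat_apply t k X v \<in> morph_image N s t m x"
  have "\<exists>w. \<forall>a<t. X a b = (\<Sum>c<s. M x a c * w c)" if "b < k" for b
  proof -
    have "unit_fun b \<in> affine_space {..<k}" using that by (auto simp: affine_space_def unit_fun_def)
    then obtain w where "mat_apply t k X (unit_fun b) = mat_apply t s (M x) w"
      using im unfolding morph_image_def by blast
    then have "(\<Sum>c<k. X a c * unit_fun b c) = (\<Sum>c<s. M x a c * w c)" if "a < t" for a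
      using that by (auto simp: mat_apply_def dest!: fun_cong[of _ _ a])
    moreover have "(\<Sum>c<k. X a c * unit_fun b c) = X a b" for a
      using that by (simp add: unit_fun_def if_distrib[of "\<lambda>z. _ * z"] cong: if_cong)
    ultimately show ?thesis by auto
  qed
  then obtain W where "\<And>b. b < k \<Longrightarrow> \<forall>a<t. X a b = (\<Sum>c<s. M x a c * W b c)" by metis
  then show "factors x k X" by (intro factorsI[where C = "\<lambda>c b. W b c"]) (simp add: mmul_def)
next
  assume "factors x k X"
  then obtain C where C: "\<forall>a<t. \<forall>b<k. X a b = mmul s (M x) C a b" unfolding factors_def by blast
  show "\<forall>v\<in>affine_space {..<k}. mat_apply t k X v \<in> morph_image N s t m x"
  proof
    fix v assume "v \<in> affine_space {..<k}"
    define w where "w = (\<lambda>c. if c < s then \<Sum>b<k. C c b * v b else 0)"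
    have "(\<Sum>b<k. X a b * v b) = (\<Sum>c<s. M x a c * w c)" if "a < t" for a
    proof -
      have "(\<Sum>b<k. X a b * v b) = mmul k X (\<lambda>b _. v b) a 0" by (simp add: mmul_def)
      also have "\<dots> = mmul k (mmul s (M x) C) (\<lambda>b _. v b) a 0" using C that by (intro mmul_cong) auto
      also have "\<dots> = (\<Sum>c<s. M x a c * w c)" unfolding mmul_assoc by (simp add: mmul_def w_def)
      finally show ?thesis .
    qed
    then have "mat_apply t k X v = mat_apply t s (M x) w" by (auto simp: mat_apply_def)
    moreover have "w \<in> affine_space {..<s}" by (auto simp: w_def affine_space_def)
    ultimately show "mat_apply t k X v \<in> morph_image N s t m x" unfolding morph_image_def by blast
  qed
qed

lemma end_null_iff: "A \<in> end_null N s t m U \<longleftrightarrow> (\<forall>x\<in>U. factors x t (A x))"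
  unfolding end_null_def image_iff_factors[symmetric] by (auto simp: image_subset_iff)

lemma preserves_iff:
  "mat_apply t t A ` morph_image N s t m x \<subseteq> morph_image N s t m x \<longleftrightarrow> factors x s (mmul t A (M x))"
proof -
  have "mat_apply t t A (mat_apply t s (M x) v) = mat_apply t s (mmul t A (M x)) v" for v
    using mmul_assoc[of s t A "M x" "\<lambda>b _. v b"]
    by (auto simp: mat_apply_def mmul_def fun_eq_iff)
  then show ?thesis unfolding image_iff_factors[symmetric] morph_image_def by (auto simp: image_subset_iff)
qed

lemma end_null_mono: "A \<in> end_null N s t m U \<Longrightarrow> W \<subseteq> U \<Longrightarrow> A \<in> end_null N s t m W"
  unfolding end_null_iff by blast

lemma end_null_diff:
  "A \<in> end_null N s t m U \<Longrightarrow> B \<in> end_null N s t m U \<Longrightarrow> A - B \<in> end_null N s t m U"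
  unfolding end_null_iff by (auto dest: factors_diff simp: fun_diff_def)

lemma end_sections_cong:
  assumes A: "A \<in> end_sections N s t m U" and n: "A - A' \<in> end_null N s t m U"
  shows "A' \<in> end_sections N s t m U"
  unfolding end_sections_def
proof (intro CollectI conjI ballI)
  fix x assume x: "x \<in> U"
  have 1: "factors x s (mmul t (A x) (M x))" using A x unfolding end_sections_def preserves_iff by blast
  have "factors x t ((A - A') x)" using n x unfolding end_null_iff by blast
  from factors_mmul[OF this] have "factors x s (mmul t ((A - A') x) (M x))" .
  from factors_diff[OF 1 this] show "mat_apply t t (A' x) ` morph_image N s t m x \<subseteq> morph_image N s t m x"
    unfolding preserves_iff by (rule factors_cong) (simp add: fun_diff_def mmul_diff_left)
next
  fix p assume "p \<in> U"
  then obtain W R where W: "proj_open N W" "p \<in> W" "W \<subseteq> U"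
     "\<forall>a<t. \<forall>b<t. regular_on N W (\<lambda>x. R x a b)" "A - R \<in> end_null N s t m W"
    using A unfolding end_sections_def by blast
  have "(A - R) - (A - A') \<in> end_null N s t m W"
    by (rule end_null_diff[OF W(5) end_null_mono[OF n W(3)]])
  moreover have "(A - R) - (A - A') = A' - R" by (auto simp: fun_eq_iff)
  ultimately show "\<exists>W R. proj_open N W \<and> p \<in> W \<and> W \<subseteq> U \<and>
      (\<forall>a<t. \<forall>b<t. regular_on N W (\<lambda>x. R x a b)) \<and> A' - R \<in> end_null N s t m W" using W by metis
qed

lemma end_sections_of_laurent:
  assumes S: "S \<subseteq> {..<N}" and A: "\<And>a b. (\<lambda>x. A x a b) \<in> laurent N S 0"
    and AM: "\<And>x a b. x \<in> chart N S \<Longrightarrow> a < t \<Longrightarrow> b < s \<Longrightarrow> mmul t (A x) (M x) a b = mmul s (M x) (B x) a b"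
  shows "A \<in> end_sections N s t m (chart N S)"
  unfolding end_sections_def
proof (intro CollectI conjI ballI)
  fix x assume "x \<in> chart N S"
  then show "mat_apply t t (A x) ` morph_image N s t m x \<subseteq> morph_image N s t m x"
    unfolding preserves_iff using AM by (intro factorsI)
next
  fix p assume "p \<in> chart N S"
  moreover have "A - A \<in> end_null N s t m (chart N S)"
    unfolding end_null_iff by (auto intro!: factorsI[where C = "\<lambda>_ _. 0"] simp: mmul_def)
  ultimately show "\<exists>W R. proj_open N W \<and> p \<in> W \<and> W \<subseteq> chart N S \<and>
      (\<forall>a<t. \<forall>b<t. regular_on N W (\<lambda>x. R x a b)) \<and> A - R \<in> end_null N s t m W"
    using proj_open_chart[OF S] regular_of_laurent[OF A] by blast
qed

text \<open>One left inverse of M is fixed for each nonempty S. No compatibility between charts is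
  available, and it is the differences between charts that produce H^1.\<close>

definition Linv :: "nat set \<Rightarrow> msection" where
  "Linv S = (SOME L. (\<forall>b a. (\<lambda>x. L x b a) \<in> laurent N S (- 1)) \<and>
     (\<forall>x\<in>chart N S. \<forall>b<s. \<forall>c<s. (\<Sum>a<t. L x b a * M x a c) = (if b = c then 1 else 0)))"

lemma Linv:
  assumes "S \<subseteq> {..<N}" "S \<noteq> {}"
  shows "(\<lambda>x. Linv S x b a) \<in> laurent N S (- 1)"
    and "x \<in> chart N S \<Longrightarrow> b < s \<Longrightarrow> c < s \<Longrightarrow> mmul t (Linv S x) (M x) b c = (if b = c then 1 else 0)"
  using someI_ex[OF steiner_left_inverse[OF steiner assms]] unfolding Linv_def mmul_def by blast+

lemma mmul_Linv:
  assumes "S \<subseteq> {..<N}" "S \<noteq> {}" "x \<in> chart N S" "b < s"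
  shows "mmul s A (mmul t (Linv S x) (M x)) a b = A a b"
proof -
  have "mmul s A (mmul t (Linv S x) (M x)) a b = (\<Sum>c<s. A a c * (if c = b then 1 else 0))"
    unfolding mmul_def[of s] using Linv(2)[OF assms(1-3)] assms(4) by (intro sum.cong) auto
  then show ?thesis using assms(4) by (simp add: sum_delta_mult)
qed

text \<open>With the projection \<open>P = 1 - M L\<close>, whose kernel is the image of \<open>M\<close>, the representative
  \<open>P c P\<close> of the section depends only on the class of \<open>c\<close>, hence is regular.\<close>

lemma end_sections_normal_form:
  assumes S: "S \<subseteq> {..<N}" "S \<noteq> {}" and c: "c \<in> end_sections N s t m (chart N S)"
  shows "\<exists>A. (\<forall>a b. (\<lambda>x. A x a b) \<in> laurent N S 0) \<and>
    (\<forall>x\<in>chart N S. \<forall>a<t. \<forall>b<s. mmul t (A x) (M x) a b = 0) \<and> c - A \<in> end_null N s t m (chart N S)"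
proof -
  define P where "P x a b = (if a = b then 1 else 0) - mmul s (M x) (Linv S x) a b" for x a b
  have Pl: "(\<lambda>x. P x a b) \<in> laurent N S 0" for a b
  proof -
    have "(\<lambda>x. mmul s (M x) (Linv S x) a b) \<in> laurent N S 0"
      unfolding mmul_def using laurent_mult[OF M_laurent Linv(1)[OF S]] by (intro laurent_sum) simp
    then show ?thesis unfolding P_def by (intro laurent_diff laurent_const)
  qed
  have Pleft: "mmul t (P x) X a b = X a b - mmul s (M x) (mmul t (Linv S x) X) a b" if "a < t" for x X a b
  proof -
    have "mmul t (P x) X a b = (\<Sum>c<t. (if a = c then 1 else 0) * X c b) - mmul t (mmul s (M x) (Linv S x)) X a b"
      unfolding P_def mmul_def by (simp add: left_diff_distrib sum_subtractf)
    then show ?thesis using that by (simp add: sum_delta_mult mmul_assoc)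
  qed
  have Pright: "mmul t X (P x) a b = X a b - mmul s (mmul t X (M x)) (Linv S x) a b" if "b < t" for x X a b
  proof -
    have "mmul t X (P x) a b = (\<Sum>c<t. X a c * (if c = b then 1 else 0)) - mmul t X (mmul s (M x) (Linv S x)) a b"
      unfolding P_def mmul_def by (simp add: right_diff_distrib sum_subtractf)
    then show ?thesis using that by (simp add: sum_delta_mult mmul_assoc)
  qed
  have PM: "mmul t (P x) (M x) a b = 0" if "x \<in> chart N S" "a < t" "b < s" for x a b
    using Pleft[OF that(2)] mmul_Linv[OF S that(1,3)] by simp
  define A where "A x a b = (if a < t \<and> b < t then mmul t (mmul t (P x) (c x)) (P x) a b else 0)" for x a b
  have "(\<lambda>x. A x a b) \<in> laurent N S 0" for a b
  proof (cases "a < t \<and> b < t")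
    case True
    have "regular_on N (chart N S) (\<lambda>x. A x a b)"
    proof (rule regular_local)
      show "chart N S \<subseteq> hcoords N" using chart_hcoords by blast
      fix p assume "p \<in> chart N S"
      then obtain W R where W: "proj_open N W" "p \<in> W" "W \<subseteq> chart N S"
         "\<forall>a<t. \<forall>b<t. regular_on N W (\<lambda>x. R x a b)" "c - R \<in> end_null N s t m W"
        using c unfolding end_sections_def by blast
      have Preg: "regular_on N W (\<lambda>x. P x a b)" for a b
        using regular_of_laurent[OF Pl] W(3) by (rule regular_cong) simp
      have "regular_on N W (\<lambda>x. mmul t (mmul t (P x) (R x)) (P x) a b)"
        unfolding mmul_def using W(4) Preg True by (intro regular_sum regular_mult) auto
      then have "regular_on N W (\<lambda>x. A x a b)"
      proof (rule regular_cong[OF _ order_refl])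
        fix x assume x: "x \<in> W"
        have "factors x t ((c - R) x)" using W(5) x unfolding end_null_iff by blast
        then obtain C where C: "\<forall>a<t. \<forall>b<t. c x a b - R x a b = mmul s (M x) C a b"
          unfolding factors_def by auto
        have xc: "x \<in> chart N S" using x W(3) by blast
        \<comment> \<open>P annihilates M C, so c may be replaced by its regular local
          representative R.\<close>
        have "mmul t (P x) (c x) a d = mmul t (P x) (R x) a d" if "d < t" for d
        proof -
          have "mmul t (P x) (c x) a d - mmul t (P x) (R x) a d = mmul t (P x) (\<lambda>a b. c x a b - R x a b) a d"
            by (simp add: mmul_diff_right)
          also have "\<dots> = mmul t (P x) (mmul s (M x) C) a d" using C that by (intro mmul_cong) auto
          also have "\<dots> = mmul s (mmul t (P x) (M x)) C a d" by (simp add: mmul_assoc)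
          also have "\<dots> = mmul s (\<lambda>_ _. 0) C a d" using PM[OF xc] True by (intro mmul_cong) auto
          finally show ?thesis by (simp add: mmul_def)
        qed
        then have "mmul t (mmul t (P x) (R x)) (P x) a b = mmul t (mmul t (P x) (c x)) (P x) a b"
          by (intro mmul_cong[of t "mmul t (P x) (R x)"]) auto
        then show "mmul t (mmul t (P x) (R x)) (P x) a b = A x a b" using True by (simp add: A_def)
      qed
      then show "\<exists>W. proj_open N W \<and> p \<in> W \<and> W \<subseteq> chart N S \<and> regular_on N W (\<lambda>x. A x a b)"
        using W by blast
    qed
    then show ?thesis by (rule laurent_of_regular[OF S])
  qed (auto simp: A_def)
  moreover have "mmul t (A x) (M x) a b = 0" if "x \<in> chart N S" "a < t" "b < s" for x a b
  proof -
    have "mmul t (A x) (M x) a b = mmul t (mmul t (mmul t (P x) (c x)) (P x)) (M x) a b"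
      using that by (intro mmul_cong) (auto simp: A_def)
    also have "\<dots> = mmul t (mmul t (P x) (c x)) (mmul t (P x) (M x)) a b" by (simp add: mmul_assoc)
    also have "\<dots> = mmul t (mmul t (P x) (c x)) (\<lambda>_ _. 0) a b" using PM that by (intro mmul_cong) auto
    finally show ?thesis by (simp add: mmul_def)
  qed
  moreover have "c - A \<in> end_null N s t m (chart N S)"
    unfolding end_null_iff
  proof
    fix x assume x: "x \<in> chart N S"
    have "factors x s (mmul t (c x) (M x))" using c x unfolding end_sections_def preserves_iff by blast
    \<comment> \<open>c - P c P = (c M) L + M (L c P), where the first summand factors because c
      preserves the image of M.\<close>
    then have 1: "factors x t (mmul s (mmul t (c x) (M x)) (Linv S x))" by (rule factors_mmul)
    have 2: "factors x t (mmul s (M x) (mmul t (Linv S x) (mmul t (c x) (P x))))" by (rule factorsI) simp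
    show "factors x t ((c - A) x)"
      using factors_add[OF 1 2]
    proof (rule factors_cong)
      fix a b assume ab: "a < t" "b < t"
      have "A x a b = mmul t (P x) (mmul t (c x) (P x)) a b" using ab by (simp add: A_def mmul_assoc)
      also have "\<dots> = mmul t (c x) (P x) a b - mmul s (M x) (mmul t (Linv S x) (mmul t (c x) (P x))) a b"
        by (rule Pleft[OF ab(1)])
      also have "mmul t (c x) (P x) a b = c x a b - mmul s (mmul t (c x) (M x)) (Linv S x) a b"
        by (rule Pright[OF ab(2)])
      finally show "mmul s (mmul t (c x) (M x)) (Linv S x) a b +
          mmul s (M x) (mmul t (Linv S x) (mmul t (c x) (P x))) a b = (c - A) x a b" by simp
    qed
  qed
  ultimately show ?thesis by blast
qed

section \<open>Resolving cocycles of End E by cochains of line bundles\<close>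

lemma M_global: "(\<lambda>x. M x a b) \<in> laurent N {} 1"
  by (rule laurent_morph_at)

lemma card_nonempty: "card S = Suc p \<Longrightarrow> S \<noteq> {}"
  by auto

text \<open>On each chart X = M D with D = L X. As M is injective on fibres, D inherits the cocycle
  condition, and the augmented Cech complex of O(-1) is exact.\<close>

lemma null_cocycle:
  assumes X: "lc N (Suc p) 0 X"
    and null: "\<And>S x. S \<subseteq> {..<N} \<Longrightarrow> card S = Suc p \<Longrightarrow> x \<in> chart N S \<Longrightarrow> factors x t (X S x)"
    and cyc: "\<And>S x a b. finite S \<Longrightarrow> card S = Suc (Suc p) \<Longrightarrow> coboundary X S x a b = 0"
  shows "\<exists>C. lc N p (- 1) C \<and> (\<forall>S x a b. S \<subseteq> {..<N} \<longrightarrow> card S = Suc p \<longrightarrow> x \<in> chart N S \<longrightarrow> a < t \<longrightarrow>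
    b < t \<longrightarrow> X S x a b = mmul s (M x) (coboundary C S x) a b)"
proof -
  have N2: "N \<ge> 2" using N by simp
  define D :: cochain where "D S x = mmul t (Linv S x) (X S x)" for S x
  have D: "lc N (Suc p) (- 1) D"
  proof (rule lcI)
    fix S a b assume S: "S \<subseteq> {..<N}" "card S = Suc p"
    then show "(\<lambda>x. D S x a b) \<in> laurent N S (- 1)"
      using laurent_mult[OF Linv(1)[OF S(1) card_nonempty[OF S(2)]] lcD[OF X S]]
      unfolding D_def mmul_def by (intro laurent_sum) simp
  qed
  have XD: "X S x a b = mmul s (M x) (D S x) a b"
    if S: "S \<subseteq> {..<N}" "card S = Suc p" and x: "x \<in> chart N S" and ab: "a < t" "b < t" for S x a b
  proof -
    obtain C where C: "\<forall>a<t. \<forall>b<t. X S x a b = mmul s (M x) C a b"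
      using null[OF S x] unfolding factors_def by blast
    \<comment> \<open>The factor C, known only at this point, is recovered by L and therefore
      depends on x as a Laurent polynomial.\<close>
    have "C c b = D S x c b" if c: "c < s" for c
    proof -
      have "D S x c b = mmul t (Linv S x) (mmul s (M x) C) c b"
        unfolding D_def using C ab by (intro mmul_cong) auto
      also have "\<dots> = mmul s (mmul t (Linv S x) (M x)) C c b" by (simp add: mmul_assoc)
      also have "\<dots> = (\<Sum>e<s. (if c = e then 1 else 0) * C e b)"
        unfolding mmul_def[of s] using Linv(2)[OF S(1) card_nonempty[OF S(2)] x c] by (intro sum.cong) auto
      finally show ?thesis using c by (simp add: sum_delta_mult)
    qed
    then have "mmul s (M x) C a b = mmul s (M x) (D S x) a b" by (intro mmul_cong) auto
    then show ?thesis using C ab by simp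
  qed
  have "\<exists>C. lc N p (- 1) C \<and> (\<forall>S x a b. S \<subseteq> {..<N} \<longrightarrow> card S = Suc p \<longrightarrow> x \<in> chart N S \<longrightarrow>
      a < s \<longrightarrow> b < t \<longrightarrow> D S x a b = coboundary C S x a b)"
  proof (rule laurent_cech_exact_matrix[OF N2 _ D])
    fix S x a b
    assume S: "S \<subseteq> {..<N}" "card S = Suc (Suc p)" and x: "x \<in> chart N S" and ab: "a < s" "b < t"
    show "coboundary D S x a b = 0"
    proof (rule M_cancel[OF chart_hcoords[OF x] _ ab(1), where Y = "\<lambda>_ _. 0"])
      fix a' assume a': "a' < t"
      have "mmul s (M x) (coboundary D S x) a' b = coboundary (\<lambda>S x. mmul s (M x) (D S x)) S x a' b"
        by (rule coboundary_mmul_left[symmetric])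
      also have "\<dots> = coboundary X S x a' b"
      proof (rule coboundary_cong, rule XD[symmetric])
        fix i assume "i \<in> S"
        then show "S - {i} \<subseteq> {..<N}" "card (S - {i}) = Suc p" "x \<in> chart N (S - {i})"
          using S x by (auto simp: chart_def)
      qed (use a' ab in auto)
      also have "\<dots> = 0" using cyc S finite_subset by blast
      finally show "mmul s (M x) (coboundary D S x) a' b = mmul s (M x) (\<lambda>_ _. 0) a' b" by (simp add: mmul_def)
    qed
  qed simp
  then obtain C where C: "lc N p (- 1) C" and DC: "\<forall>S x a b. S \<subseteq> {..<N} \<longrightarrow> card S = Suc p \<longrightarrow>
      x \<in> chart N S \<longrightarrow> a < s \<longrightarrow> b < t \<longrightarrow> D S x a b = coboundary C S x a b"
    by (elim exE conjE) rule
  have "X S x a b = mmul s (M x) (coboundary C S x) a b"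
    if S: "S \<subseteq> {..<N}" "card S = Suc p" "x \<in> chart N S" and ab: "a < t" "b < t" for S x a b
    unfolding XD[OF S ab] using DC[rule_format, OF S] ab by (intro mmul_cong) auto
  then show ?thesis using C by (intro exI[of _ C]) simp
qed

text \<open>The hypotheses say that the coboundary of \<open>(X, Y)\<close> consists of pairs \<open>(M D, D M)\<close>. As \<open>M\<close> is
  injective, \<open>D\<close> is a cocycle of degree \<open>-1\<close>, hence a coboundary, and correcting by it turns \<open>X\<close>
  and \<open>Y\<close> into cocycles of degree \<open>0\<close>, hence into coboundaries.\<close>

lemma resolve:
  assumes X: "lc N (Suc p) 0 X" and Y: "lc N (Suc p) 0 Y"
    and null: "\<And>S x. S \<subseteq> {..<N} \<Longrightarrow> card S = Suc (Suc p) \<Longrightarrow> x \<in> chart N S \<Longrightarrow> factors x t (coboundary X S x)"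
    and comp: "\<And>S x a b. S \<subseteq> {..<N} \<Longrightarrow> card S = Suc (Suc p) \<Longrightarrow> x \<in> chart N S \<Longrightarrow> a < t \<Longrightarrow> b < s \<Longrightarrow>
      mmul t (coboundary X S x) (M x) a b = mmul s (M x) (coboundary Y S x) a b"
  shows "\<exists>C E F. lc N (Suc p) (- 1) C \<and> lc N p 0 E \<and> lc N p 0 F \<and>
    (\<forall>S x. S \<subseteq> {..<N} \<longrightarrow> card S = Suc p \<longrightarrow> x \<in> chart N S \<longrightarrow>
      (\<forall>a<t. \<forall>b<t. X S x a b = mmul s (M x) (C S x) a b + coboundary E S x a b) \<and>
      (\<forall>a<s. \<forall>b<s. Y S x a b = mmul t (C S x) (M x) a b + coboundary F S x a b))"
proof -
  have N2: "N \<ge> 2" using N by simp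
  have "\<exists>C. lc N (Suc p) (- 1) C \<and> (\<forall>S x a b. S \<subseteq> {..<N} \<longrightarrow> card S = Suc (Suc p) \<longrightarrow>
      x \<in> chart N S \<longrightarrow> a < t \<longrightarrow> b < t \<longrightarrow> coboundary X S x a b = mmul s (M x) (coboundary C S x) a b)"
    by (rule null_cocycle[OF lc_coboundary[OF X]]) (fact null, simp add: coboundary_coboundary)
  then obtain C where C: "lc N (Suc p) (- 1) C"
    and XC0: "\<forall>S x a b. S \<subseteq> {..<N} \<longrightarrow> card S = Suc (Suc p) \<longrightarrow> x \<in> chart N S \<longrightarrow> a < t \<longrightarrow> b < t \<longrightarrow>
      coboundary X S x a b = mmul s (M x) (coboundary C S x) a b"
    by (elim exE conjE) rule
  note XC = XC0[rule_format]
  have MC: "lc N (Suc p) 0 (\<lambda>S x. mmul s (M x) (C S x))"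
    using lc_mmul_left[where B = M and e = 1 and n = s, OF C M_global] by simp
  have CM: "lc N (Suc p) 0 (\<lambda>S x. mmul t (C S x) (M x))"
    using lc_mmul_right[where B = M and e = 1 and n = t, OF C M_global] by simp
  note X' = lc_diff[OF X MC] and Y' = lc_diff[OF Y CM]
  have "\<exists>E. lc N p 0 E \<and> (\<forall>S x a b. S \<subseteq> {..<N} \<longrightarrow> card S = Suc p \<longrightarrow> x \<in> chart N S \<longrightarrow>
      a < t \<longrightarrow> b < t \<longrightarrow> X S x a b - mmul s (M x) (C S x) a b = coboundary E S x a b)"
  proof (rule laurent_cech_exact_matrix[OF N2 _ X'])
    fix S x a b
    assume S: "S \<subseteq> {..<N}" "card S = Suc (Suc p)" and x: "x \<in> chart N S" and ab: "a < t" "b < t"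
    show "coboundary (\<lambda>S x a b. X S x a b - mmul s (M x) (C S x) a b) S x a b = 0"
      using XC[OF S x ab] by (simp add: coboundary_diff coboundary_mmul_left)
  qed simp
  then obtain E where E: "lc N p 0 E"
    "\<And>S x a b. S \<subseteq> {..<N} \<Longrightarrow> card S = Suc p \<Longrightarrow> x \<in> chart N S \<Longrightarrow> a < t \<Longrightarrow> b < t \<Longrightarrow>
      X S x a b - mmul s (M x) (C S x) a b = coboundary E S x a b" by blast
  have "\<exists>F. lc N p 0 F \<and> (\<forall>S x a b. S \<subseteq> {..<N} \<longrightarrow> card S = Suc p \<longrightarrow> x \<in> chart N S \<longrightarrow>
      a < s \<longrightarrow> b < s \<longrightarrow> Y S x a b - mmul t (C S x) (M x) a b = coboundary F S x a b)"
  proof (rule laurent_cech_exact_matrix[OF N2 _ Y'])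
    fix S x a b
    assume S: "S \<subseteq> {..<N}" "card S = Suc (Suc p)" and x: "x \<in> chart N S" and ab: "a < s" "b < s"
    have "coboundary Y S x a b = mmul t (coboundary C S x) (M x) a b"
    proof (rule M_cancel[OF chart_hcoords[OF x] _ ab(1)])
      fix a' assume a': "a' < t"
      have "mmul s (M x) (coboundary Y S x) a' b = mmul t (coboundary X S x) (M x) a' b"
        using comp[OF S x a' ab(2)] by simp
      also have "\<dots> = mmul t (mmul s (M x) (coboundary C S x)) (M x) a' b"
        using XC[OF S x a'] by (intro mmul_cong) auto
      finally show "mmul s (M x) (coboundary Y S x) a' b = mmul s (M x) (mmul t (coboundary C S x) (M x)) a' b"
        by (simp add: mmul_assoc)
    qed
    then show "coboundary (\<lambda>S x a b. Y S x a b - mmul t (C S x) (M x) a b) S x a b = 0"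
      by (simp add: coboundary_diff coboundary_mmul_right)
  qed simp
  then obtain F where F: "lc N p 0 F"
    "\<And>S x a b. S \<subseteq> {..<N} \<Longrightarrow> card S = Suc p \<Longrightarrow> x \<in> chart N S \<Longrightarrow> a < s \<Longrightarrow> b < s \<Longrightarrow>
      Y S x a b - mmul t (C S x) (M x) a b = coboundary F S x a b" by blast
  have "(\<forall>a<t. \<forall>b<t. X S x a b = mmul s (M x) (C S x) a b + coboundary E S x a b) \<and>
      (\<forall>a<s. \<forall>b<s. Y S x a b = mmul t (C S x) (M x) a b + coboundary F S x a b)"
    if "S \<subseteq> {..<N}" "card S = Suc p" "x \<in> chart N S" for S x
    using E(2)[OF that] F(2)[OF that] by (auto simp: algebra_simps)
  then show ?thesis using C E(1) F(1) by blast
qed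

section \<open>Cochains of End E modulo null cochains\<close>

lemma null_cochains_iff:
  "c \<in> null_cochains N s t m p \<longleftrightarrow>
    (\<forall>S x. S \<subseteq> {..<N} \<longrightarrow> card S = Suc p \<longrightarrow> x \<in> chart N S \<longrightarrow> factors x t (c S x))"
  unfolding null_cochains_def end_null_iff by blast

lemma null_cochains_coboundary:
  assumes c: "c \<in> null_cochains N s t m p" shows "coboundary c \<in> null_cochains N s t m (Suc p)"
  unfolding null_cochains_iff
proof (intro allI impI)
  fix S x assume S: "S \<subseteq> {..<N}" "card S = Suc (Suc p)" and x: "x \<in> chart N S"
  show "factors x t (coboundary c S x)" unfolding coboundary_def
  proof (rule factors_sum)
    fix i assume "i \<in> S"
    then have "S - {i} \<subseteq> {..<N}" "card (S - {i}) = Suc p" "x \<in> chart N (S - {i})"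
      using S x by (auto simp: chart_def)
    then have "factors x t (c (S - {i}) x)" using c unfolding null_cochains_iff by blast
    then show "factors x t (\<lambda>a b. (- 1) ^ card {j \<in> S. j < i} * c (S - {i}) x a b)" by (rule factors_scale)
  qed
qed

lemma null_cochains_subspace: "cochain.subspace (null_cochains N s t m p)"
  unfolding cochain.subspace_def null_cochains_iff
proof (intro conjI ballI allI impI; (elim CollectE)?)
  fix S x show "factors x t ((0 :: cochain) S x)"
    by (rule factorsI[where C = "\<lambda>_ _. 0"]) (simp add: mmul_def)
next
  fix c c' S x assume "c \<in> null_cochains N s t m p" "c' \<in> null_cochains N s t m p"
    "S \<subseteq> {..<N}" "card S = Suc p" "x \<in> chart N S"
  then have "factors x t (\<lambda>a b. c S x a b + c' S x a b)"
    unfolding null_cochains_iff by (intro factors_add) auto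
  then show "factors x t ((c + c') S x)" by (simp add: plus_fun_def)
next
  fix c k S x assume "c \<in> null_cochains N s t m p" "S \<subseteq> {..<N}" "card S = Suc p" "x \<in> chart N S"
  then have "factors x t (\<lambda>a b. k * c S x a b)" unfolding null_cochains_iff by (intro factors_scale) auto
  then show "factors x t (cochain_scale k c S x)" by (simp add: cochain_scale_def)
qed

text \<open>This is the normal form applied chart by chart: modulo null cochains, A M is not only
  divisible by M but zero, so A is paired with B = 0 in the resolution.\<close>

lemma cochains_iff:
  "c \<in> cochains N s t m p \<longleftrightarrow> (\<exists>A. lc N (Suc p) 0 A \<and>
    (\<forall>S x a b. S \<subseteq> {..<N} \<longrightarrow> card S = Suc p \<longrightarrow> x \<in> chart N S \<longrightarrow> a < t \<longrightarrow> b < s \<longrightarrow>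
      mmul t (A S x) (M x) a b = 0) \<and> c - A \<in> null_cochains N s t m p)"
proof
  assume c: "c \<in> cochains N s t m p"
  define R where "R S A \<longleftrightarrow> (\<forall>a b. (\<lambda>x. A x a b) \<in> laurent N S 0) \<and>
    (\<forall>x\<in>chart N S. \<forall>a<t. \<forall>b<s. mmul t (A x) (M x) a b = 0) \<and> c S - A \<in> end_null N s t m (chart N S)"
    for S and A :: msection
  have "\<forall>S. \<exists>A. S \<subseteq> {..<N} \<and> card S = Suc p \<longrightarrow> R S A"
  proof
    fix S
    show "\<exists>A. S \<subseteq> {..<N} \<and> card S = Suc p \<longrightarrow> R S A"
    proof (cases "S \<subseteq> {..<N} \<and> card S = Suc p")
      case True
      then have "c S \<in> end_sections N s t m (chart N S)" using c unfolding cochains_def by blast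
      from end_sections_normal_form[OF _ card_nonempty this] True show ?thesis unfolding R_def by simp
    qed blast
  qed
  from choice[OF this] obtain A0 where A0: "\<forall>S. S \<subseteq> {..<N} \<and> card S = Suc p \<longrightarrow> R S (A0 S)" ..
  define A :: cochain where "A = A0"
  have A: "R S (A S)" if "S \<subseteq> {..<N}" "card S = Suc p" for S using A0 that A_def by simp
  have "lc N (Suc p) 0 A" using A unfolding lc_def R_def by blast
  moreover have "c - A \<in> null_cochains N s t m p" using A unfolding null_cochains_def R_def by simp
  ultimately show "\<exists>A. lc N (Suc p) 0 A \<and>
    (\<forall>S x a b. S \<subseteq> {..<N} \<longrightarrow> card S = Suc p \<longrightarrow> x \<in> chart N S \<longrightarrow> a < t \<longrightarrow> b < s \<longrightarrow>
      mmul t (A S x) (M x) a b = 0) \<and> c - A \<in> null_cochains N s t m p" using A unfolding R_def by blast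
next
  assume "\<exists>A. lc N (Suc p) 0 A \<and>
    (\<forall>S x a b. S \<subseteq> {..<N} \<longrightarrow> card S = Suc p \<longrightarrow> x \<in> chart N S \<longrightarrow> a < t \<longrightarrow> b < s \<longrightarrow>
      mmul t (A S x) (M x) a b = 0) \<and> c - A \<in> null_cochains N s t m p"
  then obtain A where A: "lc N (Suc p) 0 A" "\<And>S x a b. S \<subseteq> {..<N} \<Longrightarrow> card S = Suc p \<Longrightarrow> x \<in> chart N S \<Longrightarrow>
      a < t \<Longrightarrow> b < s \<Longrightarrow> mmul t (A S x) (M x) a b = 0" "c - A \<in> null_cochains N s t m p" by blast
  show "c \<in> cochains N s t m p" unfolding cochains_def
  proof (intro CollectI allI impI, elim conjE)
    fix S assume S: "S \<subseteq> {..<N}" "card S = Suc p"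
    have AS: "A S \<in> end_sections N s t m (chart N S)"
      by (rule end_sections_of_laurent[OF S(1) lcD[OF A(1) S], where B = "\<lambda>_ _ _. 0"])
        (simp add: A(2)[OF S] mmul_def[of s])
    have "A S - c S \<in> end_null N s t m (chart N S)" unfolding end_null_iff
    proof
      fix x assume "x \<in> chart N S"
      then have "factors x t ((c - A) S x)" using A(3) S unfolding null_cochains_iff by blast
      then have "factors x t (\<lambda>a b. (- 1) * (c - A) S x a b)" by (rule factors_scale)
      then show "factors x t ((A S - c S) x)" by (rule factors_cong) simp
    qed
    then show "c S \<in> end_sections N s t m (chart N S)" by (rule end_sections_cong[OF AS])
  qed
qed

text \<open>B is the second component of a pair in the resolution. Preserving the image of M is a
  condition on fibres, so no regularity is asked of B.\<close>

lemma cochainsI: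
  assumes A: "lc N (Suc p) 0 A" and AM: "\<And>S x a b. S \<subseteq> {..<N} \<Longrightarrow> card S = Suc p \<Longrightarrow> x \<in> chart N S \<Longrightarrow>
      a < t \<Longrightarrow> b < s \<Longrightarrow> mmul t (A S x) (M x) a b = mmul s (M x) (B S x) a b"
  shows "A \<in> cochains N s t m p"
  unfolding cochains_def
proof (intro CollectI allI impI, elim conjE)
  fix S assume S: "S \<subseteq> {..<N}" "card S = Suc p"
  show "A S \<in> end_sections N s t m (chart N S)"
    by (rule end_sections_of_laurent[OF S(1) lcD[OF A S], where B = "B S"]) (rule AM[OF S])
qed

lemma cochains_subspace: "cochain.subspace (cochains N s t m p)"
  unfolding cochain.subspace_def
proof (intro conjI ballI allI)
  have "(\<lambda>S x a b. 0) \<in> cochains N s t m p"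
    by (rule cochainsI[OF lc_zero, where B = "\<lambda>S x a b. 0"]) (simp add: mmul_def)
  then show "0 \<in> cochains N s t m p" by (simp add: zero_fun_def)
next
  fix c c' assume "c \<in> cochains N s t m p" "c' \<in> cochains N s t m p"
  then obtain A A' where A: "lc N (Suc p) 0 A" "\<And>S x a b. S \<subseteq> {..<N} \<Longrightarrow> card S = Suc p \<Longrightarrow> x \<in> chart N S \<Longrightarrow>
      a < t \<Longrightarrow> b < s \<Longrightarrow> mmul t (A S x) (M x) a b = 0" "c - A \<in> null_cochains N s t m p"
   and A': "lc N (Suc p) 0 A'" "\<And>S x a b. S \<subseteq> {..<N} \<Longrightarrow> card S = Suc p \<Longrightarrow> x \<in> chart N S \<Longrightarrow>
      a < t \<Longrightarrow> b < s \<Longrightarrow> mmul t (A' S x) (M x) a b = 0" "c' - A' \<in> null_cochains N s t m p"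
    unfolding cochains_iff by blast
  have "(c + c') - (\<lambda>S x a b. A S x a b + A' S x a b) = (c - A) + (c' - A')" by (auto simp: fun_eq_iff)
  then have "(c + c') - (\<lambda>S x a b. A S x a b + A' S x a b) \<in> null_cochains N s t m p"
    using cochain.subspace_add[OF null_cochains_subspace A(3) A'(3)] by (simp only:)
  moreover have "lc N (Suc p) 0 (\<lambda>S x a b. A S x a b + A' S x a b)"
    using A(1) A'(1) unfolding lc_def by (auto intro: laurent_add)
  ultimately show "c + c' \<in> cochains N s t m p"
    unfolding cochains_iff using A(2) A'(2) by (intro exI[of _ "\<lambda>S x a b. A S x a b + A' S x a b"]) (simp add: mmul_add_left)
next
  fix k c assume "c \<in> cochains N s t m p"
  then obtain A where A: "lc N (Suc p) 0 A" "\<And>S x a b. S \<subseteq> {..<N} \<Longrightarrow> card S = Suc p \<Longrightarrow> x \<in> chart N S \<Longrightarrow>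
      a < t \<Longrightarrow> b < s \<Longrightarrow> mmul t (A S x) (M x) a b = 0" "c - A \<in> null_cochains N s t m p"
    unfolding cochains_iff by blast
  have "cochain_scale k c - cochain_scale k A = cochain_scale k (c - A)" by (simp add: cochain.scale_right_diff_distrib)
  then have "cochain_scale k c - cochain_scale k A \<in> null_cochains N s t m p"
    using cochain.subspace_scale[OF null_cochains_subspace A(3), of k] by simp
  moreover have "lc N (Suc p) 0 (cochain_scale k A)"
    using A(1) unfolding lc_def cochain_scale_def by (auto intro: laurent_scale)
  moreover have "mmul t (cochain_scale k A S x) (M x) a b = k * mmul t (A S x) (M x) a b" for S x a b
    by (simp add: mmul_def cochain_scale_def sum_distrib_left mult.assoc)
  ultimately show "cochain_scale k c \<in> cochains N s t m p"
    unfolding cochains_iff using A(2) by (intro exI[of _ "cochain_scale k A"]) simp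
qed

lemma coboundary_plus: "coboundary (c + c') = coboundary c + coboundary c'"
  by (auto simp: fun_eq_iff coboundary_cob cob_add)

lemma coboundary_minus: "coboundary (c - c') = coboundary c - coboundary c'"
  by (auto simp: fun_eq_iff coboundary_cob cob_diff)

lemma coboundary_scale: "coboundary (cochain_scale k c) = cochain_scale k (coboundary c)"
  by (auto simp: fun_eq_iff coboundary_cob cochain_scale_def cob_mult_left)

lemma coboundaries_subspace: "cochain.subspace (coboundaries N s t m p)"
proof (cases p)
  case 0 then show ?thesis by (simp add: null_cochains_subspace)
next
  case (Suc p')
  note n = null_cochains_subspace[of p] and c = cochains_subspace[of p']
  show ?thesis unfolding cochain.subspace_def Suc coboundaries.simps
  proof (intro conjI ballI allI)
    have "coboundary 0 = 0" using coboundary_minus[of 0 0] by simp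
    then show "0 \<in> {c. \<exists>e\<in>cochains N s t m p'. c - coboundary e \<in> null_cochains N s t m (Suc p')}"
      using cochain.subspace_0[OF n] cochain.subspace_0[OF c] Suc by force
  next
    fix u v assume "u \<in> {c. \<exists>e\<in>cochains N s t m p'. c - coboundary e \<in> null_cochains N s t m (Suc p')}"
      "v \<in> {c. \<exists>e\<in>cochains N s t m p'. c - coboundary e \<in> null_cochains N s t m (Suc p')}"
    then obtain e f where e: "e \<in> cochains N s t m p'" "u - coboundary e \<in> null_cochains N s t m (Suc p')"
      "f \<in> cochains N s t m p'" "v - coboundary f \<in> null_cochains N s t m (Suc p')" by blast
    have "(u + v) - coboundary (e + f) = (u - coboundary e) + (v - coboundary f)" by (simp add: coboundary_plus)
    then show "u + v \<in> {c. \<exists>e\<in>cochains N s t m p'. c - coboundary e \<in> null_cochains N s t m (Suc p')}"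
      using cochain.subspace_add[OF n[unfolded Suc] e(2,4)] cochain.subspace_add[OF c e(1,3)] by (metis (mono_tags, lifting) mem_Collect_eq)
  next
    fix k u assume "u \<in> {c. \<exists>e\<in>cochains N s t m p'. c - coboundary e \<in> null_cochains N s t m (Suc p')}"
    then obtain e where e: "e \<in> cochains N s t m p'" "u - coboundary e \<in> null_cochains N s t m (Suc p')" by blast
    have "cochain_scale k u - coboundary (cochain_scale k e) = cochain_scale k (u - coboundary e)"
      by (simp add: coboundary_scale cochain.scale_right_diff_distrib)
    then show "cochain_scale k u \<in> {c. \<exists>e\<in>cochains N s t m p'. c - coboundary e \<in> null_cochains N s t m (Suc p')}"
      using cochain.subspace_scale[OF n[unfolded Suc] e(2)] cochain.subspace_scale[OF c e(1)] by (metis (mono_tags, lifting) mem_Collect_eq)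
  qed
qed

lemma coboundary_twice: "coboundary (coboundary A) = 0"
proof (intro ext)
  fix S x a b show "coboundary (coboundary A) S x a b = 0 S x a b"
  proof (cases "finite S")
    case True then show ?thesis by (simp add: coboundary_coboundary)
  next
    case False then show ?thesis by (simp add: coboundary_def)
  qed
qed

text \<open>The last map of the complex on constant matrices; its kernel consists of the
  endomorphisms of the Kronecker module.\<close>

definition defect :: "(nat \<Rightarrow> nat \<Rightarrow> complex) \<Rightarrow> (nat \<Rightarrow> nat \<Rightarrow> complex) \<Rightarrow> morph" where
  "defect E F = (\<lambda>(i, a, b). (\<Sum>c<t. E a c * m (i, c, b)) - (\<Sum>c<s. m (i, a, c) * F c b))"

definition linear_form :: "morph \<Rightarrow> msection" where
  "linear_form g x a b = (\<Sum>i<N. x i * g (i, a, b))"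

lemma linear_form_defect:
  "linear_form (defect E F) x a b = mmul t E (M x) a b - mmul s (M x) F a b"
proof -
  have "mmul t E (M x) a b = (\<Sum>c<t. \<Sum>i<N. x i * (E a c * m (i, c, b)))"
    by (simp add: mmul_def morph_at_def sum_distrib_left mult_ac)
  also have "\<dots> = (\<Sum>i<N. x i * (\<Sum>c<t. E a c * m (i, c, b)))"
    by (subst sum.swap) (simp add: sum_distrib_left)
  finally have 1: "mmul t E (M x) a b = (\<Sum>i<N. x i * (\<Sum>c<t. E a c * m (i, c, b)))" .
  have "mmul s (M x) F a b = (\<Sum>c<s. \<Sum>i<N. x i * (m (i, a, c) * F c b))"
    by (simp add: mmul_def morph_at_def sum_distrib_right mult.assoc)
  also have "\<dots> = (\<Sum>i<N. x i * (\<Sum>c<s. m (i, a, c) * F c b))"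
    by (subst sum.swap) (simp add: sum_distrib_left)
  finally show ?thesis unfolding 1 linear_form_def defect_def
    by (simp add: right_diff_distrib sum_subtractf)
qed

lemma linear_form_eq_imp:
  assumes "\<And>x. x \<in> hcoords N \<Longrightarrow> linear_form g x a b = linear_form h x a b" "i < N"
  shows "g (i, a, b) = h (i, a, b)"
proof -
  have "unit_fun i \<in> hcoords N"
    using assms(2) by (auto simp: hcoords_def affine_space_def unit_fun_def fun_eq_iff)
  moreover have "linear_form g (unit_fun i) a b = g (i, a, b)" for g
    using assms(2) by (simp add: linear_form_def unit_fun_def if_distrib[of "\<lambda>z. z * _"] cong: if_cong)
  ultimately show ?thesis using assms(1) by metis
qed

lemma hcoords_in_chart:
  assumes "x \<in> hcoords N" obtains i where "i < N" "x \<in> chart N {i}"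
proof -
  have "\<exists>i<N. x i \<noteq> 0"
  proof (rule ccontr)
    assume n: "\<not> ?thesis"
    have "x j = 0" for j using n assms by (cases "j < N") (auto simp: hcoords_def affine_space_def)
    then have "x = 0" by auto
    then show False using assms by (simp add: hcoords_def)
  qed
  then show ?thesis using that assms by (auto simp: chart_def)
qed

lemma intertwines_iff: "intertwines N s t m E F \<longleftrightarrow> (\<forall>i<N. \<forall>a<t. \<forall>b<s. defect E F (i, a, b) = 0)"
  by (simp add: intertwines_def defect_def)

lemma intertwines_commute:
  assumes "intertwines N s t m E F" "a < t" "b < s"
  shows "mmul t E (M x) a b = mmul s (M x) F a b"
proof -
  have "linear_form (defect E F) x a b = 0"
    using assms unfolding intertwines_iff linear_form_def by simp
  then show ?thesis unfolding linear_form_defect by simp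
qed

text \<open>The pair (M C, C M) drops out of A M - M B, as the composite of the two maps of the
  complex is zero.\<close>

lemma resolve_defect:
  assumes X: "\<forall>a<t. \<forall>b<t. X a b = mmul s (M x) C a b + E a b"
    and Y: "\<forall>a<s. \<forall>b<s. Y a b = mmul t C (M x) a b + F a b" and ab: "a < t" "b < s"
  shows "mmul t E (M x) a b - mmul s (M x) F a b = mmul t X (M x) a b - mmul s (M x) Y a b"
proof -
  have "mmul t X (M x) a b = mmul t (\<lambda>a b. mmul s (M x) C a b + E a b) (M x) a b"
    using X ab by (intro mmul_cong) auto
  also have "\<dots> = mmul s (M x) (mmul t C (M x)) a b + mmul t E (M x) a b"
    by (simp add: mmul_add_left mmul_assoc[symmetric])
  finally have 1: "mmul t X (M x) a b = \<dots>" .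
  have "mmul s (M x) Y a b = mmul s (M x) (\<lambda>a b. mmul t C (M x) a b + F a b) a b"
    using Y ab by (intro mmul_cong) auto
  also have "\<dots> = mmul s (M x) (mmul t C (M x)) a b + mmul s (M x) F a b" by (simp add: mmul_add_right)
  finally show ?thesis using 1 by simp
qed

section \<open>Cocycles of degree 0\<close>

lemma global_const:
  assumes E: "lc N 0 0 E"
  shows "\<exists>E0. \<forall>x\<in>hcoords N. \<forall>a b. E {} x a b = E0 a b"
proof -
  have "\<forall>ab. \<exists>k. \<forall>x\<in>hcoords N. E {} x (fst ab) (snd ab) = k"
    using laurent_global_const[OF lcD[OF E, of "{}"]] by simp
  from choice[OF this] obtain k where k: "\<forall>ab. \<forall>x\<in>hcoords N. E {} x (fst ab) (snd ab) = k ab" ..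
  show ?thesis
  proof (intro exI ballI allI)
    fix x a b assume "x \<in> hcoords N"
    then show "E {} x a b = (\<lambda>a b. k (a, b)) a b" using k[rule_format, of x "(a, b)"] by simp
  qed
qed

lemma lc_const: "lc N k 0 (\<lambda>S x. E)"
  unfolding lc_def by (simp add: laurent_const)

lemma const_cocycle:
  assumes "intertwines N s t m E F" shows "(\<lambda>S x. E) \<in> cocycles N s t m 0"
  unfolding cocycles_def
proof (intro CollectI conjI)
  show "(\<lambda>S x. E) \<in> cochains N s t m 0"
    by (rule cochainsI[OF lc_const, where B = "\<lambda>S x. F"]) (rule intertwines_commute[OF assms])
  show "coboundary (\<lambda>S x. E) \<in> null_cochains N s t m (Suc 0)"
    unfolding null_cochains_iff
    by (auto intro!: factorsI[where C = "\<lambda>_ _. 0"] simp: mmul_def coboundary_constant)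
qed

text \<open>The normal form A, for which A M = 0, enters \<open>resolve\<close> as the pair (A, 0).
  Up to null cochains the cocycle becomes the coboundary of a Laurent cochain E on sets of one
  element less, and the defect of (E, F) becomes a cocycle.\<close>

lemma cocycle_resolve:
  assumes z: "z \<in> cocycles N s t m p"
  shows "\<exists>A C E F. z - A \<in> null_cochains N s t m p \<and> lc N (Suc p) (- 1) C \<and> lc N p 0 E \<and> lc N p 0 F \<and>
    (\<forall>S x. S \<subseteq> {..<N} \<longrightarrow> card S = Suc p \<longrightarrow> x \<in> chart N S \<longrightarrow>
      (\<forall>a<t. \<forall>b<t. A S x a b = mmul s (M x) (C S x) a b + coboundary E S x a b) \<and>
      (\<forall>a<t. \<forall>b<s. mmul t (coboundary E S x) (M x) a b = mmul s (M x) (coboundary F S x) a b))"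
proof -
  have zc: "z \<in> cochains N s t m p" and zn: "coboundary z \<in> null_cochains N s t m (Suc p)"
    using z unfolding cocycles_def by auto
  obtain A where A: "lc N (Suc p) 0 A" "z - A \<in> null_cochains N s t m p"
    and AM: "\<And>S x a b. S \<subseteq> {..<N} \<Longrightarrow> card S = Suc p \<Longrightarrow> x \<in> chart N S \<Longrightarrow> a < t \<Longrightarrow> b < s \<Longrightarrow>
      mmul t (A S x) (M x) a b = 0" using zc unfolding cochains_iff by blast
  have "coboundary A = coboundary z - coboundary (z - A)" by (simp add: coboundary_minus)
  then have An: "coboundary A \<in> null_cochains N s t m (Suc p)"
    using cochain.subspace_diff[OF null_cochains_subspace zn null_cochains_coboundary[OF A(2)]] by (simp only:)
  have "\<exists>C E F. lc N (Suc p) (- 1) C \<and> lc N p 0 E \<and> lc N p 0 F \<and>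
    (\<forall>S x. S \<subseteq> {..<N} \<longrightarrow> card S = Suc p \<longrightarrow> x \<in> chart N S \<longrightarrow>
      (\<forall>a<t. \<forall>b<t. A S x a b = mmul s (M x) (C S x) a b + coboundary E S x a b) \<and>
      (\<forall>a<s. \<forall>b<s. (\<lambda>S x a b. 0) S x a b = mmul t (C S x) (M x) a b + coboundary F S x a b))"
  proof (rule resolve[OF A(1) lc_zero])
    show "factors x t (coboundary A S x)"
      if "S \<subseteq> {..<N}" "card S = Suc (Suc p)" "x \<in> chart N S" for S x
      using An that unfolding null_cochains_iff by blast
  next
    fix S x a b assume S: "S \<subseteq> {..<N}" "card S = Suc (Suc p)" and x: "x \<in> chart N S" and ab: "a < t" "b < s"
    have "mmul t (coboundary A S x) (M x) a b = coboundary (\<lambda>S x. mmul t (A S x) (M x)) S x a b"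
      by (rule coboundary_mmul_right[symmetric])
    also have "\<dots> = coboundary (\<lambda>S x a b. 0) S x a b"
    proof (rule coboundary_cong)
      fix i assume "i \<in> S"
      then show "mmul t (A (S - {i}) x) (M x) a b = 0" using S x ab by (intro AM) (auto simp: chart_def)
    qed
    finally show "mmul t (coboundary A S x) (M x) a b = mmul s (M x) (coboundary (\<lambda>S x a b. 0) S x) a b"
      by (simp add: coboundary_def mmul_def)
  qed
  then obtain C E F where CEF: "lc N (Suc p) (- 1) C" "lc N p 0 E" "lc N p 0 F"
    and r: "\<And>S x. S \<subseteq> {..<N} \<Longrightarrow> card S = Suc p \<Longrightarrow> x \<in> chart N S \<Longrightarrow>
      (\<forall>a<t. \<forall>b<t. A S x a b = mmul s (M x) (C S x) a b + coboundary E S x a b) \<and>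
      (\<forall>a<s. \<forall>b<s. 0 = mmul t (C S x) (M x) a b + coboundary F S x a b)"
    by auto
  have "mmul t (coboundary E S x) (M x) a b = mmul s (M x) (coboundary F S x) a b"
    if S: "S \<subseteq> {..<N}" "card S = Suc p" "x \<in> chart N S" and ab: "a < t" "b < s" for S x a b
    using resolve_defect[OF conjunct1[OF r[OF S]] conjunct2[OF r[OF S]] ab] AM[OF S ab] by (simp add: mmul_def)
  note EF = this
  show ?thesis
  proof (rule exI[of _ A], rule exI[of _ C], rule exI[of _ E], rule exI[of _ F], intro conjI A(2) CEF)
    show "\<forall>S x. S \<subseteq> {..<N} \<longrightarrow> card S = Suc p \<longrightarrow> x \<in> chart N S \<longrightarrow>
      (\<forall>a<t. \<forall>b<t. A S x a b = mmul s (M x) (C S x) a b + coboundary E S x a b) \<and>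
      (\<forall>a<t. \<forall>b<s. mmul t (coboundary E S x) (M x) a b = mmul s (M x) (coboundary F S x) a b)"
      using r EF by simp
  qed
qed

lemma null_of_resolve:
  assumes "z - A \<in> null_cochains N s t m p"
    and "\<And>S x a b. S \<subseteq> {..<N} \<Longrightarrow> card S = Suc p \<Longrightarrow> x \<in> chart N S \<Longrightarrow> a < t \<Longrightarrow> b < t \<Longrightarrow>
      A S x a b = mmul s (M x) (C S x) a b + D S x a b"
  shows "z - D \<in> null_cochains N s t m p"
  unfolding null_cochains_iff
proof (intro allI impI)
  fix S x assume S: "S \<subseteq> {..<N}" "card S = Suc p" "x \<in> chart N S"
  have 1: "factors x t ((z - A) S x)" using assms(1) S unfolding null_cochains_iff by blast
  have 2: "factors x t (mmul s (M x) (C S x))" by (rule factorsI) simp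
  show "factors x t ((z - D) S x)"
    using factors_add[OF 1 2] by (rule factors_cong) (simp add: assms(2)[OF S])
qed

text \<open>Here E and F live at the empty set, where Laurent polynomials of degree 0 are
  constants.\<close>

lemma cocycle_0_constant:
  assumes z: "z \<in> cocycles N s t m 0"
  shows "\<exists>E F. intertwines N s t m E F \<and> z - (\<lambda>S x. E) \<in> null_cochains N s t m 0"
proof -
  obtain A C E F where A: "z - A \<in> null_cochains N s t m 0" and "lc N (Suc 0) (- 1) C"
    and E: "lc N 0 0 E" and F: "lc N 0 0 F"
    and r0: "\<forall>S x. S \<subseteq> {..<N} \<longrightarrow> card S = Suc 0 \<longrightarrow> x \<in> chart N S \<longrightarrow>
      (\<forall>a<t. \<forall>b<t. A S x a b = mmul s (M x) (C S x) a b + coboundary E S x a b) \<and>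
      (\<forall>a<t. \<forall>b<s. mmul t (coboundary E S x) (M x) a b = mmul s (M x) (coboundary F S x) a b)"
    using cocycle_resolve[OF z] by (elim exE conjE) rule
  note r = r0[THEN spec, THEN spec, THEN mp, THEN mp, THEN mp]
  obtain E0 where E0: "\<forall>x\<in>hcoords N. \<forall>a b. E {} x a b = E0 a b" using global_const[OF E] by blast
  obtain F0 where F0: "\<forall>x\<in>hcoords N. \<forall>a b. F {} x a b = F0 a b" using global_const[OF F] by blast
  have cE: "coboundary E S x = E0" "coboundary F S x = F0" if S: "card S = Suc 0" "x \<in> chart N S" for S x
  proof -
    obtain i where "S = {i}" using S card_1_singletonE by (metis One_nat_def)
    then show "coboundary E S x = E0" "coboundary F S x = F0"
      using E0 F0 chart_hcoords[OF S(2)] by (auto simp: fun_eq_iff coboundary_singleton)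
  qed
  have "intertwines N s t m E0 F0" unfolding intertwines_iff
  proof (intro allI impI)
    fix i a b assume ab: "i < N" "a < t" "b < s"
    have "defect E0 F0 (i, a, b) = (\<lambda>_. 0) (i, a, b)"
    proof (rule linear_form_eq_imp[OF _ ab(1)])
      fix x assume "x \<in> hcoords N"
      then obtain i where i: "i < N" "x \<in> chart N {i}" by (rule hcoords_in_chart)
      then show "linear_form (defect E0 F0) x a b = linear_form (\<lambda>_. 0) x a b"
        using r[of "{i}" x] ab cE[of "{i}" x] by (simp add: linear_form_defect, simp add: linear_form_def)
    qed
    then show "defect E0 F0 (i, a, b) = 0" by simp
  qed
  moreover have "z - (\<lambda>S x. E0) \<in> null_cochains N s t m 0"
    by (rule null_of_resolve[OF A, where C = C]) (use r cE in auto)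
  ultimately show ?thesis by blast
qed

text \<open>Being null, E equals M D with D a matrix of global sections of O(-1), hence E = 0. Then
  M F = E M = 0, and M cancels.\<close>

lemma const_null_imp_zero:
  assumes i: "intertwines N s t m E F" and n: "(\<lambda>S x. E) \<in> null_cochains N s t m 0"
  shows "(\<forall>a<t. \<forall>b<t. E a b = 0) \<and> (\<forall>a<s. \<forall>b<s. F a b = 0)"
proof -
  obtain D where D: "lc N 0 (- 1) D"
    and ED: "\<forall>S x a b. S \<subseteq> {..<N} \<longrightarrow> card S = Suc 0 \<longrightarrow> x \<in> chart N S \<longrightarrow> a < t \<longrightarrow> b < t \<longrightarrow>
      E a b = mmul s (M x) (coboundary D S x) a b"
    using null_cocycle[of 0 "\<lambda>S x. E", OF lc_const] n coboundary_constant
    unfolding null_cochains_iff by auto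
  define x :: "nat \<Rightarrow> complex" where "x = unit_fun 0"
  have S: "{0} \<subseteq> {..<N}" "card {0::nat} = Suc 0" using N by auto
  have x: "x \<in> chart N {0}"
    using N by (auto simp: x_def chart_def hcoords_def affine_space_def unit_fun_def fun_eq_iff)
  have "coboundary D {0} x a b = 0" for a b
    using laurent_global_neg[OF lcD[OF D, of "{}"]] chart_hcoords[OF x] by (simp add: coboundary_singleton)
  then have E0: "E a b = 0" if "a < t" "b < t" for a b
    using ED[rule_format, OF S x that] by (simp add: mmul_def)
  have "F a b = (\<lambda>_ _. 0) a b" if "a < s" "b < s" for a b
  proof (rule M_cancel[OF chart_hcoords[OF x] _ that(1)])
    fix a' assume "a' < t"
    then show "mmul s (M x) F a' b = mmul s (M x) (\<lambda>_ _. 0) a' b"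
      using intertwines_commute[OF i _ that(2), of a' x] E0 by (simp add: mmul_def)
  qed
  then show ?thesis using E0 by simp
qed

text \<open>The connecting map from matrices of linear forms to H^1: over each chart g lifts to g L,
  because (g L) M = g, and the coboundary measures how the lifts differ.\<close>

definition connecting :: "morph \<Rightarrow> cochain" where
  "connecting g = coboundary (\<lambda>S x. mmul s (linear_form g x) (Linv S x))"

lemma lc_mmul_Linv:
  assumes G: "lc N (Suc p) 1 G" shows "lc N (Suc p) 0 (\<lambda>S x. mmul s (G S x) (Linv S x))"
proof (rule lcI)
  fix S a b assume S: "S \<subseteq> {..<N}" "card S = Suc p"
  then have "S \<noteq> {}" by auto
  then show "(\<lambda>x. mmul s (G S x) (Linv S x) a b) \<in> laurent N S 0"
    using laurent_mult[OF lcD[OF G S] Linv(1)[OF S(1)]] unfolding mmul_def by (intro laurent_sum) simp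
qed

lemma lc_linear_form: "lc N k 1 (\<lambda>S x. linear_form g x)"
  unfolding linear_form_def
  using laurent_mult[OF laurent_coord laurent_const] by (fastforce intro!: lcI laurent_sum)

lemma mmul_Linv_M:
  assumes "S \<subseteq> {..<N}" "card S = Suc p" "x \<in> chart N S" "b < s"
  shows "mmul t (mmul s G (Linv S x)) (M x) a b = G a b"
  using mmul_Linv[OF assms(1) card_nonempty[OF assms(2)] assms(3,4)] by (simp add: mmul_assoc)

lemma connecting_mmul_M:
  assumes S: "S \<subseteq> {..<N}" "card S = 2" and x: "x \<in> chart N S" and b: "b < s"
  shows "mmul t (connecting g S x) (M x) a b = 0"
proof -
  have "mmul t (connecting g S x) (M x) a b
      = coboundary (\<lambda>S x. mmul t (mmul s (linear_form g x) (Linv S x)) (M x)) S x a b"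
    unfolding connecting_def by (rule coboundary_mmul_right[symmetric])
  also have "\<dots> = coboundary (\<lambda>S. linear_form g) S x a b"
  proof (rule coboundary_cong, rule mmul_Linv_M[OF _ _ _ b])
    fix i assume "i \<in> S"
    then show "S - {i} \<subseteq> {..<N}" "card (S - {i}) = Suc 0" "x \<in> chart N (S - {i})"
      using S x by (auto simp: chart_def)
  qed
  also have "\<dots> = 0" by (rule coboundary_constant[OF S(2)])
  finally show ?thesis .
qed

lemma connecting_cocycle: "connecting g \<in> cocycles N s t m (Suc 0)"
  unfolding cocycles_def
proof (intro CollectI conjI)
  show "connecting g \<in> cochains N s t m (Suc 0)"
  proof (rule cochainsI[where B = "\<lambda>S x a b. 0"])
    show "lc N (Suc (Suc 0)) 0 (connecting g)"
      unfolding connecting_def by (intro lc_coboundary lc_mmul_Linv lc_linear_form)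
  qed (simp add: connecting_mmul_M mmul_def[of s])
  show "coboundary (connecting g) \<in> null_cochains N s t m (Suc (Suc 0))"
    unfolding connecting_def coboundary_twice by (rule cochain.subspace_0[OF null_cochains_subspace])
qed

text \<open>For g = E M - M F the lift g L can be changed to g L - E, whose product with M is -M F,
  so that it preserves the image of M. Subtracting the constant E leaves the coboundary
  unchanged.\<close>

lemma connecting_defect:
  assumes g: "\<And>i a b. i < N \<Longrightarrow> a < t \<Longrightarrow> b < s \<Longrightarrow> g (i, a, b) = defect E F (i, a, b)"
  shows "connecting g \<in> coboundaries N s t m (Suc 0)"
proof -
  define e :: cochain where "e S x a b = mmul s (linear_form g x) (Linv S x) a b - E a b" for S x a b
  have gd: "linear_form g x a b = mmul t E (M x) a b - mmul s (M x) F a b" if "a < t" "b < s" for x a b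
    unfolding linear_form_defect[symmetric] using g that by (simp add: linear_form_def)
  have "e \<in> cochains N s t m 0"
  proof (rule cochainsI[where B = "\<lambda>S x a b. - F a b"])
    show "lc N (Suc 0) 0 e" unfolding e_def by (intro lc_diff lc_mmul_Linv lc_linear_form lc_const)
    fix S x a b assume S: "S \<subseteq> {..<N}" "card S = Suc 0" "x \<in> chart N S" and ab: "a < t" "b < s"
    have "mmul t (e S x) (M x) a b = linear_form g x a b - mmul t E (M x) a b"
      unfolding e_def by (simp add: mmul_diff_left mmul_Linv_M[OF S ab(2)])
    also have "\<dots> = mmul s (M x) (\<lambda>a b. - F a b) a b" using gd[OF ab] by (simp add: mmul_def sum_negf)
    finally show "mmul t (e S x) (M x) a b = mmul s (M x) (\<lambda>a b. - F a b) a b" .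
  qed
  moreover have "connecting g - coboundary e \<in> null_cochains N s t m (Suc 0)"
    unfolding null_cochains_iff
  proof (intro allI impI)
    fix S x assume S: "S \<subseteq> {..<N}" "card S = Suc (Suc 0)" "x \<in> chart N S"
    have "coboundary e S x a b = connecting g S x a b" for a b
      unfolding e_def coboundary_diff using coboundary_constant[of S "\<lambda>x. E" x a b] S
      by (simp add: connecting_def)
    then show "factors x t ((connecting g - coboundary e) S x)"
      by (intro factorsI[where C = "\<lambda>_ _. 0"]) (simp add: mmul_def)
  qed
  ultimately show ?thesis by auto
qed

text \<open>Subtracting the normal form A of a bounding cochain from g L leaves X with X M = g and
  null coboundary. Resolving (X, 0) produces constants E0 and F0, and the defect of (E0, F0) is that
  of (X, 0), which is g.\<close>

lemma connecting_coboundary_imp_defect: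
  assumes "connecting g \<in> coboundaries N s t m (Suc 0)"
  shows "\<exists>E F. \<forall>i<N. \<forall>a<t. \<forall>b<s. g (i, a, b) = defect E F (i, a, b)"
proof -
  obtain e where e: "e \<in> cochains N s t m 0" "connecting g - coboundary e \<in> null_cochains N s t m (Suc 0)"
    using assms by auto
  obtain A where A: "lc N (Suc 0) 0 A" "e - A \<in> null_cochains N s t m 0"
    and AM: "\<And>S x a b. S \<subseteq> {..<N} \<Longrightarrow> card S = Suc 0 \<Longrightarrow> x \<in> chart N S \<Longrightarrow> a < t \<Longrightarrow> b < s \<Longrightarrow>
      mmul t (A S x) (M x) a b = 0" using e(1) unfolding cochains_iff by blast
  define H :: cochain where "H S x = mmul s (linear_form g x) (Linv S x)" for S x
  define X where "X = H - A"
  have Xlc: "lc N (Suc 0) 0 X"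
    using lc_diff[OF lc_mmul_Linv[OF lc_linear_form] A(1), of g] unfolding X_def H_def by (simp add: fun_diff_def)
  have XM: "mmul t (X S x) (M x) a b = linear_form g x a b"
    if S: "S \<subseteq> {..<N}" "card S = Suc 0" "x \<in> chart N S" and ab: "a < t" "b < s" for S x a b
    using AM[OF S ab] mmul_Linv_M[OF S ab(2)] by (simp add: X_def H_def fun_diff_def mmul_diff_left)
  have "H = (\<lambda>S x. mmul s (linear_form g x) (Linv S x))" by (intro ext) (simp add: H_def)
  then have "coboundary X = (connecting g - coboundary e) + coboundary (e - A)"
    by (simp add: X_def connecting_def coboundary_minus)
  then have Xn: "coboundary X \<in> null_cochains N s t m (Suc 0)"
    using cochain.subspace_add[OF null_cochains_subspace e(2) null_cochains_coboundary[OF A(2)]] by (simp only:)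
  have "\<exists>C E F. lc N (Suc 0) (- 1) C \<and> lc N 0 0 E \<and> lc N 0 0 F \<and>
    (\<forall>S x. S \<subseteq> {..<N} \<longrightarrow> card S = Suc 0 \<longrightarrow> x \<in> chart N S \<longrightarrow>
      (\<forall>a<t. \<forall>b<t. X S x a b = mmul s (M x) (C S x) a b + coboundary E S x a b) \<and>
      (\<forall>a<s. \<forall>b<s. (\<lambda>S x a b. 0) S x a b = mmul t (C S x) (M x) a b + coboundary F S x a b))"
  proof (rule resolve[OF Xlc lc_zero])
    show "factors x t (coboundary X S x)"
      if "S \<subseteq> {..<N}" "card S = Suc (Suc 0)" "x \<in> chart N S" for S x
      using Xn that unfolding null_cochains_iff by blast
  next
    fix S x a b assume S: "S \<subseteq> {..<N}" "card S = Suc (Suc 0)" and x: "x \<in> chart N S" and ab: "a < t" "b < s"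
    have "mmul t (coboundary X S x) (M x) a b = coboundary (\<lambda>S x. mmul t (X S x) (M x)) S x a b"
      by (rule coboundary_mmul_right[symmetric])
    also have "\<dots> = coboundary (\<lambda>S. linear_form g) S x a b"
    proof (rule coboundary_cong)
      fix i assume "i \<in> S"
      then show "mmul t (X (S - {i}) x) (M x) a b = linear_form g x a b"
        using S x ab by (intro XM) (auto simp: chart_def)
    qed
    also have "\<dots> = 0" using S by (intro coboundary_constant) simp
    finally show "mmul t (coboundary X S x) (M x) a b = mmul s (M x) (coboundary (\<lambda>S x a b. 0) S x) a b"
      by (simp add: coboundary_def mmul_def)
  qed
  then obtain C E F where "lc N (Suc 0) (- 1) C" and E: "lc N 0 0 E" and F: "lc N 0 0 F"
    and r0: "\<forall>S x. S \<subseteq> {..<N} \<longrightarrow> card S = Suc 0 \<longrightarrow> x \<in> chart N S \<longrightarrow>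
      (\<forall>a<t. \<forall>b<t. X S x a b = mmul s (M x) (C S x) a b + coboundary E S x a b) \<and>
      (\<forall>a<s. \<forall>b<s. (\<lambda>S x a b. 0) S x a b = mmul t (C S x) (M x) a b + coboundary F S x a b)"
    by (elim exE conjE) rule
  note r = r0[THEN spec, THEN spec, THEN mp, THEN mp, THEN mp]
  obtain E0 where E0: "\<forall>x\<in>hcoords N. \<forall>a b. E {} x a b = E0 a b" using global_const[OF E] by blast
  obtain F0 where F0: "\<forall>x\<in>hcoords N. \<forall>a b. F {} x a b = F0 a b" using global_const[OF F] by blast
  have "g (i, a, b) = defect E0 F0 (i, a, b)" if i: "i < N" and ab: "a < t" "b < s" for i a b
  proof (rule linear_form_eq_imp[OF _ i])
    fix x assume x: "x \<in> hcoords N"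
    then obtain i where i: "i < N" "x \<in> chart N {i}" by (rule hcoords_in_chart)
    have S: "{i} \<subseteq> {..<N}" "card {i} = Suc 0" using i by auto
    have c: "coboundary E {i} x = E0" "coboundary F {i} x = F0"
      using E0 F0 x by (auto simp: fun_eq_iff coboundary_singleton)
    show "linear_form g x a b = linear_form (defect E0 F0) x a b"
      using resolve_defect[OF conjunct1[OF r[OF S i(2)]] conjunct2[OF r[OF S i(2)]] ab] XM[OF S i(2) ab]
      unfolding linear_form_defect c by (simp add: mmul_def)
  qed
  then show ?thesis by blast
qed

text \<open>Dimension shift: resolving z gives (E, F) whose defect E M - M F is a cocycle of O(1),
  hence the coboundary of some G. If H M is the coboundary of G, then E - H is an honest cochain of
  End E, so z is cohomologous to the coboundary of H. The lift H is left open because it is chosen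
  differently in degree 1 and above.\<close>

lemma cocycle_Suc_coboundary:
  assumes z: "z \<in> cocycles N s t m (Suc p)"
  shows "\<exists>G. lc N p 1 G \<and> (\<forall>H. lc N (Suc p) 0 H \<longrightarrow>
    (\<forall>S x a b. S \<subseteq> {..<N} \<longrightarrow> card S = Suc p \<longrightarrow> x \<in> chart N S \<longrightarrow> a < t \<longrightarrow> b < s \<longrightarrow>
      mmul t (H S x) (M x) a b = coboundary G S x a b) \<longrightarrow>
    z - coboundary H \<in> coboundaries N s t m (Suc p))"
proof -
  have N2: "N \<ge> 2" using N by simp
  obtain A C E F where A: "z - A \<in> null_cochains N s t m (Suc p)" and "lc N (Suc (Suc p)) (- 1) C"
    and E: "lc N (Suc p) 0 E" and F: "lc N (Suc p) 0 F"
    and r0: "\<forall>S x. S \<subseteq> {..<N} \<longrightarrow> card S = Suc (Suc p) \<longrightarrow> x \<in> chart N S \<longrightarrow>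
      (\<forall>a<t. \<forall>b<t. A S x a b = mmul s (M x) (C S x) a b + coboundary E S x a b) \<and>
      (\<forall>a<t. \<forall>b<s. mmul t (coboundary E S x) (M x) a b = mmul s (M x) (coboundary F S x) a b)"
    using cocycle_resolve[OF z] by (elim exE conjE) rule
  note r = r0[THEN spec, THEN spec, THEN mp, THEN mp, THEN mp]
  have EM: "lc N (Suc p) 1 (\<lambda>S x. mmul t (E S x) (M x))"
    using lc_mmul_right[where B = M and e = 1 and n = t, OF E M_global] by simp
  have MF: "lc N (Suc p) 1 (\<lambda>S x. mmul s (M x) (F S x))"
    using lc_mmul_left[where B = M and e = 1 and n = s, OF F M_global] by simp
  have "\<exists>G. lc N p 1 G \<and> (\<forall>S x a b. S \<subseteq> {..<N} \<longrightarrow> card S = Suc p \<longrightarrow> x \<in> chart N S \<longrightarrow>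
      a < t \<longrightarrow> b < s \<longrightarrow> mmul t (E S x) (M x) a b - mmul s (M x) (F S x) a b = coboundary G S x a b)"
  proof (rule laurent_cech_exact_matrix[OF N2 _ lc_diff[OF EM MF]])
    show "coboundary (\<lambda>S x a b. mmul t (E S x) (M x) a b - mmul s (M x) (F S x) a b) S x a b = 0"
      if "S \<subseteq> {..<N}" "card S = Suc (Suc p)" "x \<in> chart N S" "a < t" "b < s" for S x a b
      using r[OF that(1-3)] that(4,5) by (simp add: coboundary_diff coboundary_mmul_left coboundary_mmul_right)
  qed simp
  then obtain G where G: "lc N p 1 G" and G1: "\<forall>S x a b. S \<subseteq> {..<N} \<longrightarrow> card S = Suc p \<longrightarrow> x \<in> chart N S \<longrightarrow>
      a < t \<longrightarrow> b < s \<longrightarrow> mmul t (E S x) (M x) a b - mmul s (M x) (F S x) a b = coboundary G S x a b"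
    by (elim exE conjE) rule
  have "z - coboundary H \<in> coboundaries N s t m (Suc p)"
    if H: "lc N (Suc p) 0 H" and HM: "\<forall>S x a b. S \<subseteq> {..<N} \<longrightarrow> card S = Suc p \<longrightarrow> x \<in> chart N S \<longrightarrow>
      a < t \<longrightarrow> b < s \<longrightarrow> mmul t (H S x) (M x) a b = coboundary G S x a b" for H
  proof -
    have "(\<lambda>S x a b. E S x a b - H S x a b) \<in> cochains N s t m p"
    proof (rule cochainsI[OF lc_diff[OF E H], where B = F])
      fix S x a b assume S: "S \<subseteq> {..<N}" "card S = Suc p" "x \<in> chart N S" and ab: "a < t" "b < s"
      have "mmul t (H S x) (M x) a b = coboundary G S x a b" using HM S ab by blast
      then show "mmul t (\<lambda>a b. E S x a b - H S x a b) (M x) a b = mmul s (M x) (F S x) a b"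
        using G1[rule_format, OF S ab] by (simp add: mmul_diff_left algebra_simps)
    qed
    then have "E - H \<in> cochains N s t m p" by (simp add: fun_diff_def)
    moreover have "z - coboundary E \<in> null_cochains N s t m (Suc p)"
      by (rule null_of_resolve[OF A, where C = C]) (use conjunct1[OF r] in simp)
    then have "z - coboundary H - coboundary (E - H) \<in> null_cochains N s t m (Suc p)"
      by (simp add: coboundary_minus)
    ultimately show ?thesis by auto
  qed
  then show ?thesis by (intro exI[of _ G] conjI G allI impI)
qed

text \<open>In degree 1 the cochain G lives at the empty set and consists of linear forms g; the
  lift is g L.\<close>

lemma cocycle_1_connecting:
  assumes z: "z \<in> cocycles N s t m (Suc 0)"
  shows "\<exists>g. z - connecting g \<in> coboundaries N s t m (Suc 0)"
proof -
  obtain G where G: "lc N 0 1 G" and r0: "\<forall>H. lc N (Suc 0) 0 H \<longrightarrow>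
    (\<forall>S x a b. S \<subseteq> {..<N} \<longrightarrow> card S = Suc 0 \<longrightarrow> x \<in> chart N S \<longrightarrow> a < t \<longrightarrow> b < s \<longrightarrow>
      mmul t (H S x) (M x) a b = coboundary G S x a b) \<longrightarrow>
    z - coboundary H \<in> coboundaries N s t m (Suc 0)"
    using cocycle_Suc_coboundary[OF z] by (elim exE conjE) rule
  note r = r0[THEN spec, THEN mp, THEN mp]
  have "\<forall>ab. \<exists>u. \<forall>x\<in>hcoords N. G {} x (fst ab) (snd ab) = (\<Sum>i<N. x i * u i)"
    using laurent_global_linear[OF lcD[OF G, of "{}"]] by simp
  from choice[OF this] obtain u
    where u: "\<forall>ab. \<forall>x\<in>hcoords N. G {} x (fst ab) (snd ab) = (\<Sum>i<N. x i * u ab i)" ..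
  define g :: morph where "g = (\<lambda>(i, a, b). u (a, b) i)"
  have g: "G {} x a b = linear_form g x a b" if "x \<in> hcoords N" for x a b
    using u[rule_format, of x "(a, b)"] that by (simp add: g_def linear_form_def)
  have "z - connecting g \<in> coboundaries N s t m (Suc 0)" unfolding connecting_def
  proof (intro r lc_mmul_Linv lc_linear_form allI impI)
    fix S x a b assume S: "S \<subseteq> {..<N}" "card S = Suc 0" "x \<in> chart N S" and ab: "a < t" "b < s"
    obtain i where i: "S = {i}" using S(2) card_1_singletonE by (metis One_nat_def)
    show "mmul t (mmul s (linear_form g x) (Linv S x)) (M x) a b = coboundary G S x a b"
      using mmul_Linv_M[OF S ab(2)] g[OF chart_hcoords[OF S(3)]] by (simp add: i coboundary_singleton)
  qed
  then show ?thesis by blast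
qed

lemma cocycle_ge_2_coboundary:
  assumes z: "z \<in> cocycles N s t m (Suc (Suc p))"
  shows "z \<in> coboundaries N s t m (Suc (Suc p))"
proof -
  obtain G where G: "lc N (Suc p) 1 G" and r0: "\<forall>H. lc N (Suc (Suc p)) 0 H \<longrightarrow>
    (\<forall>S x a b. S \<subseteq> {..<N} \<longrightarrow> card S = Suc (Suc p) \<longrightarrow> x \<in> chart N S \<longrightarrow> a < t \<longrightarrow> b < s \<longrightarrow>
      mmul t (H S x) (M x) a b = coboundary G S x a b) \<longrightarrow>
    z - coboundary H \<in> coboundaries N s t m (Suc (Suc p))"
    using cocycle_Suc_coboundary[OF z] by (elim exE conjE) rule
  note r = r0[THEN spec, THEN mp, THEN mp]
  \<comment> \<open>G now lives on nonempty sets, where G L is defined; its coboundary is a lift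
    whose own coboundary vanishes.\<close>
  define H where "H = coboundary (\<lambda>S x. mmul s (G S x) (Linv S x))"
  have "z - coboundary H \<in> coboundaries N s t m (Suc (Suc p))"
  proof (rule r)
    show "lc N (Suc (Suc p)) 0 H" unfolding H_def by (intro lc_coboundary lc_mmul_Linv G)
    show "\<forall>S x a b. S \<subseteq> {..<N} \<longrightarrow> card S = Suc (Suc p) \<longrightarrow> x \<in> chart N S \<longrightarrow> a < t \<longrightarrow> b < s \<longrightarrow>
      mmul t (H S x) (M x) a b = coboundary G S x a b"
    proof (intro allI impI)
      fix S x a b assume S: "S \<subseteq> {..<N}" "card S = Suc (Suc p)" "x \<in> chart N S" and ab: "a < t" "b < s"
      have "mmul t (H S x) (M x) a b = coboundary (\<lambda>S x. mmul t (mmul s (G S x) (Linv S x)) (M x)) S x a b"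
        unfolding H_def by (rule coboundary_mmul_right[symmetric])
      also have "\<dots> = coboundary G S x a b"
      proof (rule coboundary_cong, rule mmul_Linv_M[OF _ _ _ ab(2)])
        fix i assume "i \<in> S"
        then show "S - {i} \<subseteq> {..<N}" "card (S - {i}) = Suc p" "x \<in> chart N (S - {i})"
          using S by (auto simp: chart_def)
      qed
      finally show "mmul t (H S x) (M x) a b = coboundary G S x a b" .
    qed
  qed
  then show ?thesis unfolding H_def coboundary_twice by simp
qed

end

section \<open>Dimensions\<close>

lemma fv_independent_disjoint:
  assumes AB: "fv.independent (A \<union> B)" "finite A" "finite B" "A \<inter> B = {}"
    and x: "x \<in> fv.span A" "x \<in> fv.span B"
  shows "x = 0"
proof -
  obtain u where u: "x = (\<Sum>v\<in>A. fscale (u v) v)" using x(1) unfolding fv.span_finite[OF AB(2)] by auto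
  obtain w where w: "x = (\<Sum>v\<in>B. fscale (w v) v)" using x(2) unfolding fv.span_finite[OF AB(3)] by auto
  have "(\<Sum>v\<in>A \<union> B. fscale (if v \<in> A then u v else - w v) v)
      = (\<Sum>v\<in>A. fscale (if v \<in> A then u v else - w v) v) + (\<Sum>v\<in>B. fscale (if v \<in> A then u v else - w v) v)"
    by (rule sum.union_disjoint[OF AB(2-4)])
  also have "(\<Sum>v\<in>A. fscale (if v \<in> A then u v else - w v) v) = x" unfolding u by (intro sum.cong) auto
  also have "(\<Sum>v\<in>B. fscale (if v \<in> A then u v else - w v) v) = (\<Sum>v\<in>B. - fscale (w v) v)"
    using AB(4) by (intro sum.cong) (auto simp: fv.scale_minus_left)
  also have "\<dots> = - x" unfolding w by (simp add: sum_negf)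
  also have "x + - x = 0" by (rule right_minus)
  finally have "(\<Sum>v\<in>A \<union> B. fscale (if v \<in> A then u v else - w v) v) = 0" .
  then have "\<forall>v\<in>A. u v = 0"
    using fv.independentD[OF AB(1), of "A \<union> B" "\<lambda>v. if v \<in> A then u v else - w v"] AB(2,3) by fastforce
  then show ?thesis unfolding u by (intro sum.neutral ballI) (simp only: fv.scale_zero_left)
qed

lemma affine_space_outside: "v \<in> affine_space I \<Longrightarrow> i \<notin> I \<Longrightarrow> v i = 0"
  by (simp add: affine_space_def)

text \<open>Rank and nullity with explicit bases: a complement of the kernel is mapped injectively,
  and \<open>bw\<close> completes its image to a basis of the target, so it represents the
  cokernel.\<close>

lemma kernel_cokernel:
  fixes D :: "('i \<Rightarrow> complex) \<Rightarrow> ('j \<Rightarrow> complex)"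
  assumes add: "\<And>u v. D (u + v) = D u + D v" and scale: "\<And>k v. D (fscale k v) = fscale k (D v)"
    and J: "finite J" and K: "finite K" and D: "\<And>v. D v \<in> affine_space K"
  shows "\<exists>bk bw. finite bk \<and> fv.independent bk \<and> fv.span bk = {v \<in> affine_space J. D v = 0} \<and>
    finite bw \<and> fv.independent bw \<and> fv.span bw \<subseteq> affine_space K \<and>
    (\<forall>v\<in>affine_space J. D v \<in> fv.span bw \<longrightarrow> D v = 0) \<and>
    (\<forall>y\<in>affine_space K. \<exists>v\<in>affine_space J. \<exists>w\<in>fv.span bw. y = D v + w) \<and>
    card bk + card K = card bw + card J"
proof -
  have D0: "D 0 = 0" using scale[of 0 0] by (simp add: fscale_def zero_fun_def)
  have Dsum: "D (\<Sum>v\<in>A. fscale (u v) v) = (\<Sum>v\<in>A. fscale (u v) (D v))" for A u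
    by (induction A rule: infinite_finite_induct)
      (simp_all only: D0 add scale sum.infinite sum.empty sum.insert not_False_eq_True)
  define Ker where "Ker = {v \<in> affine_space J. D v = 0}"
  have Ks: "fv.subspace Ker"
    using affine_space_subspace[of J] D0 add scale fv.scale_zero_right unfolding fv.subspace_def Ker_def
    by (auto simp: fscale_def zero_fun_def)
  obtain bk where bk: "bk \<subseteq> Ker" "fv.independent bk" "Ker \<subseteq> fv.span bk"
    using fv.maximal_independent_subset by blast
  have bkJ: "bk \<subseteq> affine_space J" using bk(1) by (auto simp: Ker_def)
  obtain bj where bj: "bk \<subseteq> bj" "bj \<subseteq> affine_space J" "fv.independent bj" "affine_space J \<subseteq> fv.span bj"
    using fv.maximal_independent_subset_extend[OF bkJ bk(2)] by blast
  have fbj: "finite bj" "card bj = card J" using affine_space_basis_card[OF J bj(3,2,4)] by auto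
  have fbk: "finite bk" using bj(1) fbj(1) finite_subset by blast
  have spk: "fv.span bk = Ker" using bk Ks by (metis fv.span_minimal subset_antisym)
  define A where "A = bj - bk"
  have A: "finite A" "A \<union> bk = bj" "A \<inter> bk = {}" using fbj bj(1) by (auto simp: A_def)
  have li: "\<forall>a\<in>A. u a = 0" if u: "(\<Sum>a\<in>A. fscale (u a) (D a)) = 0" for u
  proof -
    let ?x = "\<Sum>a\<in>A. fscale (u a) a"
    have xA: "?x \<in> fv.span A" by (intro fv.span_sum fv.span_scale fv.span_base)
    have "?x \<in> affine_space J"
      using fv.span_mono[of A bj] xA A(2) fv.span_minimal[OF bj(2) affine_space_subspace] by blast
    then have "?x \<in> Ker" using u unfolding Ker_def Dsum[symmetric] by simp
    then have "?x = 0"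
      using fv_independent_disjoint[of A bk ?x] A bj(3) fbk xA spk by simp
    moreover have "fv.independent A" using bj(3) A(2) fv.independent_mono by blast
    ultimately show ?thesis using fv.independentD[of A A u] A(1) by blast
  qed
  define R where "R = D ` A"
  have R: "inj_on D A" "fv.independent R" "finite R"
    using fv_independent_family[OF A(1) li] A(1) unfolding R_def by auto
  have RK: "R \<subseteq> affine_space K" using D unfolding R_def by blast
  obtain bY where bY: "R \<subseteq> bY" "bY \<subseteq> affine_space K" "fv.independent bY" "affine_space K \<subseteq> fv.span bY"
    using fv.maximal_independent_subset_extend[OF RK R(2)] by blast
  have fbY: "finite bY" "card bY = card K" using affine_space_basis_card[OF K bY(3,2,4)] by auto
  define bw where "bw = bY - R"
  have W: "finite bw" "R \<union> bw = bY" "R \<inter> bw = {}" using fbY bY(1) by (auto simp: bw_def)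
  have Dv: "D v \<in> fv.span R" if v: "v \<in> affine_space J" for v
  proof -
    obtain u where u: "v = (\<Sum>x\<in>bj. fscale (u x) x)"
      using v bj(4) unfolding fv.span_finite[OF fbj(1)] by auto
    have "D v = (\<Sum>x\<in>bj. fscale (u x) (D x))" unfolding u by (rule Dsum)
    also have "\<dots> \<in> fv.span R"
    proof (rule fv.span_sum, rule fv.span_scale)
      fix x assume "x \<in> bj"
      then have "x \<in> A \<or> D x = 0" using A(2) bk(1) by (auto simp: Ker_def)
      then show "D x \<in> fv.span R" unfolding R_def by (auto intro: fv.span_base fv.span_zero)
    qed
    finally show ?thesis .
  qed
  have 1: "D v = 0" if "v \<in> affine_space J" "D v \<in> fv.span bw" for v
    using fv_independent_disjoint[of R bw "D v"] W bY(3) R(3) Dv[OF that(1)] that(2) by simp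
  have 2: "\<exists>v\<in>affine_space J. \<exists>w\<in>fv.span bw. y = D v + w" if "y \<in> affine_space K" for y
  proof -
    have "y \<in> fv.span (R \<union> bw)" using that bY(4) W(2) by auto
    then obtain r w where rw: "y = r + w" "r \<in> fv.span R" "w \<in> fv.span bw"
      unfolding fv.span_Un by blast
    obtain u where "r = (\<Sum>x\<in>R. fscale (u x) x)" using rw(2) unfolding fv.span_finite[OF R(3)] by auto
    also have "\<dots> = (\<Sum>a\<in>A. fscale (u (D a)) (D a))" unfolding R_def by (simp add: sum.reindex[OF R(1)])
    also have "\<dots> = D (\<Sum>a\<in>A. fscale (u (D a)) a)" using Dsum[of "\<lambda>a. u (D a)" A] by simp
    finally have r: "r = D (\<Sum>a\<in>A. fscale (u (D a)) a)" .
    have "A \<subseteq> affine_space J" using A(2) bj(2) by blast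
    then have "(\<Sum>a\<in>A. fscale (u (D a)) a) \<in> affine_space J"
      by (intro fv.subspace_sum[OF affine_space_subspace] fv.subspace_scale[OF affine_space_subspace]) auto
    then show ?thesis using r rw by blast
  qed
  have "card A = card J - card bk" "card bk \<le> card J"
    using fbj fbk bj(1) card_mono[OF fbj(1) bj(1)] by (auto simp: A_def card_Diff_subset)
  moreover have "card bw = card K - card R" "card R \<le> card K"
    using fbY R(3) bY(1) card_mono[OF fbY(1) bY(1)] by (auto simp: bw_def card_Diff_subset)
  moreover have "card R = card A" unfolding R_def by (rule card_image[OF R(1)])
  ultimately have 3: "card bk + card K = card bw + card J" by linarith
  have "fv.span bw \<subseteq> affine_space K"
    using W(2) bY(2) by (intro fv.span_minimal affine_space_subspace) auto
  note 4 = this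
  have 5: "fv.independent bw" using bY(3) W(2) fv.independent_mono by blast
  show ?thesis
    by (rule exI[of _ bk], rule exI[of _ bw],
        intro conjI ballI impI fbk bk(2) spk[unfolded Ker_def] W(1) 3 4 5) (fact 1 2)+
qed

text \<open>\<sigma> induces an isomorphism from the span of \<open>b\<close> onto Z modulo B. Since
  \<open>quotient_dim\<close> selects some basis, each quotient basis b' must be compared with
  \<open>b\<close>: lifted back along \<sigma>, it becomes a basis of the span of
  \<open>b\<close>.\<close>

lemma quotient_dim_eq:
  fixes \<sigma> :: "('i \<Rightarrow> complex) \<Rightarrow> cochain"
  assumes add: "\<And>u v. \<sigma> (u + v) = \<sigma> u + \<sigma> v" and scale: "\<And>k v. \<sigma> (fscale k v) = cochain_scale k (\<sigma> v)"
    and b: "fv.independent b" "finite b" and B: "cochain.subspace B"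
    and Z: "\<And>w. w \<in> fv.span b \<Longrightarrow> \<sigma> w \<in> Z"
    and inj: "\<And>w. w \<in> fv.span b \<Longrightarrow> \<sigma> w \<in> B \<Longrightarrow> w = 0"
    and sur: "\<And>z. z \<in> Z \<Longrightarrow> \<exists>w\<in>fv.span b. z - \<sigma> w \<in> B"
  shows "quotient_dim Z B = card b"
proof -
  have s0: "\<sigma> 0 = 0" using scale[of 0 0] by (simp add: fscale_def zero_fun_def cochain_scale_def)
  have sdiff: "\<sigma> (u - v) = \<sigma> u - \<sigma> v" for u v using add[of "u - v" v] by (simp add: algebra_simps)
  have ssum: "\<sigma> (\<Sum>v\<in>A. fscale (u v) (h v)) = (\<Sum>v\<in>A. cochain_scale (u v) (\<sigma> (h v)))" for A and u :: "'x \<Rightarrow> complex" and h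
    by (induction A rule: infinite_finite_induct)
      (simp_all only: s0 add scale sum.infinite sum.empty sum.insert not_False_eq_True)
  have spb: "\<exists>u. w = (\<Sum>v\<in>b. fscale (u v) v)" if "w \<in> fv.span b" for w
    using that unfolding fv.span_finite[OF b(2)] by auto
  have "quotient_basis Z B (\<sigma> ` b)"
    unfolding quotient_basis_def
  proof (intro conjI allI impI)
    show "\<sigma> ` b \<subseteq> Z" using Z fv.span_base by blast
    show "Z \<subseteq> cochain.span (B \<union> \<sigma> ` b)"
    proof
      fix z assume "z \<in> Z"
      then obtain w where w: "w \<in> fv.span b" "z - \<sigma> w \<in> B" using sur by blast
      obtain u where u: "w = (\<Sum>v\<in>b. fscale (u v) v)" using spb[OF w(1)] by blast
      have "\<sigma> w \<in> cochain.span (B \<union> \<sigma> ` b)"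
        unfolding u ssum by (intro cochain.span_sum cochain.span_scale cochain.span_base) auto
      moreover have "z - \<sigma> w \<in> cochain.span (B \<union> \<sigma> ` b)" using w(2) by (auto intro: cochain.span_base)
      ultimately have "(z - \<sigma> w) + \<sigma> w \<in> cochain.span (B \<union> \<sigma> ` b)" by (rule cochain.span_add[rotated])
      then show "z \<in> cochain.span (B \<union> \<sigma> ` b)" by simp
    qed
  next
    fix f u assume f: "finite f \<and> f \<subseteq> \<sigma> ` b \<and> (\<Sum>v\<in>f. cochain_scale (u v) v) \<in> B"
    then obtain b0 where b0: "b0 \<subseteq> b" "f = \<sigma> ` b0" by (auto simp: subset_image_iff)
    have inj0: "inj_on \<sigma> b0"
    proof (rule inj_onI)
      fix v w assume vw: "v \<in> b0" "w \<in> b0" "\<sigma> v = \<sigma> w"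
      then have "\<sigma> (v - w) \<in> B" using cochain.subspace_0[OF B] by (simp add: sdiff)
      moreover have "v - w \<in> fv.span b" using vw b0 by (intro fv.span_diff fv.span_base) auto
      ultimately show "v = w" using inj[of "v - w"] by simp
    qed
    have "(\<Sum>v\<in>f. cochain_scale (u v) v) = \<sigma> (\<Sum>v\<in>b0. fscale (u (\<sigma> v)) v)"
      unfolding b0(2) using ssum[of "\<lambda>v. u (\<sigma> v)" "\<lambda>v. v" b0] by (simp add: sum.reindex[OF inj0])
    moreover have "(\<Sum>v\<in>b0. fscale (u (\<sigma> v)) v) \<in> fv.span b"
      using b0(1) by (intro fv.span_sum fv.span_scale fv.span_base) auto
    ultimately have "(\<Sum>v\<in>b0. fscale (u (\<sigma> v)) v) = 0" using inj f by simp
    then have "\<forall>v\<in>b0. u (\<sigma> v) = 0"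
      using fv.independentD[OF b(1) _ b0(1), of "\<lambda>v. u (\<sigma> v)"] b0(1) b(2) finite_subset by blast
    then show "\<forall>v\<in>f. u v = 0" using b0(2) by blast
  qed
  then have ex: "\<exists>b'. quotient_basis Z B b'" by blast
  have "card b' = card b" if qb: "quotient_basis Z B b'" for b'
  proof -
    note q = qb[unfolded quotient_basis_def]
    note b'Z = conjunct1[OF q] and Zs = conjunct1[OF conjunct2[OF q]]
    have bi: "\<forall>v\<in>f. u v = 0" if "finite f" "f \<subseteq> b'" "(\<Sum>v\<in>f. cochain_scale (u v) v) \<in> B" for f u
      using conjunct2[OF conjunct2[OF q]] that by simp
    have "\<forall>z. \<exists>w. z \<in> b' \<longrightarrow> w \<in> fv.span b \<and> z - \<sigma> w \<in> B" using sur b'Z by blast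
    from choice[OF this] obtain \<tau> where \<tau>: "\<And>z. z \<in> b' \<Longrightarrow> \<tau> z \<in> fv.span b" "\<And>z. z \<in> b' \<Longrightarrow> z - \<sigma> (\<tau> z) \<in> B"
      by blast
    have red: "(\<Sum>z\<in>f. cochain_scale (u z) z) - \<sigma> (\<Sum>z\<in>f. fscale (u z) (\<tau> z)) \<in> B" if "f \<subseteq> b'" for f u
    proof -
      have "(\<Sum>z\<in>f. cochain_scale (u z) z) - \<sigma> (\<Sum>z\<in>f. fscale (u z) (\<tau> z))
          = (\<Sum>z\<in>f. cochain_scale (u z) (z - \<sigma> (\<tau> z)))"
        unfolding ssum by (simp add: sum_subtractf cochain.scale_right_diff_distrib)
      also have "\<dots> \<in> B" using that \<tau>(2)
        by (intro cochain.subspace_sum[OF B] cochain.subspace_scale[OF B]) auto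
      finally show ?thesis .
    qed
    have li: "\<forall>z\<in>f. u z = 0" if f: "finite f" "f \<subseteq> b'" and u: "(\<Sum>z\<in>f. fscale (u z) (\<tau> z)) = 0" for f u
      using bi[OF f] red[OF f(2), of u] u s0 by simp
    have fam: "inj_on \<tau> f \<and> fv.independent (\<tau> ` f)" if "finite f" "f \<subseteq> b'" for f
      using that li by (intro fv_independent_family) auto
    have bound: "card f \<le> card b" if "finite f" "f \<subseteq> b'" for f
    proof -
      have "card (\<tau> ` f) \<le> card b"
        using fv.independent_span_bound[OF b(2), of "\<tau> ` f"] fam[OF that] \<tau>(1) that by blast
      then show ?thesis using fam[OF that] by (simp add: card_image)
    qed
    \<comment> \<open>Finiteness is settled first, from the bound on finite subsets, since an
      infinite set has \<open>card\<close> 0.\<close>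
    have fin: "finite b'"
    proof (rule ccontr)
      assume "infinite b'"
      then obtain f where "finite f" "card f = Suc (card b)" "f \<subseteq> b'" using infinite_arbitrarily_large by blast
      then show False using bound[of f] by simp
    qed
    have "b \<subseteq> fv.span (\<tau> ` b')"
    proof
      fix w assume w: "w \<in> b"
      then have wb: "w \<in> fv.span b" by (rule fv.span_base)
      then have "\<sigma> w \<in> cochain.span (B \<union> b')" using Z Zs by blast
      then obtain \<beta> y where y: "\<sigma> w = \<beta> + y" "\<beta> \<in> B" "y \<in> cochain.span b'"
        unfolding cochain.span_Un cochain.span_eq_iff[THEN iffD2, OF B] by blast
      then obtain u where u: "y = (\<Sum>z\<in>b'. cochain_scale (u z) z)"
        unfolding cochain.span_finite[OF fin] by auto
      let ?t = "\<Sum>z\<in>b'. fscale (u z) (\<tau> z)"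
      have "\<sigma> (w - ?t) = \<beta> + (y - \<sigma> ?t)" by (simp add: sdiff y(1))
      also have "\<dots> \<in> B" using cochain.subspace_add[OF B y(2) red[OF order_refl, of u]] u by simp
      finally have "\<sigma> (w - ?t) \<in> B" .
      moreover have "w - ?t \<in> fv.span b"
        using wb \<tau>(1) by (intro fv.span_diff fv.span_sum fv.span_scale) auto
      ultimately have "w = ?t" using inj[of "w - ?t"] by simp
      moreover have "?t \<in> fv.span (\<tau> ` b')" by (intro fv.span_sum fv.span_scale fv.span_base) auto
      ultimately show "w \<in> fv.span (\<tau> ` b')" by simp
    qed
    then have "card b \<le> card (\<tau> ` b')" using fv.independent_span_bound[OF _ b(1)] fin by blast
    also have "\<dots> \<le> card b'" by (rule card_image_le[OF fin])
    finally show ?thesis using bound[OF fin order_refl] by simp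
  qed
  then show ?thesis unfolding quotient_dim_def using someI_ex[OF ex] by blast
qed

text \<open>The tags 0 and 1 put the entries of A and of B into one coordinate space.\<close>

definition pair_index :: "nat \<Rightarrow> nat \<Rightarrow> (nat \<times> nat \<times> nat) set" where
  "pair_index s t = {0} \<times> {..<t} \<times> {..<t} \<union> {1} \<times> {..<s} \<times> {..<s}"

definition pair_defect :: "nat \<Rightarrow> nat \<Rightarrow> nat \<Rightarrow> morph \<Rightarrow> (nat \<times> nat \<times> nat \<Rightarrow> complex) \<Rightarrow> morph" where
  "pair_defect N s t m v = (\<lambda>(i, a, b). if i < N \<and> a < t \<and> b < s then
     (\<Sum>c<t. v (0, a, c) * m (i, c, b)) - (\<Sum>c<s. m (i, a, c) * v (1, c, b)) else 0)"

definition pair_vec :: "nat \<Rightarrow> nat \<Rightarrow> (nat \<Rightarrow> nat \<Rightarrow> complex) \<Rightarrow> (nat \<Rightarrow> nat \<Rightarrow> complex) \<Rightarrow> nat \<times> nat \<times> nat \<Rightarrow> complex" where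
  "pair_vec s t A B = (\<lambda>(i, a, b). if i = 0 \<and> a < t \<and> b < t then A a b
     else if i = 1 \<and> a < s \<and> b < s then B a b else 0)"

lemma pair_index_finite: "finite (pair_index s t)" and morph_index_finite: "finite (morph_index N s t)"
  by (auto simp: pair_index_def morph_index_def)

lemma pair_index_card: "card (pair_index s t) = t^2 + s^2" and morph_index_card: "card (morph_index N s t) = N * (t * s)"
proof -
  have "card (pair_index s t) = card ({0::nat} \<times> {..<t} \<times> {..<t}) + card ({1::nat} \<times> {..<s} \<times> {..<s})"
    unfolding pair_index_def by (rule card_Un_disjoint) auto
  then show "card (pair_index s t) = t^2 + s^2" by (simp add: power2_eq_square)
  show "card (morph_index N s t) = N * (t * s)" by (simp add: morph_index_def)
qed

lemma pair_vec_affine: "pair_vec s t A B \<in> affine_space (pair_index s t)"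
  by (auto simp: pair_vec_def affine_space_def pair_index_def)

lemma pair_defect_add: "pair_defect N s t m (u + v) = pair_defect N s t m u + pair_defect N s t m v"
  by (auto simp: pair_defect_def fun_eq_iff distrib_left distrib_right sum.distrib)

lemma pair_defect_scale: "pair_defect N s t m (fscale k v) = fscale k (pair_defect N s t m v)"
  by (auto simp: pair_defect_def fscale_def fun_eq_iff right_diff_distrib sum_distrib_left mult_ac)

lemma pair_defect_affine: "pair_defect N s t m v \<in> affine_space (morph_index N s t)"
  by (auto simp: pair_defect_def affine_space_def morph_index_def)

lemma pair_defect_zero_iff:
  "pair_defect N s t m v = 0 \<longleftrightarrow> intertwines N s t m (\<lambda>a b. v (0, a, b)) (\<lambda>a b. v (1, a, b))"
  by (auto simp: pair_defect_def intertwines_def fun_eq_iff)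

lemma intertwines_cong:
  assumes "\<And>a b. a < t \<Longrightarrow> b < t \<Longrightarrow> A a b = A' a b" "\<And>a b. a < s \<Longrightarrow> b < s \<Longrightarrow> B a b = B' a b"
  shows "intertwines N s t m A B \<longleftrightarrow> intertwines N s t m A' B'"
  unfolding intertwines_def using assms by simp

lemma pair_defect_pair_vec: "pair_defect N s t m (pair_vec s t A B) = 0 \<longleftrightarrow> intertwines N s t m A B"
  unfolding pair_defect_zero_iff by (rule intertwines_cong) (simp_all add: pair_vec_def)

section \<open>Openness of the simplicity condition\<close>

text \<open>Subtracting the scalar A 0 0 from an endomorphism makes its corner entry zero. So it
  suffices that (A, B) -> (A m - m B, A 0 0) is injective. Its matrix is polynomial in m, and a
  determinant with one factor frozen at the known module detects injectivity on an open set.\<close>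

lemma generic_brick:
  assumes t: "t \<ge> 1" and m0: "brick N s t m0"
  shows "\<exists>U. zariski_open (morph_index N s t) U \<and> U \<noteq> {} \<and> (\<forall>m\<in>U. brick N s t m)"
proof -
  let ?J = "pair_index s t" and ?K = "morph_index N s t"
  define m1 where "m1 = (\<lambda>i. if i \<in> ?K then m0 i else 0)"
  have m1: "brick N s t m1"
    using m0 unfolding brick_def intertwines_def m1_def morph_index_def by simp
  obtain f where f: "bij_betw f {..<card ?J} ?J" using ex_bij_betw_nat_finite[OF pair_index_finite] by (metis lessThan_atLeast0)
  obtain g where g: "bij_betw g {..<card ?K} ?K" using ex_bij_betw_nat_finite[OF morph_index_finite] by (metis lessThan_atLeast0)
  define k r where "k = card ?J" and "r = card ?K"
  \<comment> \<open>Rows below r are the coordinates of the defect; row r reads off the corner entry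
    A 0 0.\<close>
  define X where "X m a b = (if a < r then pair_defect N s t m (unit_fun (f b)) (g a) else unit_fun (f b) (0, 0, 0))"
    for m a b
  have fJ: "f b \<in> ?J" if "b < k" for b using f that by (auto simp: bij_betw_def k_def)
  have gK: "g a \<in> ?K" if "a < r" for a using g that by (auto simp: bij_betw_def r_def)
  define V where "V w = (\<Sum>b<k. fscale (w b) (unit_fun (f b)))" for w
  have Vf: "V w (f b) = w b" if "b < k" for w b
  proof -
    have "V w (f b) = (\<Sum>c<k. if c = b then w b else 0)"
      unfolding V_def sum_fun_apply fscale_def unit_fun_def
      using f that by (intro sum.cong) (auto simp: bij_betw_def k_def inj_on_eq_iff)
    then show ?thesis using that by simp
  qed
  have VJ: "V w \<in> affine_space ?J" for w
    unfolding V_def using fJ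
    by (intro fv.subspace_sum[OF affine_space_subspace] fv.subspace_scale[OF affine_space_subspace])
       (auto simp: affine_space_def unit_fun_def)
  have V_sur: "v = V (\<lambda>b. v (f b))" if v: "v \<in> affine_space ?J" for v
  proof
    fix i show "v i = V (\<lambda>b. v (f b)) i"
    proof (cases "i \<in> ?J")
      case True
      then obtain b where "b < k" "i = f b" using f unfolding bij_betw_def k_def by auto
      then show ?thesis using Vf by simp
    next
      case False
      then show ?thesis using affine_space_outside[OF v] affine_space_outside[OF VJ] by simp
    qed
  qed
  have Dsum: "pair_defect N s t m (\<Sum>b\<in>B. fscale (w b) (h b)) = (\<Sum>b\<in>B. fscale (w b) (pair_defect N s t m (h b)))"
    for m w h and B :: "nat set"
  proof (induction B rule: infinite_finite_induct)
    case (insert b B)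
    then show ?case by (simp only: pair_defect_add pair_defect_scale sum.insert not_False_eq_True)
  qed (auto simp: pair_defect_def fun_eq_iff)
  have XV: "(\<Sum>b<k. X m a b * w b) = (if a < r then pair_defect N s t m (V w) (g a) else V w (0, 0, 0))" for m a w
    unfolding X_def V_def Dsum by (simp add: sum_fun_apply fscale_def mult.commute)
  have Xzero: "(\<forall>a<Suc r. (\<Sum>b<k. X m a b * w b) = 0) \<longleftrightarrow> pair_defect N s t m (V w) = 0 \<and> V w (0, 0, 0) = 0" for m w
  proof
    assume z: "\<forall>a<Suc r. (\<Sum>b<k. X m a b * w b) = 0"
    have "pair_defect N s t m (V w) i = 0" for i
    proof (cases "i \<in> ?K")
      case True
      then obtain a where "a < r" "i = g a" using g unfolding bij_betw_def r_def by auto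
      then show ?thesis using z[rule_format, of a] XV[of m a w] by simp
    next
      case False
      then show ?thesis by (rule affine_space_outside[OF pair_defect_affine])
    qed
    moreover have "V w (0, 0, 0) = 0" using z[rule_format, of r] XV[of m r w] by simp
    ultimately show "pair_defect N s t m (V w) = 0 \<and> V w (0, 0, 0) = 0" by auto
  qed (simp add: XV)
  have inj0: "\<forall>b<k. w b = 0" if "\<forall>a<Suc r. (\<Sum>b<k. X m1 a b * w b) = 0" for w
  proof -
    have "pair_defect N s t m1 (V w) = 0" and v0: "V w (0, 0, 0) = 0" using that unfolding Xzero by auto
    then obtain \<kappa> where \<kappa>: "scalar_mat t (\<lambda>a b. V w (0, a, b)) \<kappa>" "scalar_mat s (\<lambda>a b. V w (1, a, b)) \<kappa>"
      using m1 unfolding brick_def pair_defect_zero_iff by blast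
    then have "\<kappa> = 0" using v0 t unfolding scalar_mat_def by force
    have "V w i = 0" if "i \<in> ?J" for i
      using that \<kappa> \<open>\<kappa> = 0\<close> unfolding pair_index_def scalar_mat_def by auto
    then show ?thesis using Vf fJ by metis
  qed
  \<comment> \<open>Only entries at m1 are conjugated, so this is a polynomial in m; at m = m1 it is
    a Gram determinant.\<close>
  define \<delta> where "\<delta> m = det (mat k k (\<lambda>(i, j). \<Sum>a<Suc r. cnj (X m1 a i) * X m a j))" for m
  have Xp: "(\<lambda>m. X m a b) \<in> poly_fun ?K" if a: "a < Suc r" for a b
  proof (cases "a < r")
    case True
    obtain i c d where icd: "g a = (i, c, d)" by (cases "g a")
    then have lt: "i < N" "c < t" "d < s" using gK[OF True] by (auto simp: morph_index_def)
    have "(\<lambda>m. (\<Sum>e<t. unit_fun (f b) (0, c, e) * m (i, e, d)) - (\<Sum>e<s. m (i, c, e) * unit_fun (f b) (1, e, d))) \<in> poly_fun ?K"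
      using lt by (intro poly_fun_diff poly_fun_sum poly_fun.mult poly_fun.const poly_fun.coord) (auto simp: morph_index_def)
    then show ?thesis using True lt by (simp add: X_def icd pair_defect_def)
  qed (simp add: X_def poly_fun.const)
  have \<delta>p: "\<delta> \<in> poly_fun ?K"
    unfolding \<delta>_def by (intro poly_fun_det poly_fun_sum poly_fun.mult poly_fun.const Xp) auto
  define U where "U = {m \<in> affine_space ?K. \<exists>h\<in>{\<delta>}. h m \<noteq> 0}"
  have "zariski_open ?K U" unfolding zariski_open_def U_def using \<delta>p by blast
  moreover have "\<delta> m1 \<noteq> 0" unfolding \<delta>_def by (rule det_gram_nonzero) (rule inj0)
  then have "m1 \<in> U" unfolding U_def by (auto simp: affine_space_def m1_def)
  moreover have "brick N s t m" if mU: "m \<in> U" for m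
    unfolding brick_def
  proof (intro allI impI)
    fix A B assume I: "intertwines N s t m A B"
    define \<kappa> where "\<kappa> = A 0 0"
    define A' where "A' a b = A a b - (if a = b then \<kappa> else 0)" for a b
    define B' where "B' a b = B a b - (if a = b then \<kappa> else 0)" for a b
    have "intertwines N s t m A' B'" unfolding intertwines_def
    proof (intro allI impI)
      fix i a b assume h: "i < N" "a < t" "b < s"
      have "(\<Sum>c<t. A' a c * m (i, c, b)) = (\<Sum>c<t. A a c * m (i, c, b)) - \<kappa> * m (i, a, b)"
        using h by (simp add: A'_def left_diff_distrib sum_subtractf if_distrib[of "\<lambda>z. z * _"] cong: if_cong)
      moreover have "(\<Sum>c<s. m (i, a, c) * B' c b) = (\<Sum>c<s. m (i, a, c) * B c b) - m (i, a, b) * \<kappa>"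
        using h by (simp add: B'_def right_diff_distrib sum_subtractf if_distrib[of "\<lambda>z. _ * z"] cong: if_cong)
      ultimately show "(\<Sum>c<t. A' a c * m (i, c, b)) = (\<Sum>c<s. m (i, a, c) * B' c b)"
        using I h unfolding intertwines_def by simp
    qed
    define v where "v = pair_vec s t A' B'"
    have v: "v \<in> affine_space ?J" "pair_defect N s t m v = 0"
      unfolding v_def using pair_vec_affine pair_defect_pair_vec \<open>intertwines N s t m A' B'\<close> by blast+
    have "v (0, 0, 0) = 0" using t by (simp add: v_def pair_vec_def A'_def \<kappa>_def)
    then have X0: "\<forall>a<Suc r. (\<Sum>b<k. X m a b * v (f b)) = 0"
      unfolding Xzero using v(2) V_sur[OF v(1)] by simp
    have "\<delta> m \<noteq> 0" using mU by (simp add: U_def)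
    then have "\<forall>b<k. v (f b) = 0" unfolding \<delta>_def
      by (rule det_product_nonzero_imp_injective[where \<Lambda> = "\<lambda>i a. cnj (X m1 a i)" and M = "X m"
          and w = "\<lambda>b. v (f b)", OF _ X0])
    then have "v = V (\<lambda>_. 0)" using V_sur[OF v(1)] unfolding V_def by simp
    then have v0: "v i = 0" for i by (simp add: V_def sum_fun_apply fscale_def)
    have "scalar_mat t A \<kappa>" unfolding scalar_mat_def
    proof (intro allI impI)
      fix a b assume "a < t" "b < t"
      then show "A a b = (if a = b then \<kappa> else 0)" using v0[of "(0, a, b)"] by (simp add: v_def pair_vec_def A'_def)
    qed
    moreover have "scalar_mat s B \<kappa>" unfolding scalar_mat_def
    proof (intro allI impI)
      fix a b assume "a < s" "b < s"
      then show "B a b = (if a = b then \<kappa> else 0)" using v0[of "(1, a, b)"] by (simp add: v_def pair_vec_def B'_def)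
    qed
    ultimately show "\<exists>k. scalar_mat t A k \<and> scalar_mat s B k" by blast
  qed
  ultimately show ?thesis by blast
qed

section \<open>The numbers \<open>h\<^sup>p\<close>\<close>

context steiner
begin

lemma defect_pair_vec:
  assumes "i < N" "a < t" "b < s"
  shows "pair_defect N s t m (pair_vec s t E F) (i, a, b) = defect E F (i, a, b)"
  using assms by (simp add: pair_defect_def pair_vec_def defect_def)

text \<open>Endomorphisms of the Kronecker module are sent to the constant cochains of their A-part.
  Nothing is lost with the B-part, because it vanishes once A is null.\<close>

lemma h_End_0:
  assumes bk: "finite bk" "fv.independent bk"
    and sp: "fv.span bk = {v \<in> affine_space (pair_index s t). pair_defect N s t m v = 0}"
  shows "h_End N s t m 0 = card bk"
  unfolding h_End_def coboundaries.simps
proof (rule quotient_dim_eq[where \<sigma> = "\<lambda>v S x a b. v (0, a, b)", OF _ _ bk(2,1) null_cochains_subspace])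
  show "(\<lambda>S x a b. (u + v) (0, a, b)) = (\<lambda>S x a b. u (0, a, b)) + (\<lambda>S x a b. v (0, a, b))"
    for u v :: "nat \<times> nat \<times> nat \<Rightarrow> complex" by (auto simp: fun_eq_iff)
  show "(\<lambda>S x a b. fscale k v (0, a, b)) = cochain_scale k (\<lambda>S x a b. v (0, a, b))"
    for k and v :: "nat \<times> nat \<times> nat \<Rightarrow> complex" by (auto simp: fun_eq_iff fscale_def cochain_scale_def)
next
  fix w assume "w \<in> fv.span bk"
  then have w: "w \<in> affine_space (pair_index s t)"
    and i: "intertwines N s t m (\<lambda>a b. w (0, a, b)) (\<lambda>a b. w (1, a, b))"
    unfolding sp by (simp_all add: pair_defect_zero_iff)
  show "(\<lambda>S x a b. w (0, a, b)) \<in> cocycles N s t m 0" by (rule const_cocycle[OF i])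
  assume "(\<lambda>S x a b. w (0, a, b)) \<in> null_cochains N s t m 0"
  from const_null_imp_zero[OF i this]
  have "(\<forall>a<t. \<forall>b<t. w (0, a, b) = 0) \<and> (\<forall>a<s. \<forall>b<s. w (1, a, b) = 0)" .
  then have "w i = 0" for i
    using affine_space_outside[OF w] by (cases "i \<in> pair_index s t") (auto simp: pair_index_def)
  then show "w = 0" by auto
next
  fix z assume "z \<in> cocycles N s t m 0"
  then obtain E F where EF: "intertwines N s t m E F" "z - (\<lambda>S x. E) \<in> null_cochains N s t m 0"
    using cocycle_0_constant by blast
  let ?w = "pair_vec s t E F"
  have "?w \<in> fv.span bk" unfolding sp using EF(1) by (simp add: pair_vec_affine pair_defect_pair_vec)
  moreover have "z - (\<lambda>S x a b. ?w (0, a, b)) \<in> null_cochains N s t m 0"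
    unfolding null_cochains_iff
  proof (intro allI impI)
    fix S x assume "S \<subseteq> {..<N}" "card S = Suc 0" "x \<in> chart N S"
    then have "factors x t ((z - (\<lambda>S x. E)) S x)" using EF(2) unfolding null_cochains_iff by blast
    then show "factors x t ((z - (\<lambda>S x a b. ?w (0, a, b))) S x)"
      by (rule factors_cong) (simp add: pair_vec_def)
  qed
  ultimately show "\<exists>w\<in>fv.span bk. z - (\<lambda>S x a b. w (0, a, b)) \<in> null_cochains N s t m 0" by blast
qed

lemma connecting_add: "connecting (u + v) = connecting u + connecting v"
proof -
  have "(\<lambda>S x. mmul s (linear_form (u + v) x) (Linv S x))
      = (\<lambda>S x. mmul s (linear_form u x) (Linv S x)) + (\<lambda>S x. mmul s (linear_form v x) (Linv S x))"
    by (auto simp: fun_eq_iff linear_form_def mmul_def distrib_left distrib_right sum.distrib)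
  then show ?thesis unfolding connecting_def by (simp only: coboundary_plus)
qed

lemma connecting_scale: "connecting (fscale k v) = cochain_scale k (connecting v)"
proof -
  have "(\<lambda>S x. mmul s (linear_form (fscale k v) x) (Linv S x))
      = cochain_scale k (\<lambda>S x. mmul s (linear_form v x) (Linv S x))"
    by (auto simp: fun_eq_iff linear_form_def mmul_def cochain_scale_def fscale_def
        sum_distrib_left sum_distrib_right mult_ac)
  then show ?thesis unfolding connecting_def by (simp only: coboundary_scale)
qed

text \<open>\<open>connecting\<close> is onto H^1 and its kernel is the image of the defect map, so
  a complement of that image is carried isomorphically onto H^1.\<close>

lemma h_End_1:
  assumes bw: "finite bw" "fv.independent bw" and spw: "fv.span bw \<subseteq> affine_space (morph_index N s t)"
    and disj: "\<forall>v\<in>affine_space (pair_index s t). pair_defect N s t m v \<in> fv.span bw \<longrightarrow> pair_defect N s t m v = 0"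
    and sum: "\<forall>y\<in>affine_space (morph_index N s t). \<exists>v\<in>affine_space (pair_index s t). \<exists>w\<in>fv.span bw.
      y = pair_defect N s t m v + w"
  shows "h_End N s t m (Suc 0) = card bw"
  unfolding h_End_def
proof (rule quotient_dim_eq[where \<sigma> = connecting, OF connecting_add connecting_scale bw(2,1) coboundaries_subspace])
  fix w show "connecting w \<in> cocycles N s t m (Suc 0)" by (rule connecting_cocycle)
next
  fix w assume w: "w \<in> fv.span bw" and "connecting w \<in> coboundaries N s t m (Suc 0)"
  then obtain E F where EF: "\<forall>i<N. \<forall>a<t. \<forall>b<s. w (i, a, b) = defect E F (i, a, b)"
    using connecting_coboundary_imp_defect by blast
  let ?v = "pair_vec s t E F"
  have "pair_defect N s t m ?v i = w i" for i
  proof (cases "i \<in> morph_index N s t")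
    case True
    then obtain j a b where j: "i = (j, a, b)" "j < N" "a < t" "b < s" by (auto simp: morph_index_def)
    then show ?thesis using EF defect_pair_vec[OF j(2-4)] by simp
  next
    case False
    have "w \<in> affine_space (morph_index N s t)" using w spw by blast
    then show ?thesis using False affine_space_outside pair_defect_affine by metis
  qed
  then have eq: "pair_defect N s t m ?v = w" by auto
  then show "w = 0" using disj[rule_format, OF pair_vec_affine[of s t E F]] w by simp
next
  fix z assume "z \<in> cocycles N s t m (Suc 0)"
  then obtain g where g: "z - connecting g \<in> coboundaries N s t m (Suc 0)" using cocycle_1_connecting by blast
  \<comment> \<open>Entries outside the block are cut off in order to decompose g;
    \<open>connecting_defect\<close> looks only at the entries inside.\<close>
  define g' where "g' = (\<lambda>i. if i \<in> morph_index N s t then g i else 0)"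
  have "g' \<in> affine_space (morph_index N s t)" by (auto simp: g'_def affine_space_def)
  then obtain v w where vw: "w \<in> fv.span bw" "g' = pair_defect N s t m v + w" using sum by blast
  have "connecting (g - w) \<in> coboundaries N s t m (Suc 0)"
  proof (rule connecting_defect)
    fix i a b assume "i < N" "a < t" "b < s"
    then show "(g - w) (i, a, b) = defect (\<lambda>a b. v (0, a, b)) (\<lambda>a b. v (1, a, b)) (i, a, b)"
      using fun_cong[OF vw(2), of "(i, a, b)"] by (simp add: g'_def morph_index_def pair_defect_def defect_def)
  qed
  moreover have "connecting g = connecting (g - w) + connecting w"
    using connecting_add[of "g - w" w] by simp
  then have "z - connecting w = (z - connecting g) + connecting (g - w)" by simp
  ultimately have "z - connecting w \<in> coboundaries N s t m (Suc 0)"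
    using cochain.subspace_add[OF coboundaries_subspace g] by (simp only:)
  then show "\<exists>w\<in>fv.span bw. z - connecting w \<in> coboundaries N s t m (Suc 0)" using vw(1) by blast
qed

lemma h_End_ge_2: "h_End N s t m (Suc (Suc p)) = 0"
proof -
  let ?\<sigma> = "\<lambda>_ :: nat \<Rightarrow> complex. 0 :: cochain"
  have "h_End N s t m (Suc (Suc p)) = card ({} :: (nat \<Rightarrow> complex) set)"
    unfolding h_End_def
  proof (rule quotient_dim_eq[where \<sigma> = ?\<sigma>, OF _ _ fv.independent_empty finite.emptyI coboundaries_subspace])
    have "coboundary 0 = 0" using coboundary_minus[of 0 0] by simp
    then show "?\<sigma> w \<in> cocycles N s t m (Suc (Suc p))" for w
      unfolding cocycles_def
      using cochain.subspace_0[OF null_cochains_subspace] cochain.subspace_0[OF cochains_subspace] by simp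
    show "\<exists>w\<in>fv.span {}. z - ?\<sigma> w \<in> coboundaries N s t m (Suc (Suc p))"
      if "z \<in> cocycles N s t m (Suc (Suc p))" for z
      using cocycle_ge_2_coboundary[OF that] by simp
  qed (simp_all add: cochain.scale_zero_right)
  then show ?thesis by simp
qed

lemma chi_End_eq: "chi_End N s t m = int (h_End N s t m 0) - int (h_End N s t m (Suc 0))"
proof -
  have "chi_End N s t m = (\<Sum>p\<in>{0, Suc 0}. (- 1) ^ p * int (h_End N s t m p))"
    unfolding chi_End_def
  proof (rule sum.mono_neutral_right)
    show "\<forall>p\<in>{..<N} - {0, Suc 0}. (- 1) ^ p * int (h_End N s t m p) = 0"
    proof
      fix p assume "p \<in> {..<N} - {0, Suc 0}"
      then have "p \<noteq> 0" "p \<noteq> Suc 0" by auto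
      then obtain k where "p = Suc (Suc k)" by (metis not0_implies_Suc)
      then show "(- 1) ^ p * int (h_End N s t m p) = 0" by (simp add: h_End_ge_2)
    qed
  qed (use N in auto)
  then show ?thesis by simp
qed

lemma h_End_difference:
  "int (h_End N s t m 0) - int (h_End N s t m (Suc 0)) = (int s)^2 - int N * int s * int t + (int t)^2"
proof -
  obtain bk bw where bk: "finite bk" "fv.independent bk"
      "fv.span bk = {v \<in> affine_space (pair_index s t). pair_defect N s t m v = 0}"
    and bw: "finite bw" "fv.independent bw" "fv.span bw \<subseteq> affine_space (morph_index N s t)"
      "\<forall>v\<in>affine_space (pair_index s t). pair_defect N s t m v \<in> fv.span bw \<longrightarrow> pair_defect N s t m v = 0"
      "\<forall>y\<in>affine_space (morph_index N s t). \<exists>v\<in>affine_space (pair_index s t). \<exists>w\<in>fv.span bw.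
        y = pair_defect N s t m v + w"
    and c: "card bk + card (morph_index N s t) = card bw + card (pair_index s t)"
    using kernel_cokernel[of "pair_defect N s t m" "pair_index s t" "morph_index N s t",
        OF pair_defect_add pair_defect_scale pair_index_finite morph_index_finite pair_defect_affine]
    by (elim exE conjE) rule
  have "int (card bk + N * (t * s)) = int (card bw + (t^2 + s^2))"
    using c unfolding morph_index_card pair_index_card by (simp only:)
  then show ?thesis unfolding h_End_0[OF bk] h_End_1[OF bw] by (simp add: algebra_simps)
qed

text \<open>The kernel of the defect map is the line spanned by the identity pair, which is nonzero
  as t \<ge> 1.\<close>

lemma brick_imp_simple:
  assumes b: "brick N s t m" shows "simple_bundle N s t m"
proof -
  have t: "t \<ge> 1" using steiner by (auto simp: steiner_bundle_def)
  define Ker where "Ker = {v \<in> affine_space (pair_index s t). pair_defect N s t m v = 0}"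
  have "\<exists>bk. finite bk \<and> fv.independent bk \<and> fv.span bk = Ker"
    using kernel_cokernel[of "pair_defect N s t m" "pair_index s t" "morph_index N s t",
        OF pair_defect_add pair_defect_scale pair_index_finite morph_index_finite pair_defect_affine]
    unfolding Ker_def by (elim exE conjE) (intro exI conjI)
  then obtain bk where bk: "finite bk" "fv.independent bk" "fv.span bk = Ker" by blast
  define \<iota> where "\<iota> = (\<lambda>a b :: nat. if a = b then 1 else 0 :: complex)"
  define e where "e = pair_vec s t \<iota> \<iota>"
  have "intertwines N s t m \<iota> \<iota>"
    by (simp add: intertwines_def \<iota>_def if_distrib[of "\<lambda>z. z * _"] if_distrib[of "\<lambda>z. _ * z"] cong: if_cong)
  then have eK: "e \<in> Ker" unfolding Ker_def e_def using pair_vec_affine pair_defect_pair_vec by blast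
  have "e (0, 0, 0) = 1" using t by (simp add: e_def pair_vec_def \<iota>_def)
  then have e0: "e \<noteq> 0" by auto
  have "Ker \<subseteq> fv.span {e}"
  proof
    fix v assume "v \<in> Ker"
    then have v: "v \<in> affine_space (pair_index s t)"
      and "intertwines N s t m (\<lambda>a b. v (0, a, b)) (\<lambda>a b. v (1, a, b))"
      by (auto simp: Ker_def pair_defect_zero_iff)
    then obtain k where k: "scalar_mat t (\<lambda>a b. v (0, a, b)) k" "scalar_mat s (\<lambda>a b. v (1, a, b)) k"
      using b unfolding brick_def by blast
    have "v i = fscale k e i" for i
    proof (cases "i \<in> pair_index s t")
      case True
      then show ?thesis using k
        by (auto simp: pair_index_def scalar_mat_def fscale_def e_def pair_vec_def \<iota>_def)
    next
      case False
      then show ?thesis using affine_space_outside[OF v] affine_space_outside[OF pair_vec_affine[of s t \<iota> \<iota>]]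
        by (simp add: fscale_def e_def)
    qed
    then have "v = fscale k e" by auto
    then show "v \<in> fv.span {e}" by (auto intro: fv.span_scale fv.span_base)
  qed
  then have "bk \<subseteq> fv.span {e}" using bk(3) fv.span_superset[of bk] by blast
  then have "card bk \<le> 1" using fv.independent_span_bound[OF _ bk(2), of "{e}"] by simp
  moreover have "bk \<noteq> {}" using bk(3) eK e0 by auto
  then have "card bk \<ge> 1" using bk(1) by (simp add: Suc_le_eq card_gt_0_iff)
  ultimately show ?thesis
    unfolding simple_bundle_def using h_End_0[OF bk(1,2) bk(3)[unfolded Ker_def]] by simp
qed

end

lemma zariski_open_affine_space: "zariski_open I (affine_space I)"
  unfolding zariski_open_def by (intro exI[of _ "{\<lambda>_. 1}"]) (auto intro: poly_fun.const)

theorem mainTheorem1: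
  fixes N s t :: nat
  assumes "N \<ge> 3"
  shows "\<exists>U. zariski_open (morph_index N s t) U \<and> U \<noteq> {} \<and>
    (\<forall>m\<in>U. steiner_bundle N s t m \<longrightarrow>
       (let q = (int s)^2 - int N * int s * int t + (int t)^2 in
         (simple_bundle N s t m \<longleftrightarrow> q \<le> 1) \<and>
         (q \<le> 1 \<longleftrightarrow> chi_End N s t m \<le> 1) \<and>
         (q \<le> 1 \<longleftrightarrow>
            q \<le> 0 \<or> (\<exists>k::nat. real t = a_seq N (k + 1) \<and> real s = a_seq N k)) \<and>
         (q \<le> 0 \<longleftrightarrow> real t \<le> (real N + sqrt (real N ^ 2 - 4)) / 2 * real s)))"
proof -
  define q where "q = (int s)^2 - int N * int s * int t + (int t)^2"
  \<comment> \<open>For q > 1 the whole space serves, because no Steiner bundle is simple then; a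
    proper open condition is imposed only to obtain simplicity.\<close>
  have "\<exists>U. zariski_open (morph_index N s t) U \<and> U \<noteq> {} \<and> (s < t \<longrightarrow> q \<le> 1 \<longrightarrow> (\<forall>m\<in>U. brick N s t m))"
  proof (cases "s < t \<and> q \<le> 1")
    case True
    then obtain m0 where "brick N s t m0" using brick_exists[OF assms, of s t] unfolding q_def by blast
    then show ?thesis using generic_brick[of t N s m0] True by auto
  next
    case False
    have "(\<lambda>_. 0) \<in> affine_space (morph_index N s t)" by (simp add: affine_space_def)
    then show ?thesis using zariski_open_affine_space False by blast
  qed
  then obtain U where U: "zariski_open (morph_index N s t) U" "U \<noteq> {}"
    and bU: "\<And>m. s < t \<Longrightarrow> q \<le> 1 \<Longrightarrow> m \<in> U \<Longrightarrow> brick N s t m" by blast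
  have "(simple_bundle N s t m \<longleftrightarrow> q \<le> 1) \<and> (q \<le> 1 \<longleftrightarrow> chi_End N s t m \<le> 1) \<and>
         (q \<le> 1 \<longleftrightarrow> q \<le> 0 \<or> (\<exists>k::nat. real t = a_seq N (k + 1) \<and> real s = a_seq N k)) \<and>
         (q \<le> 0 \<longleftrightarrow> real t \<le> (real N + sqrt (real N ^ 2 - 4)) / 2 * real s)"
    if mU: "m \<in> U" and m: "steiner_bundle N s t m" for m
  proof -
    interpret steiner N s t m using assms m by unfold_locales
    have st: "s < t" using m by (simp add: steiner_bundle_def)
    have d: "int (h_End N s t m 0) - int (h_End N s t m (Suc 0)) = q" unfolding q_def by (rule h_End_difference)
    \<comment> \<open>Simplicity gives q = 1 - h^1 \<le> 1 for every m; the converse is the brick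
      property on U.\<close>
    have "simple_bundle N s t m \<longleftrightarrow> q \<le> 1"
      using d brick_imp_simple[OF bU[OF st _ mU]] unfolding simple_bundle_def by auto
    moreover have "chi_End N s t m = q" using chi_End_eq d by simp
    ultimately show ?thesis
      using quadric_le_1_iff[OF assms st q_def] quadric_le_0_iff[OF assms st q_def] by simp
  qed
  then show ?thesis using U unfolding Let_def q_def by blast
qed

end
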